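(* Let $\Bbbk$ be an algebraically closed field, $q\in\Bbbk$ with $q\ne0,1$, $d\geq1$, $\ell\geq1$ and $\mathbf Q=(Q_1,\dots,Q_\ell)\in(\Bbbk^\times)^\ell$. The homology of the DG-algebra $(\mathcal H_d,\partial_{\mathbf Q})$ is concentrated in degree $0$ and is isomorphic to the cyclotomic $q$-Hecke algebra $H_d^{\mathbf Q}$.
   Context: $H_d$ (affine $q$-Hecke algebra) is the $\Bbbk$-algebra generated by $T_1,\dots,T_{d-1}$, $X_1^{\pm1},\dots,X_d^{\pm1}$ with relations $X_rX_r^{-1}=X_r^{-1}X_r=1$; $X_i^{\pm1}X_j^{\pm1}=X_j^{\pm1}X_i^{\pm1}$; $(T_i-q)(T_i+1)=0$; $T_iT_j=T_jT_i$ if $|i-j|>1$; $T_iT_{i+1}T_i=T_{i+1}T_iT_{i+1}$; $T_iX_j=X_jT_i$ if $j-i\ne0,1$; $T_iX_iT_i=qX_{i+1}$. The cyclotomic $q$-Hecke algebra $H_d^{\mathbf Q}$ is the quotient of $H_d$ by the two-sided ideal generated by $\prod_{r=1}^\ell(X_1-Q_r)$. $\mathcal H_d$ is the $\Bbbk$-algebra generated by $T_1,\dots,T_{d-1}$, $X_1^{\pm1},\dots,X_d^{\pm1}$ (in degree $\lambda=0$) and $\theta$ (in degree $\lambda=1$) with the relations $X_rX_r^{-1}=X_r^{-1}X_r=1$; $X_i^{\pm1}X_j^{\pm1}=X_j^{\pm1}X_i^{\pm1}$; $(T_i-q)(T_i+1)=0$; $T_iT_j=T_jT_i$ if $|i-j|>1$;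 $T_iT_{i+1}T_i=T_{i+1}T_iT_{i+1}$; $T_iX_j=X_jT_i$ if $j-i\ne0,1$; $T_iX_iT_i=qX_{i+1}$; together with $\theta^2=0$; $X_r^{\pm1}\theta=\theta X_r^{\pm1}$ for all $r$; $T_r\theta=\theta T_r$ for $r>1$; $T_1\theta T_1\theta+\theta T_1\theta T_1=(q-1)\theta T_1\theta$. The differential $\partial_{\mathbf Q}$ is the linear operator on $\mathcal H_d$ that is zero on $H_d$ (the subalgebra generated by the $T_i$ and $X_r^{\pm1}$), with $\partial_{\mathbf Q}(\theta)=\prod_{r=1}^\ell(X_1-Q_r)$ and $\partial_{\mathbf Q}(ab)=\partial_{\mathbf Q}(a)b+(-1)^{\lambda(a)}a\,\partial_{\mathbf Q}(b)$ for $a$ homogeneous. The homological degree is $\lambda$ (so $\partial_{\mathbf Q}$ lowers the degree by $1$). *)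

theory Defs
  imports
    "HOL-Algebra.Algebra"
    "HOL-Algebra.Algebraic_Closure_Type"
    "HOL-Library.Poly_Mapping"
begin

section \<open>Associative algebras over a field\<close>

text \<open>
  The library's locale \<^locale>\<open>algebra\<close> only covers commutative algebras.
  The scalars are the elements of a type of class \<^class>\<open>field\<close>.
\<close>

locale assoc_algebra =
  ring A + scalars: module "ring_of_type_algebra :: 'k::field ring" A
  for A :: "('k::field, 'a) module" (structure) +
  assumes smult_mult_left:
    "\<lbrakk>x \<in> carrier A; y \<in> carrier A\<rbrakk> \<Longrightarrow> c \<odot> (x \<otimes> y) = (c \<odot> x) \<otimes> y"
  and smult_mult_right:
    "\<lbrakk>x \<in> carrier A; y \<in> carrier A\<rbrakk> \<Longrightarrow> c \<odot> (x \<otimes> y) = x \<otimes> (c \<odot> y)"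

definition alg_iso :: "('k, 'a) module \<Rightarrow> ('k, 'b) module \<Rightarrow> ('a \<Rightarrow> 'b) set" where
  "alg_iso A B =
     {h \<in> ring_iso A B. \<forall>c. \<forall>x\<in>carrier A. h (c \<odot>\<^bsub>A\<^esub> x) = c \<odot>\<^bsub>B\<^esub> h x}"

text \<open>
  \<^const>\<open>FactRing\<close> forgets the scalar multiplication, so it is put back here; as in
  \<^const>\<open>rcoset_mult\<close>, the union is over representatives and the members coincide
  when \<open>I\<close> is an ideal. In a unital algebra every two-sided ideal is a linear subspace.
\<close>

definition quotient_algebra :: "('k, 'a) module \<Rightarrow> 'a set \<Rightarrow> ('k, 'a set) module" where
  "quotient_algebra A I =
     ring.extend (A Quot I) (module.fields (\<lambda>c C. \<Union>x\<in>C. I +>\<^bsub>A\<^esub> (c \<odot>\<^bsub>A\<^esub> x)))"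

definition subalgebra_generated :: "('k, 'a) module \<Rightarrow> 'a set \<Rightarrow> 'a set" where
  "subalgebra_generated A S = generate_ring A (S \<union> {c \<odot>\<^bsub>A\<^esub> \<one>\<^bsub>A\<^esub> |c. True})"


section \<open>Algebras given by generators and relations\<close>

text \<open>
  The free algebra is the monoid algebra of the free monoid. Since \<^const>\<open>times\<close> on
  \<^type>\<open>poly_mapping\<close> is convolution with respect to addition of the indices,
  concatenation of words is written additively.
\<close>

datatype 'g free_word = Word (letters: "'g list")

instantiation free_word :: (type) monoid_add
begin

definition zero_free_word :: "'a free_word" where
  "0 = Word []"

definition plus_free_word :: "'a free_word \<Rightarrow> 'a free_word \<Rightarrow> 'a free_word" where
  "u + v = Word (letters u @ letters v)"

instance
  by standard (simp_all add: zero_free_word_def plus_free_word_def)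

end

type_synonym ('g, 'k) free_alg = "'g free_word \<Rightarrow>\<^sub>0 'k"

definition free_gen :: "'g \<Rightarrow> ('g, 'k::field) free_alg" where
  "free_gen g = Poly_Mapping.single (Word [g]) 1"

definition free_const :: "'k \<Rightarrow> ('g, 'k::field) free_alg" where
  "free_const c = Poly_Mapping.single 0 c"

definition free_algebra :: "'g set \<Rightarrow> ('k::field, ('g, 'k) free_alg) module" where
  "free_algebra S =
     \<lparr>carrier = {f. \<forall>w\<in>Poly_Mapping.keys f. set (letters w) \<subseteq> S},
      monoid.mult = (*), one = 1, ring.zero = 0, add = (+),
      module.smult = (\<lambda>c f. free_const c * f)\<rparr>"

text \<open>A set of relators \<open>R\<close> stands for the relations \<open>r = 0\<close> with \<open>r \<in> R\<close>.\<close>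

definition relation_ideal ::
    "'g set \<Rightarrow> ('g, 'k::field) free_alg set \<Rightarrow> ('g, 'k) free_alg set" where
  "relation_ideal S R = genideal (free_algebra S) R"

definition presented_algebra ::
    "'g set \<Rightarrow> ('g, 'k::field) free_alg set \<Rightarrow> ('k, ('g, 'k) free_alg set) module" where
  "presented_algebra S R = quotient_algebra (free_algebra S) (relation_ideal S R)"

definition presented_class ::
    "'g set \<Rightarrow> ('g, 'k::field) free_alg set \<Rightarrow> ('g, 'k) free_alg \<Rightarrow> ('g, 'k) free_alg set" where
  "presented_class S R f = relation_ideal S R +>\<^bsub>free_algebra S\<^esub> f"


section \<open>DG-algebras and their homology\<close>

text \<open>
  Homological convention: the differential lowers the degree by one. \<open>G n\<close> is the
  homogeneous part of degree \<open>n\<close>; there is nothing in negative degrees.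
\<close>

definition graded_derivation :: "('k, 'a) module \<Rightarrow> (nat \<Rightarrow> 'a set) \<Rightarrow> ('a \<Rightarrow> 'a) \<Rightarrow> bool" where
  "graded_derivation A G D \<longleftrightarrow>
     D \<in> carrier A \<rightarrow> carrier A \<and>
     (\<forall>x\<in>carrier A. \<forall>y\<in>carrier A. D (x \<oplus>\<^bsub>A\<^esub> y) = D x \<oplus>\<^bsub>A\<^esub> D y) \<and>
     (\<forall>c. \<forall>x\<in>carrier A. D (c \<odot>\<^bsub>A\<^esub> x) = c \<odot>\<^bsub>A\<^esub> D x) \<and>
     (\<forall>n. \<forall>x\<in>G n. \<forall>y\<in>carrier A.
        D (x \<otimes>\<^bsub>A\<^esub> y) = D x \<otimes>\<^bsub>A\<^esub> y \<oplus>\<^bsub>A\<^esub> ((\<ominus>\<^bsub>A\<^esub> \<one>\<^bsub>A\<^esub>) [^]\<^bsub>A\<^esub> n) \<otimes>\<^bsub>A\<^esub> (x \<otimes>\<^bsub>A\<^esub> D y))"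

locale dg_algebra = assoc_algebra A
  for A :: "('k::field, 'a) module" (structure) +
  fixes G :: "nat \<Rightarrow> 'a set" and D :: "'a \<Rightarrow> 'a"
  assumes homogeneous_submodule: "submodule (G n) ring_of_type_algebra A"
    and direct_sum_decomposition: "x \<in> carrier A \<Longrightarrow>
      \<exists>!f. (\<forall>n. f n \<in> G n) \<and> finite {n. f n \<noteq> \<zero>} \<and> x = (\<Oplus>n\<in>{n. f n \<noteq> \<zero>}. f n)"
    and one_homogeneous: "\<one> \<in> G 0"
    and mult_homogeneous: "\<lbrakk>x \<in> G m; y \<in> G n\<rbrakk> \<Longrightarrow> x \<otimes> y \<in> G (m + n)"
    and derivation: "graded_derivation A G D"
    and lowers_degree: "x \<in> G (Suc n) \<Longrightarrow> D x \<in> G n"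
    and vanishes_in_degree_0: "x \<in> G 0 \<Longrightarrow> D x = \<zero>"
    and square_zero: "x \<in> carrier A \<Longrightarrow> D (D x) = \<zero>"

definition cycles :: "('k, 'a) module \<Rightarrow> ('a \<Rightarrow> 'a) \<Rightarrow> 'a set" where
  "cycles A D = {x \<in> carrier A. D x = \<zero>\<^bsub>A\<^esub>}"

definition boundaries :: "('k, 'a) module \<Rightarrow> ('a \<Rightarrow> 'a) \<Rightarrow> 'a set" where
  "boundaries A D = D ` carrier A"

definition homology :: "('k, 'a) module \<Rightarrow> ('a \<Rightarrow> 'a) \<Rightarrow> ('k, 'a set) module" where
  "homology A D = quotient_algebra (A\<lparr>carrier := cycles A D\<rparr>) (boundaries A D)"

definition homology_component ::
    "('k, 'a) module \<Rightarrow> (nat \<Rightarrow> 'a set) \<Rightarrow> ('a \<Rightarrow> 'a) \<Rightarrow> nat \<Rightarrow> 'a set set" where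
  "homology_component A G D n = (\<lambda>z. boundaries A D +>\<^bsub>A\<^esub> z) ` (G n \<inter> cycles A D)"


section \<open>Affine and cyclotomic Hecke algebras\<close>

datatype hecke_gen = GenT nat | GenX nat | GenXinv nat | GenTheta

abbreviation gT :: "nat \<Rightarrow> (hecke_gen, 'k::field) free_alg" where
  "gT i \<equiv> free_gen (GenT i)"

abbreviation gX :: "nat \<Rightarrow> (hecke_gen, 'k::field) free_alg" where
  "gX i \<equiv> free_gen (GenX i)"

abbreviation gXinv :: "nat \<Rightarrow> (hecke_gen, 'k::field) free_alg" where
  "gXinv i \<equiv> free_gen (GenXinv i)"

abbreviation gTheta :: "(hecke_gen, 'k::field) free_alg" where
  "gTheta \<equiv> free_gen GenTheta"

definition affine_gens :: "nat \<Rightarrow> hecke_gen set" where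
  "affine_gens d = GenT ` {1..<d} \<union> GenX ` {1..d} \<union> GenXinv ` {1..d}"

definition affine_relators :: "nat \<Rightarrow> 'k::field \<Rightarrow> (hecke_gen, 'k) free_alg set" where
  "affine_relators d q =
     {gX r * gXinv r - 1 |r. r \<in> {1..d}} \<union>
     {gXinv r * gX r - 1 |r. r \<in> {1..d}} \<union>
     {x * y - y * x |x y i j. i \<in> {1..d} \<and> j \<in> {1..d} \<and> x \<in> {gX i, gXinv i} \<and> y \<in> {gX j, gXinv j}} \<union>
     {(gT i - free_const q) * (gT i + 1) |i. i \<in> {1..<d}} \<union>
     {gT i * gT j - gT j * gT i |i j. i \<in> {1..<d} \<and> j \<in> {1..<d} \<and> \<bar>int i - int j\<bar> > 1} \<union>
     {gT i * gT (i + 1) * gT i - gT (i + 1) * gT i * gT (i + 1) |i. i \<in> {1..<d} \<and> i + 1 \<in> {1..<d}} \<union>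
     {gT i * gX j - gX j * gT i |i j. i \<in> {1..<d} \<and> j \<in> {1..d} \<and> int j - int i \<notin> {0, 1}} \<union>
     {gT i * gX i * gT i - free_const q * gX (i + 1) |i. i \<in> {1..<d}}"

definition affine_hecke ::
    "nat \<Rightarrow> 'k::field \<Rightarrow> ('k, (hecke_gen, 'k) free_alg set) module" where
  "affine_hecke d q = presented_algebra (affine_gens d) (affine_relators d q)"

definition affine_hecke_X1 :: "nat \<Rightarrow> 'k::field \<Rightarrow> (hecke_gen, 'k) free_alg set" where
  "affine_hecke_X1 d q = presented_class (affine_gens d) (affine_relators d q) (gX 1)"

text \<open>The product of all \<open>x - Q\<^sub>r\<close>, where the tuple \<open>(Q\<^sub>1, \<dots>, Q\<^sub>l)\<close> is given as a list.\<close>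

definition cyclotomic_element :: "('k, 'a) module \<Rightarrow> 'a \<Rightarrow> 'k list \<Rightarrow> 'a" where
  "cyclotomic_element A x Qs =
     foldr (\<lambda>c y. (x \<ominus>\<^bsub>A\<^esub> c \<odot>\<^bsub>A\<^esub> \<one>\<^bsub>A\<^esub>) \<otimes>\<^bsub>A\<^esub> y) Qs \<one>\<^bsub>A\<^esub>"

definition cyclotomic_hecke ::
    "nat \<Rightarrow> 'k::field \<Rightarrow> 'k list \<Rightarrow> ('k, (hecke_gen, 'k) free_alg set set) module" where
  "cyclotomic_hecke d q Qs =
     quotient_algebra (affine_hecke d q)
       (genideal (affine_hecke d q)
          {cyclotomic_element (affine_hecke d q) (affine_hecke_X1 d q) Qs})"


section \<open>The DG-enhancement of the affine Hecke algebra\<close>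

definition dg_gens :: "nat \<Rightarrow> hecke_gen set" where
  "dg_gens d = insert GenTheta (affine_gens d)"

text \<open>For \<open>d = 1\<close> there is no \<open>T\<^sub>1\<close>, hence the last relation is only imposed for \<open>d > 1\<close>.\<close>

definition dg_relators :: "nat \<Rightarrow> 'k::field \<Rightarrow> (hecke_gen, 'k) free_alg set" where
  "dg_relators d q =
     affine_relators d q \<union>
     {gTheta * gTheta} \<union>
     {gX r * gTheta - gTheta * gX r |r. r \<in> {1..d}} \<union>
     {gXinv r * gTheta - gTheta * gXinv r |r. r \<in> {1..d}} \<union>
     {gT r * gTheta - gTheta * gT r |r. r \<in> {1..<d} \<and> r > 1} \<union>
     (if d > 1
      then {gT 1 * gTheta * gT 1 * gTheta + gTheta * gT 1 * gTheta * gT 1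
              - free_const (q - 1) * gTheta * gT 1 * gTheta}
      else {})"

definition dg_hecke ::
    "nat \<Rightarrow> 'k::field \<Rightarrow> ('k, (hecke_gen, 'k) free_alg set) module" where
  "dg_hecke d q = presented_algebra (dg_gens d) (dg_relators d q)"

definition dg_class ::
    "nat \<Rightarrow> 'k::field \<Rightarrow> (hecke_gen, 'k) free_alg \<Rightarrow> (hecke_gen, 'k) free_alg set" where
  "dg_class d q = presented_class (dg_gens d) (dg_relators d q)"

text \<open>The degree \<open>\<lambda>\<close> of a word is its number of occurrences of \<open>\<theta>\<close>.\<close>

definition dg_degree :: "nat \<Rightarrow> 'k::field \<Rightarrow> nat \<Rightarrow> (hecke_gen, 'k) free_alg set set" where
  "dg_degree d q n =
     dg_class d q `
       {f \<in> carrier (free_algebra (dg_gens d)).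
          \<forall>w\<in>Poly_Mapping.keys f. count_list (letters w) GenTheta = n}"

definition is_dg_differential ::
    "nat \<Rightarrow> 'k::field \<Rightarrow> 'k list
      \<Rightarrow> ((hecke_gen, 'k) free_alg set \<Rightarrow> (hecke_gen, 'k) free_alg set) \<Rightarrow> bool" where
  "is_dg_differential d q Qs D \<longleftrightarrow>
     graded_derivation (dg_hecke d q) (dg_degree d q) D \<and>
     (\<forall>x\<in>subalgebra_generated (dg_hecke d q) ((\<lambda>g. dg_class d q (free_gen g)) ` affine_gens d).
        D x = \<zero>\<^bsub>dg_hecke d q\<^esub>) \<and>
     D (dg_class d q gTheta) = cyclotomic_element (dg_hecke d q) (dg_class d q (gX 1)) Qs"

text \<open>
  The conditions determine the differential on the carrier, and
  \<^const>\<open>extensional\<close> fixes the irrelevant values outside of it.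
\<close>

definition dg_differential ::
    "nat \<Rightarrow> 'k::field \<Rightarrow> 'k list
      \<Rightarrow> (hecke_gen, 'k) free_alg set \<Rightarrow> (hecke_gen, 'k) free_alg set" where
  "dg_differential d q Qs =
     (THE D. D \<in> extensional (carrier (dg_hecke d q)) \<and> is_dg_differential d q Qs D)"

end

theory Submission
  imports Defs
begin

text \<open>
  Write \<open>A\<close> for the algebra attached to \<open>k - 1\<close> and \<open>S\<^sub>i\<close> for the inverse of \<open>T\<^sub>i\<close>. The algebra
  attached to \<open>k\<close> is a free right module over \<open>A[X\<^sub>k, X\<^sub>k\<inverse>]\<close> with basis the \<open>2k\<close> elements
  \<open>S\<^sub>j \<cdots> S\<^bsub>k-1\<^esub>\<close> with \<open>1 \<le> j \<le> k\<close> and \<open>T\<^sub>j \<cdots> T\<^sub>1 \<theta> S\<^sub>1 \<cdots> S\<^bsub>k-1\<^esub>\<close> with \<open>j < k\<close>. That they span follows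
  from the relations; independence is detected by Demazure-Lusztig operators with generic
  parameters, which also yield a faithful family of representations. In particular the
  differential of the free algebra descends, since it is enough to test this in the representations.

  Acyclicity in positive degrees is proved by induction on \<open>k\<close>. The differential maps the \<open>j\<close>-th basis
  element containing \<open>\<theta>\<close> to the \<open>(j + 1)\<close>-st one without \<open>\<theta>\<close>, multiplied by \<open>X\<^sub>k\<^sup>l\<close>, plus terms of
  lower degree in \<open>X\<^sub>k\<close>. The coefficients in \<open>A\<close> of a cycle can therefore be removed by induction,
  apart from degree-zero coefficients of the elements with \<open>\<theta>\<close>, and those vanish by comparing
  leading degrees in \<open>X\<^sub>k\<close>. The image of the differential in degree zero is the ideal
  generated by \<open>\<partial>(\<theta>)\<close>.
\<close>


section \<open>Two-sided ideals of a ring\<close>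

text \<open>Using inverses in the basis is what makes it triangular: X_i S_i = S_i X_{i+1} - (1 -
  1/q) X_i leaves a correction in the smaller algebra, whereas moving X_i past T_i would leave a
  multiple of X_{i+1} and hence terms of top degree. The inverses also telescope, T_j ... T_1 S_1
  ... S_{k-1} = S_{j+1} ... S_{k-1}, which pairs the two halves of the basis under the differential.
  The lower terms have coefficients free of \<theta>, so passing to \<theta>-degree zero commutes
  with multiplication by them and the leading degrees can be compared among degree-zero coefficients
  alone. The delicate relation is the one with two \<theta>: its image under the differential has to
  follow from the relations. Faithfulness replaces a derivation by a check of the four occupation
  patterns of two positions. It requires infinitely many labels, which an algebraically closed field
  supplies. The induction starts at k = 0 with the ground field. All calculations take place in the
  free algebra modulo a two-sided ideal; quotient algebras enter only at the end.\<close>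

inductive_set ideal_hull :: "'a::ring_1 set \<Rightarrow> 'a set" for R where
  zero: "0 \<in> ideal_hull R"
| add: "r \<in> R \<Longrightarrow> f \<in> ideal_hull R \<Longrightarrow> u * r * v + f \<in> ideal_hull R"

lemma ideal_hull_incl: "r \<in> R \<Longrightarrow> r \<in> ideal_hull R"
  using ideal_hull.add[OF _ ideal_hull.zero, of r R 1 1] by simp

lemma ideal_hull_add: "a \<in> ideal_hull R \<Longrightarrow> b \<in> ideal_hull R \<Longrightarrow> a + b \<in> ideal_hull R"
  by (induction rule: ideal_hull.induct) (auto simp: add.assoc intro: ideal_hull.add)

lemma ideal_hull_mult_left: "a \<in> ideal_hull R \<Longrightarrow> x * a \<in> ideal_hull R"
proof (induction rule: ideal_hull.induct)
  case (add r f u v)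
  then show ?case using ideal_hull.add[of r R "x * f" "x * u" v] by (simp add: algebra_simps)
qed (simp add: ideal_hull.zero)

lemma ideal_hull_mult_right: "a \<in> ideal_hull R \<Longrightarrow> a * x \<in> ideal_hull R"
proof (induction rule: ideal_hull.induct)
  case (add r f u v)
  then show ?case using ideal_hull.add[of r R "f * x" u "v * x"] by (simp add: algebra_simps)
qed (simp add: ideal_hull.zero)

lemma ideal_hull_uminus: "a \<in> ideal_hull R \<Longrightarrow> - a \<in> ideal_hull R"
  using ideal_hull_mult_left[of a R "- 1"] by simp

lemma ideal_hull_diff: "a \<in> ideal_hull R \<Longrightarrow> b \<in> ideal_hull R \<Longrightarrow> a - b \<in> ideal_hull R"
  using ideal_hull_add[OF _ ideal_hull_uminus, of a R b] by simp

lemma ideal_hull_sum: "(\<And>i. i \<in> I \<Longrightarrow> f i \<in> ideal_hull R) \<Longrightarrow> sum f I \<in> ideal_hull R"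
  by (induction I rule: infinite_finite_induct) (auto intro: ideal_hull_add ideal_hull.zero)

lemma ideal_hull_subset:
  assumes "R \<subseteq> ideal_hull R'"
  shows "ideal_hull R \<subseteq> ideal_hull R'"
proof
  fix x assume "x \<in> ideal_hull R"
  then show "x \<in> ideal_hull R'"
  proof induction
    case (add r f u v)
    then have "u * r * v \<in> ideal_hull R'"
      using assms by (blast intro: ideal_hull_mult_left ideal_hull_mult_right)
    then show ?case using add by (simp add: ideal_hull_add)
  qed (rule ideal_hull.zero)
qed

text \<open>Stands for equality in the quotient, so that calculations in a presented algebra can be
  chained on representatives in the free algebra.\<close>

definition cong_ideal :: "'a::ring_1 set \<Rightarrow> 'a \<Rightarrow> 'a \<Rightarrow> bool" where
  "cong_ideal R a b \<longleftrightarrow> a - b \<in> ideal_hull R"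

lemma cong_ideal_refl [simp]: "cong_ideal R a a"
  by (simp add: cong_ideal_def ideal_hull.zero)

lemma cong_ideal_sym: "cong_ideal R a b \<Longrightarrow> cong_ideal R b a"
  unfolding cong_ideal_def using ideal_hull_uminus[of "a - b" R] by simp

lemma cong_ideal_trans [trans]: "cong_ideal R a b \<Longrightarrow> cong_ideal R b c \<Longrightarrow> cong_ideal R a c"
  unfolding cong_ideal_def using ideal_hull_add[of "a - b" R "b - c"] by simp

lemma cong_ideal_add:
  "cong_ideal R a b \<Longrightarrow> cong_ideal R c d \<Longrightarrow> cong_ideal R (a + c) (b + d)"
  unfolding cong_ideal_def using ideal_hull_add[of "a - b" R "c - d"] by (simp add: algebra_simps)

lemma cong_ideal_uminus: "cong_ideal R a b \<Longrightarrow> cong_ideal R (- a) (- b)"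
  unfolding cong_ideal_def using ideal_hull_uminus[of "a - b" R] by (simp add: algebra_simps)

lemma cong_ideal_diff:
  "cong_ideal R a b \<Longrightarrow> cong_ideal R c d \<Longrightarrow> cong_ideal R (a - c) (b - d)"
  unfolding cong_ideal_def using ideal_hull_diff[of "a - b" R "c - d"] by (simp add: algebra_simps)

lemma cong_ideal_mult:
  assumes "cong_ideal R a b" "cong_ideal R c d"
  shows "cong_ideal R (a * c) (b * d)"
proof -
  have "a * c - b * d = (a - b) * c + b * (c - d)" by (simp add: algebra_simps)
  then show ?thesis using assms unfolding cong_ideal_def
    by (metis ideal_hull_add ideal_hull_mult_left ideal_hull_mult_right)
qed

lemma cong_ideal_sum:
  "(\<And>i. i \<in> I \<Longrightarrow> cong_ideal R (f i) (g i)) \<Longrightarrow> cong_ideal R (sum f I) (sum g I)"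
  by (induction I rule: infinite_finite_induct) (auto intro: cong_ideal_add)

lemma cong_ideal_0_iff: "cong_ideal R a 0 \<longleftrightarrow> a \<in> ideal_hull R"
  by (simp add: cong_ideal_def)

lemma cong_ideal_mem_iff: "cong_ideal R a b \<Longrightarrow> a \<in> ideal_hull R \<longleftrightarrow> b \<in> ideal_hull R"
  by (metis cong_ideal_0_iff cong_ideal_sym cong_ideal_trans)

lemma cong_ideal_incl: "a - b \<in> R \<Longrightarrow> cong_ideal R a b"
  by (simp add: cong_ideal_def ideal_hull_incl)

section \<open>The free algebra\<close>

definition free_span :: "'g set \<Rightarrow> ('g, 'k::field) free_alg set" where
  "free_span S = {f. \<forall>w\<in>Poly_Mapping.keys f. set (letters w) \<subseteq> S}"

abbreviation word_term :: "'g list \<Rightarrow> 'k \<Rightarrow> ('g, 'k::field) free_alg" where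
  "word_term u c \<equiv> Poly_Mapping.single (Word u) c"

lemma Word_plus: "Word u + Word v = Word (u @ v)"
  by (simp add: plus_free_word_def)

lemma letters_plus: "letters (u + v) = letters u @ letters v"
  by (simp add: plus_free_word_def)

lemma letters_zero [simp]: "letters 0 = []"
  by (simp add: zero_free_word_def)

lemma word_term_mult: "word_term u c * word_term v e = word_term (u @ v) (c * e)"
  by (simp add: mult_single Word_plus)

lemma free_const_eq: "free_const c = word_term [] c"
  by (simp add: free_const_def zero_free_word_def)

lemma free_const_mult_word_term: "free_const c * word_term u e = word_term u (c * e)"
  by (simp add: free_const_eq word_term_mult)

lemma free_const_0 [simp]: "free_const 0 = 0"
  and free_const_1 [simp]: "free_const 1 = 1"
  by (simp_all add: free_const_def)

lemma free_const_add: "free_const (c + e) = free_const c + free_const e"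
  and free_const_diff: "free_const (c - e) = free_const c - free_const e"
  and free_const_uminus: "free_const (- c) = - free_const c"
  and free_const_mult: "free_const (c * e) = free_const c * free_const e"
  by (simp_all add: free_const_def single_add single_diff single_uminus mult_single)

lemma word_term_Cons: "word_term (g # u) c = free_gen g * word_term u c"
  by (simp add: free_gen_def word_term_mult)

lemma free_span_mono: "S \<subseteq> S' \<Longrightarrow> free_span S \<subseteq> free_span S'"
  unfolding free_span_def by blast

lemma free_span_0 [simp]: "0 \<in> free_span S"
  and free_span_1 [simp]: "1 \<in> free_span S"
  by (auto simp: free_span_def)

lemma free_span_word_term: "set u \<subseteq> S \<Longrightarrow> word_term u c \<in> free_span S"
  by (auto simp: free_span_def split: if_splits)

lemma free_span_const [simp]: "free_const c \<in> free_span S"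
  by (simp add: free_const_eq free_span_word_term)

lemma free_span_gen [simp]: "free_gen g \<in> free_span S \<longleftrightarrow> g \<in> S"
  by (auto simp: free_span_def free_gen_def)

lemma free_span_add: "f \<in> free_span S \<Longrightarrow> g \<in> free_span S \<Longrightarrow> f + g \<in> free_span S"
  unfolding free_span_def using keys_add[of f g] by blast

lemma free_span_mult:
  assumes "f \<in> free_span S" "g \<in> free_span S"
  shows "f * g \<in> free_span S"
proof -
  have "set (letters w) \<subseteq> S" if w: "w \<in> Poly_Mapping.keys (f * g)" for w
  proof -
    obtain u v where "w = u + v" "u \<in> Poly_Mapping.keys f" "v \<in> Poly_Mapping.keys g"
      using subsetD[OF keys_mult w] by auto
    then show ?thesis using assms by (auto simp: free_span_def letters_plus)
  qed
  then show ?thesis by (simp add: free_span_def)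
qed

lemma free_span_uminus: "f \<in> free_span S \<Longrightarrow> - f \<in> free_span S"
  using free_span_mult[OF free_span_const, of f S "- 1"] by (simp add: free_const_uminus)

lemma free_span_diff: "f \<in> free_span S \<Longrightarrow> g \<in> free_span S \<Longrightarrow> f - g \<in> free_span S"
  using free_span_add[OF _ free_span_uminus, of f S g] by simp

lemma free_span_sum: "(\<And>i. i \<in> I \<Longrightarrow> f i \<in> free_span S) \<Longrightarrow> sum f I \<in> free_span S"
  by (induction I rule: infinite_finite_induct) (auto intro: free_span_add)

lemmas free_span_intros =
  free_span_add free_span_mult free_span_uminus free_span_diff free_span_sum

lemma free_span_UNIV [simp]: "f \<in> free_span UNIV"
  by (simp add: free_span_def)

lemma poly_mapping_eq_sum_single: "f = (\<Sum>w\<in>Poly_Mapping.keys f. Poly_Mapping.single w (Poly_Mapping.lookup f w))"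
  by (rule poly_mapping_eqI) (auto simp: lookup_sum lookup_single when_def in_keys_iff)

lemma free_span_induct [consumes 1, case_names word add]:
  assumes "f \<in> free_span S"
    and "\<And>c u. set u \<subseteq> S \<Longrightarrow> P (word_term u c)"
    and "\<And>f g. f \<in> free_span S \<Longrightarrow> g \<in> free_span S \<Longrightarrow> P f \<Longrightarrow> P g \<Longrightarrow> P (f + g)"
  shows "P f"
proof -
  have single: "Poly_Mapping.single w c \<in> free_span S \<and> P (Poly_Mapping.single w c)"
    if "set (letters w) \<subseteq> S" for w c
    using that assms(2)[of "letters w" c] free_span_word_term[of "letters w" S c] by simp
  have "(\<Sum>w\<in>W. Poly_Mapping.single w (Poly_Mapping.lookup f w)) \<in> free_span S \<and>
      P (\<Sum>w\<in>W. Poly_Mapping.single w (Poly_Mapping.lookup f w))"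
    if "finite W" "\<forall>w\<in>W. set (letters w) \<subseteq> S" for W
    using that
  proof (induction W rule: finite_induct)
    case empty
    then show ?case using assms(2)[of "[]" 0] by simp
  next
    case (insert w W)
    then show ?case using assms(3) single free_span_add by fastforce
  qed
  from this[of "Poly_Mapping.keys f"] show ?thesis
    using assms(1) poly_mapping_eq_sum_single[of f] by (simp add: free_span_def)
qed

lemma free_alg_induct [case_names word add]:
  assumes "\<And>c u. P (word_term u c)" and "\<And>f g. P f \<Longrightarrow> P g \<Longrightarrow> P (f + g)"
  shows "P f"
  using free_span_induct[of f UNIV P] assms by auto

lemma free_const_commute: "free_const c * f = f * free_const c"
  by (induction f rule: free_alg_induct)
    (simp_all add: free_const_eq word_term_mult mult.commute algebra_simps)

text \<open>A linear projection that serves three purposes: keeping the words over a set of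
  generators, the words without \<theta> (\<open>theta_free\<close>), and the words with exactly n
  letters \<theta> (\<open>theta_part\<close>).\<close>

definition restrict_words :: "('g list \<Rightarrow> bool) \<Rightarrow> ('g, 'k::field) free_alg \<Rightarrow> ('g, 'k) free_alg" where
  "restrict_words P f = Poly_Mapping.mapp (\<lambda>w c. c when P (letters w)) f"

lemma lookup_restrict_words: "Poly_Mapping.lookup (restrict_words P f) w = (Poly_Mapping.lookup f w when P (letters w))"
  by (auto simp: restrict_words_def lookup_mapp in_keys_iff when_def)

lemma restrict_words_0 [simp]: "restrict_words P 0 = 0"
  by (rule poly_mapping_eqI) (simp add: lookup_restrict_words)

lemma restrict_words_add: "restrict_words P (f + g) = restrict_words P f + restrict_words P g"
  by (rule poly_mapping_eqI) (simp add: lookup_restrict_words lookup_add when_add_distrib)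

lemma restrict_words_diff: "restrict_words P (f - g) = restrict_words P f - restrict_words P g"
  by (rule poly_mapping_eqI) (simp add: lookup_restrict_words lookup_minus when_diff_distrib)

lemma restrict_words_uminus: "restrict_words P (- f) = - restrict_words P f"
  using restrict_words_diff[of P 0 f] by simp

lemma restrict_words_sum: "restrict_words P (sum f I) = (\<Sum>i\<in>I. restrict_words P (f i))"
  by (induction I rule: infinite_finite_induct) (auto simp: restrict_words_add)

lemma restrict_words_word_term:
  "restrict_words P (word_term u c) = (if P u then word_term u c else 0)"
  by (rule poly_mapping_eqI) (auto simp: lookup_restrict_words lookup_single when_def)

lemma restrict_words_free_span: "f \<in> free_span S \<Longrightarrow> restrict_words P f \<in> free_span S"
  by (auto simp: free_span_def in_keys_iff lookup_restrict_words when_def split: if_splits)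

text \<open>Under this condition the words violating \<open>P\<close> span a two-sided ideal, and
  the projection is the quotient map onto a subalgebra.\<close>

lemma restrict_words_mult:
  assumes "\<And>u v. P (u @ v) \<longleftrightarrow> P u \<and> P v"
  shows "restrict_words P (f * g) = restrict_words P f * restrict_words P g"
proof (induction f rule: free_alg_induct)
  case (word c u)
  show ?case
  proof (induction g rule: free_alg_induct)
    case (word e v)
    then show ?case using assms by (simp add: word_term_mult restrict_words_word_term)
  qed (simp add: algebra_simps restrict_words_add)
qed (simp add: algebra_simps restrict_words_add)

lemma restrict_words_ident:
  "(\<And>w. w \<in> Poly_Mapping.keys f \<Longrightarrow> P (letters w)) \<Longrightarrow> restrict_words P f = f"
  by (rule poly_mapping_eqI) (auto simp: lookup_restrict_words when_def in_keys_iff)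

section \<open>Comparison with the carrier-based free algebra and its ideals\<close>

lemma carrier_free_algebra: "carrier (free_algebra S) = free_span S"
  by (simp add: free_algebra_def free_span_def)

lemma free_algebra_simps [simp]:
  "x \<otimes>\<^bsub>free_algebra S\<^esub> y = x * y" "\<one>\<^bsub>free_algebra S\<^esub> = 1"
  "\<zero>\<^bsub>free_algebra S\<^esub> = 0" "x \<oplus>\<^bsub>free_algebra S\<^esub> y = x + y"
  "c \<odot>\<^bsub>free_algebra S\<^esub> x = free_const c * x"
  by (simp_all add: free_algebra_def)

lemma ring_free_algebra: "ring (free_algebra S)"
proof (rule ringI)
  show "abelian_group (free_algebra S)"
  proof (rule abelian_groupI)
    fix x assume "x \<in> carrier (free_algebra S)"
    then show "\<exists>y\<in>carrier (free_algebra S). y \<oplus>\<^bsub>free_algebra S\<^esub> x = \<zero>\<^bsub>free_algebra S\<^esub>"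
      by (intro bexI[of _ "- x"]) (auto simp: carrier_free_algebra free_span_uminus)
  qed (auto simp: carrier_free_algebra free_span_add algebra_simps)
  show "Group.monoid (free_algebra S)"
    by (rule monoidI) (auto simp: carrier_free_algebra free_span_mult algebra_simps)
qed (auto simp: algebra_simps)

text \<open>\<open>ideal_hull\<close> allows multipliers with letters outside \<open>S\<close>. This
  does not enlarge the ideal: the projection \<open>p\<close> onto \<open>free_span S\<close> is
  multiplicative and fixes the relators, so it sends u r v to (p u) r (p v), which lies in the ideal
  of the small algebra.\<close>

lemma relation_ideal_eq:
  fixes R :: "('g, 'k::field) free_alg set"
  assumes "R \<subseteq> free_span S"
  shows "relation_ideal S R = ideal_hull R \<inter> free_span S"
proof
  interpret F: ring "free_algebra S" by (rule ring_free_algebra)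
  have uminus: "\<ominus>\<^bsub>free_algebra S\<^esub> x = - x" if "x \<in> free_span S" for x
    using that by (intro F.minus_equality) (auto simp: carrier_free_algebra free_span_uminus)
  have "ideal (ideal_hull R \<inter> free_span S) (free_algebra S)"
  proof (rule idealI)
    show "subgroup (ideal_hull R \<inter> free_span S) (add_monoid (free_algebra S))"
    proof (rule group.subgroupI[OF F.add.is_group])
      show "inv\<^bsub>add_monoid (free_algebra S)\<^esub> a \<in> ideal_hull R \<inter> free_span S"
        if "a \<in> ideal_hull R \<inter> free_span S" for a
        using that uminus[of a] unfolding a_inv_def
        by (auto simp del: free_algebra_simps simp: free_span_uminus ideal_hull_uminus)
    qed (auto simp: carrier_free_algebra intro: ideal_hull_add free_span_add ideal_hull.zero)
  qed (auto simp: carrier_free_algebra intro: ideal_hull_mult_left ideal_hull_mult_right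
      free_span_mult ring_free_algebra)
  then show "relation_ideal S R \<subseteq> ideal_hull R \<inter> free_span S"
    unfolding relation_ideal_def
    by (rule F.genideal_minimal) (use assms in \<open>auto intro: ideal_hull_incl\<close>)
  interpret I: ideal "relation_ideal S R" "free_algebra S"
    unfolding relation_ideal_def
    by (rule F.genideal_ideal) (use assms in \<open>simp add: carrier_free_algebra\<close>)
  have R: "R \<subseteq> relation_ideal S R"
    unfolding relation_ideal_def
    by (rule F.genideal_self) (use assms in \<open>simp add: carrier_free_algebra\<close>)
  define p :: "('g, 'k) free_alg \<Rightarrow> ('g, 'k) free_alg"
    where "p = restrict_words (\<lambda>u. set u \<subseteq> S)"
  have p_S: "p f \<in> free_span S" for f :: "('g, 'k) free_alg"
    by (auto simp: p_def free_span_def in_keys_iff lookup_restrict_words when_def split: if_splits)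
  have p_id: "p f = f" if "f \<in> free_span S" for f :: "('g, 'k) free_alg"
    using that unfolding p_def free_span_def by (intro restrict_words_ident) auto
  have p_mult: "p (f * g) = p f * p g" for f g :: "('g, 'k) free_alg"
    unfolding p_def by (rule restrict_words_mult) auto
  have p_I: "p f \<in> relation_ideal S R" if "f \<in> ideal_hull R" for f
    using that
  proof induction
    case zero
    then show ?case using I.zero_closed by (simp add: p_def)
  next
    case (add r f u v)
    have "p r = r" using add p_id assms by auto
    then have "p (u * r * v) = p u * r * p v" by (simp add: p_mult)
    moreover have "p u * r * p v \<in> relation_ideal S R"
      using I.I_l_closed[of r "p u"] I.I_r_closed[of "p u * r" "p v"] R add p_S
      by (auto simp: carrier_free_algebra)
    ultimately show ?case
      using I.a_closed[of "p (u * r * v)" "p f"] add by (simp add: p_def restrict_words_add)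
  qed
  show "ideal_hull R \<inter> free_span S \<subseteq> relation_ideal S R"
    using p_I p_id by fastforce
qed


section \<open>Consequences of the defining relations\<close>

lemma affine_relators_mono:
  assumes "k \<le> d" shows "affine_relators k q \<subseteq> affine_relators d q"
proof -
  have "{1..<k} \<subseteq> {1..<d}" "{1..k} \<subseteq> {1..d}" using assms by auto
  then show ?thesis unfolding affine_relators_def by (intro Un_mono) blast+
qed

lemma dg_relators_mono:
  assumes "k \<le> d" shows "dg_relators k q \<subseteq> dg_relators d q"
proof -
  have "{1..<k} \<subseteq> {1..<d}" "{1..k} \<subseteq> {1..d}" using assms by auto
  then show ?thesis unfolding dg_relators_def
    using assms affine_relators_mono[OF assms, of q] by (intro Un_mono) (blast | simp)+
qed

text \<open>The inverse of T_i, read off from the quadratic relation in the form T_i (T_i - (q - 1))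
  = q.\<close>

definition gS :: "'k::field \<Rightarrow> nat \<Rightarrow> (hecke_gen, 'k) free_alg" where
  "gS q i = free_const (1 / q) * (gT i - free_const (q - 1))"

lemma gen_const: "free_gen g * free_const a = free_const a * free_gen g"
  and gen_const': "free_gen g * (free_const a * x) = free_const a * (free_gen g * x)"
  and const_const: "free_const a * free_const b = free_const (a * b)"
  and const_const': "free_const a * (free_const b * x) = free_const (a * b) * x"
  by (simp_all only: free_const_commute[of a "free_gen g"] mult.assoc[symmetric] free_const_mult)

lemma const_mid: "x * (free_const a * y) = free_const a * (x * y)"
  by (simp only: free_const_commute[of a x] mult.assoc[symmetric])

lemmas const_simps = gen_const gen_const' const_const const_const' free_const_diff
  free_const_add free_const_uminus

lemma gT_eq_gS: "q \<noteq> 0 \<Longrightarrow> gT i = free_const q * gS q i + free_const (q - 1)"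
  by (simp add: gS_def const_simps algebra_simps)

locale hecke =
  fixes q :: "'k::field" and k :: nat
  assumes q_nz: "q \<noteq> 0"
begin

abbreviation equiv (infix "\<doteq>" 50) where "a \<doteq> b \<equiv> cong_ideal (dg_relators k q) a b"

abbreviation S where "S \<equiv> gS q"

lemma rewrite_left: "a \<doteq> b \<Longrightarrow> a * v \<doteq> b * v"
  by (simp add: cong_ideal_mult)

lemma rewrite_right: "a \<doteq> b \<Longrightarrow> u * a \<doteq> u * b"
  by (simp add: cong_ideal_mult)

lemma affine_incl: "a - b \<in> affine_relators k q \<Longrightarrow> a \<doteq> b"
  by (rule cong_ideal_incl) (simp add: dg_relators_def)

lemma X_Y: "1 \<le> r \<Longrightarrow> r \<le> k \<Longrightarrow> gX r * gXinv r \<doteq> 1"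
  and Y_X: "1 \<le> r \<Longrightarrow> r \<le> k \<Longrightarrow> gXinv r * gX r \<doteq> 1"
  by (rule affine_incl, unfold affine_relators_def, force)+

lemma X_comm:
  assumes "i \<in> {1..k}" "j \<in> {1..k}" "x \<in> {gX i, gXinv i}" "y \<in> {gX j, gXinv j}"
  shows "x * y \<doteq> y * x"
  by (rule affine_incl, unfold affine_relators_def) (use assms in blast)

lemma T_quadratic:
  assumes "i \<in> {1..<k}"
  shows "gT i * gT i \<doteq> free_const (q - 1) * gT i + free_const q"
proof -
  have "gT i * gT i - (free_const (q - 1) * gT i + free_const q) = (gT i - free_const q) * (gT i + 1)"
    by (simp add: algebra_simps free_const_diff)
  also have "\<dots> \<in> affine_relators k q"
    unfolding affine_relators_def using assms by blast
  finally show ?thesis by (rule affine_incl)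
qed

lemma T_far:
  assumes "i \<in> {1..<k}" "j \<in> {1..<k}" "i + 1 < j \<or> j + 1 < i"
  shows "gT i * gT j \<doteq> gT j * gT i"
proof -
  have "\<bar>int i - int j\<bar> > 1" using assms by linarith
  then show ?thesis
    by (intro affine_incl, unfold affine_relators_def) (use assms in blast)
qed

lemma braid:
  assumes "1 \<le> i" "i + 1 < k"
  shows "gT i * (gT (i + 1) * gT i) \<doteq> gT (i + 1) * (gT i * gT (i + 1))"
proof -
  have "i \<in> {1..<k}" "i + 1 \<in> {1..<k}" using assms by auto
  then show ?thesis unfolding mult.assoc[symmetric]
    by (intro affine_incl, unfold affine_relators_def) blast
qed

lemma T_X_far:
  assumes "i \<in> {1..<k}" "j \<in> {1..k}" "j \<noteq> i" "j \<noteq> i + 1"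
  shows "gT i * gX j \<doteq> gX j * gT i"
proof -
  have "int j - int i \<notin> {0, 1}" using assms by auto
  then show ?thesis
    by (intro affine_incl, unfold affine_relators_def) (use assms in blast)
qed

lemma T_X_T:
  assumes "i \<in> {1..<k}"
  shows "gT i * (gX i * gT i) \<doteq> free_const q * gX (i + 1)"
  unfolding mult.assoc[symmetric]
  by (rule affine_incl, unfold affine_relators_def) (use assms in blast)

lemma theta_theta: "gTheta * gTheta \<doteq> 0"
  by (rule cong_ideal_incl) (simp add: dg_relators_def)

lemma X_theta: "r \<in> {1..k} \<Longrightarrow> gX r * gTheta \<doteq> gTheta * gX r"
  by (rule cong_ideal_incl, unfold dg_relators_def, blast)

lemma Y_theta: "r \<in> {1..k} \<Longrightarrow> gXinv r * gTheta \<doteq> gTheta * gXinv r"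
  by (rule cong_ideal_incl, unfold dg_relators_def, blast)

lemma T_theta: "r \<in> {1..<k} \<Longrightarrow> r > 1 \<Longrightarrow> gT r * gTheta \<doteq> gTheta * gT r"
  by (rule cong_ideal_incl, unfold dg_relators_def, blast)

lemma theta_T_theta:
  assumes "k > 1"
  shows "gT 1 * gTheta * gT 1 * gTheta + gTheta * gT 1 * gTheta * gT 1
    \<doteq> free_const (q - 1) * gTheta * gT 1 * gTheta"
  by (rule cong_ideal_incl) (use assms in \<open>simp add: dg_relators_def\<close>)

lemma T_S:
  assumes "i \<in> {1..<k}"
  shows "gT i * S i \<doteq> 1" "S i * gT i \<doteq> 1"
proof -
  have "free_const (1/q) * (gT i * gT i) \<doteq> free_const (1/q) * (free_const (q - 1) * gT i + free_const q)"
    by (rule rewrite_right[OF T_quadratic[OF assms]])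
  then have *: "free_const (1/q) * (gT i * gT i) - free_const (1/q) * (free_const (q - 1) * gT i)
      \<doteq> free_const (1/q) * (free_const (q - 1) * gT i + free_const q)
        - free_const (1/q) * (free_const (q - 1) * gT i)"
    by (rule cong_ideal_diff) simp
  show "gT i * S i \<doteq> 1" "S i * gT i \<doteq> 1"
    using * q_nz by (simp_all add: gS_def algebra_simps const_simps)
qed

lemma cancel_T_left: "i \<in> {1..<k} \<Longrightarrow> gT i * a \<doteq> gT i * b \<Longrightarrow> a \<doteq> b"
proof -
  assume i: "i \<in> {1..<k}" and ab: "gT i * a \<doteq> gT i * b"
  have "a \<doteq> S i * (gT i * a)" for a
    using cong_ideal_sym[OF rewrite_left[OF T_S(2)[OF i]], of a] by (simp add: mult.assoc)
  then show "a \<doteq> b" using rewrite_right[OF ab, of "S i"] by (meson cong_ideal_sym cong_ideal_trans)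
qed

lemma T_cancel: "i \<in> {1..<k} \<Longrightarrow> gT i * (S i * a) \<doteq> a" "i \<in> {1..<k} \<Longrightarrow> S i * (gT i * a) \<doteq> a"
  using rewrite_left[OF T_S(1), of i a] rewrite_left[OF T_S(2), of i a]
  by (simp_all add: mult.assoc)

lemma X_cancel:
  "r \<in> {1..k} \<Longrightarrow> gX r * (gXinv r * a) \<doteq> a" "r \<in> {1..k} \<Longrightarrow> gXinv r * (gX r * a) \<doteq> a"
  using rewrite_left[OF X_Y, of r a] rewrite_left[OF Y_X, of r a] by (simp_all add: mult.assoc)

lemma T_Y_far:
  assumes "i \<in> {1..<k}" "j \<in> {1..k}" "j \<noteq> i" "j \<noteq> i + 1"
  shows "gT i * gXinv j \<doteq> gXinv j * gT i"
proof -
  have "gT i * gXinv j \<doteq> gXinv j * (gX j * (gT i * gXinv j))"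
    by (rule cong_ideal_sym, rule X_cancel) (use assms in simp)
  also have "\<dots> \<doteq> gXinv j * (gT i * (gX j * gXinv j))"
    using rewrite_right[OF rewrite_left[OF cong_ideal_sym[OF T_X_far[OF assms]]],
        of "gXinv j" "gXinv j"]
    by (simp add: mult.assoc)
  also have "\<dots> \<doteq> gXinv j * (gT i * 1)"
    using assms by (intro rewrite_right X_Y) auto
  finally show ?thesis by simp
qed

lemma X_T:
  assumes "i \<in> {1..<k}"
  shows "gX i * gT i \<doteq> free_const q * (S i * gX (i + 1))"
proof -
  have "gX i * gT i \<doteq> S i * (gT i * (gX i * gT i))"
    by (rule cong_ideal_sym, rule T_cancel) (use assms in simp)
  also have "\<dots> \<doteq> S i * (free_const q * gX (i + 1))"
    by (rule rewrite_right[OF T_X_T[OF assms]])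
  also have "\<dots> = free_const q * (S i * gX (i + 1))"
    by (rule const_mid)
  finally show ?thesis .
qed

text \<open>Source of all lower terms in the leading-term analysis: the correction has lost the
  factor S_i and only contains X_i, not X_{i+1}.\<close>

lemma X_S:
  assumes "i \<in> {1..<k}"
  shows "gX i * S i \<doteq> S i * gX (i + 1) - free_const (1 - 1/q) * gX i"
proof -
  have "gX i * S i = free_const (1/q) * (gX i * gT i) - free_const (1 - 1/q) * gX i"
    using q_nz by (simp add: gS_def algebra_simps const_simps)
  also have "\<dots> \<doteq> free_const (1/q) * (free_const q * (S i * gX (i + 1))) - free_const (1 - 1/q) * gX i"
    by (intro cong_ideal_diff rewrite_right X_T[OF assms] cong_ideal_refl)
  finally show ?thesis using q_nz by (simp add: const_const')
qed

lemma X_Suc_S: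
  assumes "i \<in> {1..<k}"
  shows "gX (i + 1) * S i \<doteq> free_const (1/q) * (gT i * gX i)"
proof -
  have "gX (i + 1) * S i = free_const (1/q) * (free_const q * gX (i + 1)) * S i"
    using q_nz by (simp add: const_const')
  also have "\<dots> \<doteq> free_const (1/q) * (gT i * (gX i * gT i)) * S i"
    by (intro rewrite_left rewrite_right cong_ideal_sym[OF T_X_T[OF assms]])
  also have "\<dots> = free_const (1/q) * (gT i * (gX i * (gT i * S i)))"
    by (simp add: mult.assoc)
  also have "\<dots> \<doteq> free_const (1/q) * (gT i * (gX i * 1))"
    by (intro rewrite_right T_S assms)
  finally show ?thesis by simp
qed

lemma Y_S:
  assumes "i \<in> {1..<k}"
  shows "gXinv i * S i \<doteq> free_const (1/q) * (gT i * gXinv (i + 1))"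
proof -
  have i: "i \<in> {1..k}" "i + 1 \<in> {1..k}" using assms by auto
  have "gXinv i * S i \<doteq> gXinv i * (S i * (gX (i + 1) * gXinv (i + 1)))"
    using rewrite_right[OF cong_ideal_sym[OF X_Y[of "i + 1"]], of "gXinv i * S i"] i
    by (simp add: mult.assoc)
  also have "\<dots> = free_const (1/q) * (gXinv i * ((free_const q * (S i * gX (i + 1))) * gXinv (i + 1)))"
    using q_nz by (simp add: mult.assoc const_simps)
  also have "\<dots> \<doteq> free_const (1/q) * (gXinv i * ((gX i * gT i) * gXinv (i + 1)))"
    by (intro rewrite_right rewrite_left cong_ideal_sym[OF X_T[OF assms]])
  also have "\<dots> = free_const (1/q) * (gXinv i * (gX i * (gT i * gXinv (i + 1))))"
    by (simp add: mult.assoc)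
  also have "\<dots> \<doteq> free_const (1/q) * (gT i * gXinv (i + 1))"
    by (intro rewrite_right X_cancel i)
  finally show ?thesis .
qed

lemma Y_T:
  assumes "i \<in> {1..<k}"
  shows "gXinv i * gT i \<doteq> gT i * gXinv (i + 1) + free_const (q - 1) * gXinv i"
proof -
  have "gXinv i * gT i = free_const q * (gXinv i * S i) + free_const (q - 1) * gXinv i"
    by (subst gT_eq_gS[OF q_nz]) (simp add: algebra_simps const_simps)
  also have "\<dots> \<doteq> free_const q * (free_const (1/q) * (gT i * gXinv (i + 1))) + free_const (q - 1) * gXinv i"
    by (intro cong_ideal_add rewrite_right Y_S[OF assms] cong_ideal_refl)
  finally show ?thesis using q_nz by (simp add: const_const')
qed

lemma Y_Suc_T:
  assumes "i \<in> {1..<k}"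
  shows "gXinv (i + 1) * gT i \<doteq> free_const q * (S i * gXinv i)"
proof (rule cancel_T_left[OF assms])
  have i: "i \<in> {1..k}" "i + 1 \<in> {1..k}" using assms by auto
  have "gT i * (gXinv (i + 1) * gT i) \<doteq> free_const q * (gXinv i * S i) * gT i"
  proof -
    have "free_const q * (gXinv i * S i) * gT i
        \<doteq> free_const q * (free_const (1/q) * (gT i * gXinv (i + 1))) * gT i"
      by (intro rewrite_left rewrite_right Y_S[OF assms])
    from cong_ideal_sym[OF this] show ?thesis using q_nz by (simp add: const_const' mult.assoc)
  qed
  also have "\<dots> = free_const q * (gXinv i * (S i * gT i))" by (simp add: mult.assoc)
  also have "\<dots> \<doteq> free_const q * (gXinv i * 1)"
    by (intro rewrite_right T_S assms)
  also have "\<dots> \<doteq> free_const q * (gT i * (S i * gXinv i))"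
    using cong_ideal_sym[OF T_cancel(1)[OF assms]] by (simp add: rewrite_right)
  finally show "gT i * (gXinv (i + 1) * gT i) \<doteq> gT i * (free_const q * (S i * gXinv i))"
    by (simp add: const_simps)
qed

lemma Y_Suc_S:
  assumes "i \<in> {1..<k}"
  shows "gXinv (i + 1) * S i \<doteq> S i * gXinv i - free_const (1 - 1/q) * gXinv (i + 1)"
proof -
  have "gXinv (i + 1) * S i = free_const (1/q) * (gXinv (i + 1) * gT i) - free_const (1 - 1/q) * gXinv (i + 1)"
    using q_nz by (simp add: gS_def algebra_simps const_simps)
  also have "\<dots> \<doteq> free_const (1/q) * (free_const q * (S i * gXinv i)) - free_const (1 - 1/q) * gXinv (i + 1)"
    by (intro cong_ideal_diff rewrite_right Y_Suc_T[OF assms] cong_ideal_refl)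
  finally show ?thesis using q_nz by (simp add: const_const')
qed

lemma X_from_T: "i \<in> {1..<k} \<Longrightarrow> gX (i + 1) \<doteq> free_const (1/q) * (gT i * (gX i * gT i))"
  using cong_ideal_sym[OF rewrite_right[OF T_X_T, of i "free_const (1/q)"]] q_nz
  by (simp add: const_const')

lemma Y_from_S:
  assumes "i \<in> {1..<k}"
  shows "gXinv (i + 1) \<doteq> free_const q * (S i * (gXinv i * S i))"
proof -
  have "free_const q * (S i * (gXinv i * S i)) \<doteq> free_const q * (S i * (free_const (1/q) * (gT i * gXinv (i + 1))))"
    by (intro rewrite_right Y_S assms)
  also have "\<dots> = S i * (gT i * gXinv (i + 1))"
    using q_nz by (simp add: const_mid[of "S i"] const_const')
  also have "\<dots> \<doteq> gXinv (i + 1)" by (rule T_cancel[OF assms])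
  finally show ?thesis by (rule cong_ideal_sym)
qed

text \<open>After multiplication by T_{i+1} T_i from the left, both sides become T_i: the left one
  by the braid relation, the right one by cancellation.\<close>

lemma T_S_S:
  assumes "1 \<le> i" "i + 1 < k"
  shows "gT (i + 1) * (S i * S (i + 1)) \<doteq> S i * (S (i + 1) * gT i)"
proof -
  have i: "i \<in> {1..<k}" "i + 1 \<in> {1..<k}" using assms by auto
  have "gT (i + 1) * (gT i * (gT (i + 1) * (S i * S (i + 1))))
      \<doteq> gT i * (gT (i + 1) * (gT i * (S i * S (i + 1))))"
    using rewrite_left[OF cong_ideal_sym[OF braid[OF assms]], of "S i * S (i + 1)"]
    by (simp add: mult.assoc)
  also have "\<dots> \<doteq> gT i * (gT (i + 1) * S (i + 1))"
    by (intro rewrite_right T_cancel i)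
  also have "\<dots> \<doteq> gT i * 1" by (intro rewrite_right T_S i)
  also have "\<dots> \<doteq> gT (i + 1) * (S (i + 1) * gT i)"
    using cong_ideal_sym[OF T_cancel(1)[OF i(2)]] by simp
  also have "\<dots> \<doteq> gT (i + 1) * (gT i * (S i * (S (i + 1) * gT i)))"
    by (intro rewrite_right cong_ideal_sym[OF T_cancel(1)[OF i(1)]])
  finally show ?thesis
    using cancel_T_left i by blast
qed

text \<open>Replacing the last T_1 by its inverse turns the three-term relation into an
  anticommutation: the sum of both sides is 1/q times the defining relator up to a multiple of
  \<theta> \<theta>. This is how \<theta> is moved past T_1 \<theta> S_1.\<close>

lemma theta_T_theta_S:
  assumes "k > 1"
  shows "gTheta * (gT 1 * (gTheta * S 1)) \<doteq> - (gT 1 * (gTheta * (S 1 * gTheta)))"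
proof -
  have eq: "gTheta * (gT 1 * (gTheta * S 1)) + gT 1 * (gTheta * (S 1 * gTheta))
     = free_const (1/q) * ((gT 1 * gTheta * gT 1 * gTheta + gTheta * gT 1 * gTheta * gT 1)
         - free_const (q - 1) * gTheta * gT 1 * gTheta)
       - free_const (1 - 1/q) * (gT 1 * (gTheta * gTheta))"
    using q_nz by (simp add: gS_def algebra_simps const_simps)
  also have "\<dots> \<doteq> free_const (1/q) * ((free_const (q - 1) * gTheta * gT 1 * gTheta)
         - free_const (q - 1) * gTheta * gT 1 * gTheta) - free_const (1 - 1/q) * (gT 1 * 0)"
    by (intro cong_ideal_diff rewrite_right theta_T_theta theta_theta assms cong_ideal_refl)
  finally show ?thesis unfolding cong_ideal_def by (simp add: algebra_simps)
qed

lemma T_far_S: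
  assumes "i \<in> {1..<k}" "j \<in> {1..<k}" "i + 1 < j \<or> j + 1 < i"
  shows "gT i * S j \<doteq> S j * gT i"
proof -
  have "gT i * S j = free_const (1/q) * (gT i * gT j - free_const (q - 1) * gT i)"
    by (simp add: gS_def algebra_simps const_simps)
  also have "\<dots> \<doteq> free_const (1/q) * (gT j * gT i - free_const (q - 1) * gT i)"
    by (intro rewrite_right cong_ideal_diff T_far assms cong_ideal_refl)
  also have "\<dots> = S j * gT i" by (simp add: gS_def algebra_simps const_simps)
  finally show ?thesis .
qed

lemma comm_S:
  assumes "x * gT j \<doteq> gT j * x"
  shows "x * S j \<doteq> S j * x"
proof -
  have "x * S j = free_const (1/q) * (x * gT j - free_const (q - 1) * x)"
    by (simp add: gS_def right_diff_distrib const_mid[of x] free_const_commute[of "q - 1" x])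
  also have "\<dots> \<doteq> free_const (1/q) * (gT j * x - free_const (q - 1) * x)"
    by (intro rewrite_right cong_ideal_diff assms cong_ideal_refl)
  also have "\<dots> = S j * x" by (simp add: gS_def algebra_simps const_simps)
  finally show ?thesis .
qed

end


section \<open>Laurent polynomials with coefficients in a ring\<close>

lemma lookup_mult_int:
  fixes p r :: "int \<Rightarrow>\<^sub>0 'a::semiring_1"
  shows "Poly_Mapping.lookup (p * r) m
    = (\<Sum>a\<in>Poly_Mapping.keys p. Poly_Mapping.lookup p a * Poly_Mapping.lookup r (m - a))"
proof -
  have single: "Poly_Mapping.lookup (Poly_Mapping.single a x * r) m = x * Poly_Mapping.lookup r (m - a)"
    for a and x :: 'a
  proof -
    have "Poly_Mapping.single a x * r
        = (\<Sum>b\<in>Poly_Mapping.keys r. Poly_Mapping.single (a + b) (x * Poly_Mapping.lookup r b))"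
      by (subst poly_mapping_eq_sum_single[of r]) (simp add: sum_distrib_left mult_single)
    moreover have "a + b = m \<longleftrightarrow> b = m - a" for b by auto
    ultimately have "Poly_Mapping.lookup (Poly_Mapping.single a x * r) m
        = (\<Sum>b\<in>Poly_Mapping.keys r. if b = m - a then x * Poly_Mapping.lookup r b else 0)"
      by (simp only: lookup_sum lookup_single when_def)
    also have "\<dots> = x * Poly_Mapping.lookup r (m - a)"
      by (simp add: in_keys_iff)
    finally show ?thesis .
  qed
  have "p * r = (\<Sum>a\<in>Poly_Mapping.keys p. Poly_Mapping.single a (Poly_Mapping.lookup p a) * r)"
    by (subst poly_mapping_eq_sum_single[of p]) (simp add: sum_distrib_right)
  then show ?thesis by (simp add: lookup_sum single)
qed

text \<open>The free algebra has no inverses, so integer powers are split by sign; they add up only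
  modulo the relations.\<close>

definition Xpow :: "nat \<Rightarrow> int \<Rightarrow> (hecke_gen, 'k::field) free_alg" where
  "Xpow k a = (if a \<ge> 0 then gX k ^ nat a else gXinv k ^ nat (- a))"

text \<open>Realizes a Laurent polynomial over the free algebra at \<open>X_k\<close>. The
  convolution product on the coefficient side treats the variable as central, which matches
  \<open>X_k\<close> when the coefficients come from the algebra for k - 1.\<close>

definition laurent :: "nat \<Rightarrow> (int \<Rightarrow>\<^sub>0 (hecke_gen, 'k::field) free_alg) \<Rightarrow> (hecke_gen, 'k) free_alg" where
  "laurent k p = (\<Sum>a\<in>Poly_Mapping.keys p. Xpow k a * Poly_Mapping.lookup p a)"

text \<open>The exponent set \<open>B\<close> carries the degree bounds in \<open>X_k\<close>; the
  generator set \<open>G\<close> records whether \<theta> may occur in the coefficients.\<close>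

definition coeff_set ::
    "hecke_gen set \<Rightarrow> int set \<Rightarrow> (int \<Rightarrow>\<^sub>0 (hecke_gen, 'k::field) free_alg) set" where
  "coeff_set G B = {p. Poly_Mapping.keys p \<subseteq> B \<and> (\<forall>a. Poly_Mapping.lookup p a \<in> free_span G)}"

lemma Xpow_0 [simp]: "Xpow k 0 = 1"
  and Xpow_1: "Xpow k 1 = gX k"
  and Xpow_minus_1: "Xpow k (- 1) = gXinv k"
  by (simp_all add: Xpow_def)

lemma laurent_0 [simp]: "laurent k 0 = 0"
  by (simp add: laurent_def)

lemma laurent_single: "laurent k (Poly_Mapping.single a x) = Xpow k a * x"
  by (simp add: laurent_def)

lemma laurent_add: "laurent k (p + r) = laurent k p + laurent k r"
  unfolding laurent_def by (rule setsum_keys_plus_distrib) (simp_all add: algebra_simps)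

lemma laurent_sum: "laurent k (sum p I) = (\<Sum>i\<in>I. laurent k (p i))"
  by (induction I rule: infinite_finite_induct) (auto simp: laurent_add)

lemma laurent_uminus: "laurent k (- p) = - laurent k p"
  by (simp add: laurent_def sum_negf in_keys_iff keys_def)

lemma coeff_set_0 [simp]: "0 \<in> coeff_set G B"
  by (simp add: coeff_set_def)

lemma coeff_set_mono: "p \<in> coeff_set G B \<Longrightarrow> G \<subseteq> G' \<Longrightarrow> B \<subseteq> B' \<Longrightarrow> p \<in> coeff_set G' B'"
  using free_span_mono[of G G'] by (auto simp: coeff_set_def)

lemma coeff_set_add: "p \<in> coeff_set G B \<Longrightarrow> r \<in> coeff_set G B \<Longrightarrow> p + r \<in> coeff_set G B"
  using keys_add[of p r] by (auto simp: coeff_set_def lookup_add intro: free_span_add)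

lemma coeff_set_uminus: "p \<in> coeff_set G B \<Longrightarrow> - p \<in> coeff_set G B"
  by (auto simp: coeff_set_def free_span_uminus in_keys_iff subset_iff)

lemma coeff_set_sum: "(\<And>i. i \<in> I \<Longrightarrow> p i \<in> coeff_set G B) \<Longrightarrow> sum p I \<in> coeff_set G B"
  by (induction I rule: infinite_finite_induct) (auto intro: coeff_set_add)

lemma coeff_set_single: "a \<in> B \<Longrightarrow> x \<in> free_span G \<Longrightarrow> Poly_Mapping.single a x \<in> coeff_set G B"
  by (auto simp: coeff_set_def lookup_single when_def)

lemma coeff_set_mult:
  assumes "p \<in> coeff_set G B" "r \<in> coeff_set G B'" "\<And>a b. a \<in> B \<Longrightarrow> b \<in> B' \<Longrightarrow> a + b \<in> B''"
  shows "p * r \<in> coeff_set G B''"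
proof -
  have "Poly_Mapping.keys (p * r) \<subseteq> B''"
    using keys_mult[of p r] assms by (fastforce simp: coeff_set_def)
  moreover have "Poly_Mapping.lookup (p * r) m \<in> free_span G" for m
    unfolding lookup_mult_int using assms
    by (auto simp: coeff_set_def intro!: free_span_sum free_span_mult)
  ultimately show ?thesis by (simp add: coeff_set_def)
qed

text \<open>\<open>dg_gens 0\<close> still contains \<theta>. Removing it makes the algebra for k =
  0 the ground field, so that for k = 1 the coefficients are scalars and the basis is 1,
  \<theta>.\<close>

definition dgens :: "nat \<Rightarrow> hecke_gen set" where
  "dgens k = (if k = 0 then {} else dg_gens k)"

lemma affine_gens_dgens: "affine_gens k \<subseteq> dgens k"
  by (auto simp: dgens_def dg_gens_def affine_gens_def)

lemma dgens_cases:
  assumes "g \<in> dgens k"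
  obtains (T) i where "g = GenT i" "i \<in> {1..<k}" | (X) i where "g = GenX i" "i \<in> {1..k}"
    | (Y) i where "g = GenXinv i" "i \<in> {1..k}" | (theta) "g = GenTheta" "k \<ge> 1"
  using assms by (auto simp: dgens_def dg_gens_def affine_gens_def split: if_splits)

lemma GenT_in: "GenT i \<in> affine_gens k \<longleftrightarrow> i \<in> {1..<k}"
  and GenX_in: "GenX i \<in> affine_gens k \<longleftrightarrow> i \<in> {1..k}"
  and GenXinv_in: "GenXinv i \<in> affine_gens k \<longleftrightarrow> i \<in> {1..k}"
  and GenTheta_in: "GenTheta \<notin> affine_gens k" "k \<ge> 1 \<Longrightarrow> GenTheta \<in> dgens k"
  by (auto simp: affine_gens_def dgens_def dg_gens_def)

section \<open>A spanning set\<close>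

definition Sword :: "'k::field \<Rightarrow> nat \<Rightarrow> nat \<Rightarrow> (hecke_gen, 'k) free_alg" where
  "Sword q m k = prod_list (map (gS q) [m..<k])"

lemma Sword_rec: "m < k \<Longrightarrow> Sword q m k = gS q m * Sword q (Suc m) k"
  by (simp add: Sword_def upt_conv_Cons)

lemma Sword_refl [simp]: "k \<le> m \<Longrightarrow> Sword q m k = 1"
  by (simp add: Sword_def)

primrec Tword :: "nat \<Rightarrow> (hecke_gen, 'k::field) free_alg" where
  "Tword 0 = 1"
| "Tword (Suc j) = gT (Suc j) * Tword j"

lemma gS_free_span: "GenT i \<in> G \<Longrightarrow> gS q i \<in> free_span G"
  by (simp add: gS_def free_span_diff free_span_mult)

text \<open>Sums of elements of \<open>E\<close>, saturated under congruence. Scalars are absent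
  because in the applications they are absorbed into the Laurent coefficients of the members of
  \<open>E\<close>.\<close>

inductive_set lin_hull :: "'a::ring_1 set \<Rightarrow> 'a set \<Rightarrow> 'a set" for R E where
  zero: "0 \<in> lin_hull R E"
| add: "e \<in> E \<Longrightarrow> f \<in> lin_hull R E \<Longrightarrow> e + f \<in> lin_hull R E"
| cong: "f \<in> lin_hull R E \<Longrightarrow> cong_ideal R f g \<Longrightarrow> g \<in> lin_hull R E"

lemma lin_hull_incl: "e \<in> E \<Longrightarrow> e \<in> lin_hull R E"
  using lin_hull.add[OF _ lin_hull.zero] by fastforce

lemma lin_hull_add: "f \<in> lin_hull R E \<Longrightarrow> g \<in> lin_hull R E \<Longrightarrow> f + g \<in> lin_hull R E"
proof (induction rule: lin_hull.induct)
  case (cong f f')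
  show ?case
    by (rule lin_hull.cong[OF cong.IH[OF cong.prems]]) (simp add: cong cong_ideal_add)
qed (auto simp: add.assoc intro: lin_hull.add)

lemma lin_hull_eq: "cong_ideal R f g \<Longrightarrow> g \<in> lin_hull R E \<Longrightarrow> f \<in> lin_hull R E"
  using lin_hull.cong cong_ideal_sym by metis

lemma lin_hull_image:
  assumes "f \<in> lin_hull R E"
    and "\<And>e. e \<in> E \<Longrightarrow> x * e * y \<in> lin_hull R E'"
  shows "x * f * y \<in> lin_hull R E'"
  using assms(1)
proof induction
  case (add e f)
  then show ?case using assms(2)[of e] lin_hull_add[of "x * e * y" R E' "x * f * y"]
    by (simp add: algebra_simps)
next
  case (cong f g)
  have "cong_ideal R (x * f * y) (x * g * y)"
    by (intro cong_ideal_mult cong cong_ideal_refl)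
  then show ?case using cong.IH by (blast intro: lin_hull.cong)
qed (simp add: lin_hull.zero)

lemma lin_hull_left:
  "f \<in> lin_hull R E \<Longrightarrow> (\<And>e. e \<in> E \<Longrightarrow> x * e \<in> lin_hull R E') \<Longrightarrow> x * f \<in> lin_hull R E'"
  using lin_hull_image[of f R E x 1 E'] by simp

lemma lin_hull_right:
  "f \<in> lin_hull R E \<Longrightarrow> (\<And>e. e \<in> E \<Longrightarrow> e * x \<in> lin_hull R E') \<Longrightarrow> f * x \<in> lin_hull R E'"
  using lin_hull_image[of f R E 1 x E'] by simp

lemma lin_hull_subset:
  "f \<in> lin_hull R E \<Longrightarrow> (\<And>e. e \<in> E \<Longrightarrow> e \<in> lin_hull R E') \<Longrightarrow> f \<in> lin_hull R E'"
  using lin_hull_left[of f R E 1 E'] by simp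

locale hecke_pos = hecke q k for q :: "'k::field" and k :: nat +
  assumes k_pos: "k \<ge> 1"
begin

abbreviation Sw where "Sw m \<equiv> Sword q m k"

abbreviation lhull where "lhull E \<equiv> lin_hull (dg_relators k q) E"

lemma comm_mult: "x * a \<doteq> a * x \<Longrightarrow> x * b \<doteq> b * x \<Longrightarrow> x * (a * b) \<doteq> a * b * x"
proof -
  assume a: "x * a \<doteq> a * x" and b: "x * b \<doteq> b * x"
  have "x * a * b \<doteq> a * x * b" by (rule rewrite_left[OF a])
  also have "a * x * b = a * (x * b)" by (simp add: mult.assoc)
  also have "\<dots> \<doteq> a * (b * x)" by (rule rewrite_right[OF b])
  finally show ?thesis by (simp add: mult.assoc)
qed

lemma comm_free_span:
  assumes "a \<in> free_span G" "\<And>g. g \<in> G \<Longrightarrow> x * free_gen g \<doteq> free_gen g * x"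
  shows "x * a \<doteq> a * x"
  using assms(1)
proof (induction a rule: free_span_induct)
  case (word c u)
  then show ?case
  proof (induction u)
    case Nil
    then show ?case by (simp add: free_const_eq[symmetric] free_const_commute)
  next
    case (Cons g u)
    then show ?case unfolding word_term_Cons using assms(2)[of g] by (intro comm_mult) auto
  qed
qed (simp add: algebra_simps cong_ideal_add)

section \<open>Arithmetic of Laurent polynomials in \<open>X_k\<close> over the smaller
  algebra\<close>

lemma Xk_comm:
  assumes "a \<in> free_span (dgens (k - 1))" "x \<in> {gX k, gXinv k}"
  shows "x * a \<doteq> a * x"
proof (rule comm_free_span[OF assms(1)])
  fix g assume g: "g \<in> dgens (k - 1)"
  have k: "k \<in> {1..k}" using k_pos by simp
  show "x * free_gen g \<doteq> free_gen g * x"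
    using g
  proof (cases rule: dgens_cases)
    case (T i)
    then have "i \<in> {1..<k}" "k \<noteq> i" "k \<noteq> i + 1" by auto
    then show ?thesis
      using assms(2) T(1) T_X_far[of i k] T_Y_far[of i k] k by (auto simp: cong_ideal_sym)
  next
    case (X i)
    then show ?thesis using X_comm[of k i x "gX i"] assms(2) k by auto
  next
    case (Y i)
    then show ?thesis using X_comm[of k i x "gXinv i"] assms(2) k by auto
  next
    case theta
    then show ?thesis using assms(2) X_theta[of k] Y_theta[of k] k by auto
  qed
qed

lemma Xpow_comm:
  assumes "a \<in> free_span (dgens (k - 1))"
  shows "a * Xpow k n \<doteq> Xpow k n * a"
proof -
  have "x ^ m * a \<doteq> a * x ^ m" if "x * a \<doteq> a * x" for x m
  proof (induction m)
    case (Suc m)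
    have "a * x \<doteq> x * a" "a * x ^ m \<doteq> x ^ m * a" using that Suc cong_ideal_sym by auto
    then show ?case using comm_mult[of a x "x ^ m"] cong_ideal_sym by auto
  qed simp
  then have "gX k ^ m * a \<doteq> a * gX k ^ m" "gXinv k ^ m * a \<doteq> a * gXinv k ^ m" for m
    using Xk_comm[OF assms] by auto
  from this[THEN cong_ideal_sym] show ?thesis by (simp add: Xpow_def)
qed

lemma Xpow_Suc: "gX k * Xpow k n \<doteq> Xpow k (n + 1)"
proof (cases "n \<ge> 0")
  case True
  then show ?thesis by (simp add: Xpow_def nat_add_distrib)
next
  case False
  define m where "m = nat (- n - 1)"
  have n: "nat (- n) = Suc m" "nat (- (n + 1)) = m" using False by (auto simp: m_def)
  have "gX k * (gXinv k * gXinv k ^ m) \<doteq> gXinv k ^ m" using k_pos by (intro X_cancel) auto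
  moreover have "Xpow k (n + 1) = (gXinv k ^ m :: (hecke_gen, 'k) free_alg)"
    using False n by (cases "n = - 1") (auto simp: Xpow_def)
  moreover have "Xpow k n = (gXinv k * gXinv k ^ m :: (hecke_gen, 'k) free_alg)"
    using False n by (simp add: Xpow_def)
  ultimately show ?thesis by (simp only:)
qed

lemma Xpow_pred: "gXinv k * Xpow k n \<doteq> Xpow k (n - 1)"
proof -
  have "gXinv k * (gX k * Xpow k (n - 1)) \<doteq> Xpow k (n - 1)"
    using k_pos by (intro X_cancel) auto
  moreover have "gXinv k * (gX k * Xpow k (n - 1)) \<doteq> gXinv k * Xpow k n"
    using Xpow_Suc[of "n - 1"] by (intro rewrite_right) auto
  ultimately show ?thesis by (meson cong_ideal_sym cong_ideal_trans)
qed

lemma Xpow_add: "Xpow k (a + b) \<doteq> Xpow k a * Xpow k b"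
proof (induction a rule: int_induct[where k = 0])
  case base
  then show ?case by simp
next
  case (step1 i)
  have "Xpow k (i + 1 + b) \<doteq> gX k * Xpow k (i + b)"
    using cong_ideal_sym[OF Xpow_Suc[of "i + b"]] by (simp add: algebra_simps)
  also have "\<dots> \<doteq> gX k * (Xpow k i * Xpow k b)" by (rule rewrite_right[OF step1.IH])
  also have "\<dots> = gX k * Xpow k i * Xpow k b" by (simp add: mult.assoc)
  also have "\<dots> \<doteq> Xpow k (i + 1) * Xpow k b" by (rule rewrite_left[OF Xpow_Suc])
  finally show ?case .
next
  case (step2 i)
  have "Xpow k (i - 1 + b) \<doteq> gXinv k * Xpow k (i + b)"
    using cong_ideal_sym[OF Xpow_pred[of "i + b"]] by (simp add: algebra_simps)
  also have "\<dots> \<doteq> gXinv k * (Xpow k i * Xpow k b)" by (rule rewrite_right[OF step2.IH])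
  also have "\<dots> = gXinv k * Xpow k i * Xpow k b" by (simp add: mult.assoc)
  also have "\<dots> \<doteq> Xpow k (i - 1) * Xpow k b" by (rule rewrite_left[OF Xpow_pred])
  finally show ?case .
qed

text \<open>Only the coefficients of the left factor have to move past powers of \<open>X_k\<close>,
  hence the condition on \<open>p\<close> alone.\<close>

lemma laurent_mult:
  assumes "\<And>a. Poly_Mapping.lookup p a \<in> free_span (dgens (k - 1))"
  shows "laurent k p * laurent k r \<doteq> laurent k (p * r)"
proof -
  let ?P = "Poly_Mapping.keys p" and ?R = "Poly_Mapping.keys r"
  let ?p = "Poly_Mapping.lookup p" and ?r = "Poly_Mapping.lookup r"
  have "p * r = (\<Sum>a\<in>?P. Poly_Mapping.single a (?p a)) * (\<Sum>b\<in>?R. Poly_Mapping.single b (?r b))"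
    using poly_mapping_eq_sum_single[of p] poly_mapping_eq_sum_single[of r] by simp
  also have "\<dots> = (\<Sum>a\<in>?P. \<Sum>b\<in>?R. Poly_Mapping.single (a + b) (?p a * ?r b))"
    by (simp add: sum_product mult_single)
  finally have pr: "laurent k (p * r) = (\<Sum>a\<in>?P. \<Sum>b\<in>?R. Xpow k (a + b) * (?p a * ?r b))"
    by (simp add: laurent_sum laurent_single)
  have "laurent k p * laurent k r = (\<Sum>a\<in>?P. \<Sum>b\<in>?R. Xpow k a * ((?p a * Xpow k b) * ?r b))"
    by (simp add: laurent_def sum_product mult.assoc)
  also have "\<dots> \<doteq> (\<Sum>a\<in>?P. \<Sum>b\<in>?R. Xpow k a * ((Xpow k b * ?p a) * ?r b))"
    by (intro cong_ideal_sum rewrite_right rewrite_left Xpow_comm assms)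
  also have "\<dots> = (\<Sum>a\<in>?P. \<Sum>b\<in>?R. (Xpow k a * Xpow k b) * (?p a * ?r b))"
    by (simp add: mult.assoc)
  also have "\<dots> \<doteq> (\<Sum>a\<in>?P. \<Sum>b\<in>?R. Xpow k (a + b) * (?p a * ?r b))"
    by (intro cong_ideal_sum rewrite_left cong_ideal_sym[OF Xpow_add])
  finally show ?thesis by (simp add: pr)
qed

lemma mult_laurent:
  assumes "x \<in> free_span (dgens (k - 1))"
  shows "x * laurent k p \<doteq> laurent k (Poly_Mapping.single 0 x * p)"
  using laurent_mult[of "Poly_Mapping.single 0 x" p] assms
  by (simp add: laurent_single lookup_single when_def)

lemma X_laurent: "gX k * laurent k p \<doteq> laurent k (Poly_Mapping.single 1 1 * p)"
  using laurent_mult[of "Poly_Mapping.single 1 1" p]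
  by (simp add: laurent_single lookup_single when_def Xpow_1)

lemma Y_laurent: "gXinv k * laurent k p \<doteq> laurent k (Poly_Mapping.single (- 1) 1 * p)"
  using laurent_mult[of "Poly_Mapping.single (- 1) 1" p]
  by (simp add: laurent_single lookup_single when_def Xpow_minus_1)

text \<open>The parameters keep what triangularity arguments need: the least starting index of the
  products of inverses, the admissible letters of the coefficients, and the exponents of
  \<open>X_k\<close>.\<close>

definition Uspan :: "nat \<Rightarrow> hecke_gen set \<Rightarrow> int set \<Rightarrow> (hecke_gen, 'k) free_alg set" where
  "Uspan i G B = lhull {Sw m * laurent k p |m p. i \<le> m \<and> m \<le> k \<and> p \<in> coeff_set G B}"

lemma Uspan_incl: "i \<le> m \<Longrightarrow> m \<le> k \<Longrightarrow> p \<in> coeff_set G B \<Longrightarrow> Sw m * laurent k p \<in> Uspan i G B"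
  unfolding Uspan_def by (rule lin_hull_incl) blast

lemma Uspan_add: "f \<in> Uspan i G B \<Longrightarrow> g \<in> Uspan i G B \<Longrightarrow> f + g \<in> Uspan i G B"
  unfolding Uspan_def by (rule lin_hull_add)

lemma Uspan_0: "0 \<in> Uspan i G B"
  unfolding Uspan_def by (rule lin_hull.zero)

lemma Uspan_eq: "f \<doteq> g \<Longrightarrow> g \<in> Uspan i G B \<Longrightarrow> f \<in> Uspan i G B"
  unfolding Uspan_def by (rule lin_hull_eq)

lemma Uspan_left:
  assumes "f \<in> Uspan i G B"
    and "\<And>m p. i \<le> m \<Longrightarrow> m \<le> k \<Longrightarrow> p \<in> coeff_set G B \<Longrightarrow> x * (Sw m * laurent k p) \<in> lhull E"
  shows "x * f \<in> lhull E"
  using assms(1) unfolding Uspan_def by (rule lin_hull_left) (use assms(2) in blast)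

lemma Uspan_mono:
  assumes "f \<in> Uspan i G B" "i' \<le> i" "G \<subseteq> G'" "B \<subseteq> B'"
  shows "f \<in> Uspan i' G' B'"
  using assms(1) unfolding Uspan_def
proof (rule lin_hull_subset)
  fix e assume "e \<in> {Sw m * laurent k p |m p. i \<le> m \<and> m \<le> k \<and> p \<in> coeff_set G B}"
  then obtain m p where "e = Sw m * laurent k p" "i \<le> m" "m \<le> k" "p \<in> coeff_set G B" by blast
  then have "e \<in> {Sw m * laurent k p |m p. i' \<le> m \<and> m \<le> k \<and> p \<in> coeff_set G' B'}"
    using assms(2) coeff_set_mono[OF _ assms(3,4)] le_trans by blast
  then show "e \<in> lhull {Sw m * laurent k p |m p. i' \<le> m \<and> m \<le> k \<and> p \<in> coeff_set G' B'}"
    by (rule lin_hull_incl)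
qed

section \<open>Left multiplication on the span of the elements without \<theta>\<close>

lemma Sw_comm:
  assumes "\<And>j. m \<le> j \<Longrightarrow> j < k \<Longrightarrow> x * gT j \<doteq> gT j * x"
  shows "x * Sw m \<doteq> Sw m * x"
  using assms
proof (induction "k - m" arbitrary: m)
  case (Suc n)
  then have m: "m < k" by simp
  have "x * Sw (Suc m) \<doteq> Sw (Suc m) * x" using Suc by (intro Suc(1)) auto
  moreover have "x * S m \<doteq> S m * x" using Suc(3)[of m] m by (intro comm_S) auto
  ultimately show ?case by (simp add: Sword_rec[OF m] comm_mult)
qed simp

text \<open>The multiplier passes all inverses from index i on and becomes a coefficient. Its
  membership is only demanded for i \<le> k: for i = k + 1 the span is trivial, a case that occurs
  in \<open>X_Sw_aux\<close>.\<close>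

lemma Uspan_mult_comm:
  assumes f: "f \<in> Uspan i G B" and G: "G \<subseteq> dgens (k - 1)"
    and x: "i \<le> k \<Longrightarrow> x \<in> free_span G"
    and comm: "\<And>j. i \<le> j \<Longrightarrow> j < k \<Longrightarrow> x * gT j \<doteq> gT j * x"
  shows "x * f \<in> Uspan i G B"
  unfolding Uspan_def
proof (rule Uspan_left[OF f], fold Uspan_def)
  fix m and p :: "int \<Rightarrow>\<^sub>0 (hecke_gen, 'k) free_alg"
  assume m: "i \<le> m" "m \<le> k" and p: "p \<in> coeff_set G B"
  then have xG: "x \<in> free_span G" using x by simp
  have "x * (Sw m * laurent k p) \<doteq> Sw m * (x * laurent k p)"
    using rewrite_left[OF Sw_comm[of m x], of "laurent k p"] comm m by (simp add: mult.assoc)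
  also have "\<dots> \<doteq> Sw m * laurent k (Poly_Mapping.single 0 x * p)"
    using xG G free_span_mono by (intro rewrite_right mult_laurent) blast
  finally show "x * (Sw m * laurent k p) \<in> Uspan i G B"
    by (rule Uspan_eq) (use p xG m in \<open>auto intro!: Uspan_incl coeff_set_mult coeff_set_single[of 0 "{0}"]\<close>)
qed

lemma Uspan_const:
  assumes "f \<in> Uspan i G B" "G \<subseteq> dgens (k - 1)"
  shows "free_const c * f \<in> Uspan i G B"
  using assms by (intro Uspan_mult_comm) (auto simp: free_const_commute)

lemma Uspan_uminus: "f \<in> Uspan i G B \<Longrightarrow> G \<subseteq> dgens (k - 1) \<Longrightarrow> - f \<in> Uspan i G B"
  using Uspan_const[of f i G B "- 1"] by (simp add: free_const_uminus)

lemma Uspan_diff: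
  "f \<in> Uspan i G B \<Longrightarrow> g \<in> Uspan i G B \<Longrightarrow> G \<subseteq> dgens (k - 1) \<Longrightarrow> f - g \<in> Uspan i G B"
  using Uspan_add[OF _ Uspan_uminus, of f i G B g] by simp

text \<open>T_i passes the factors far from it, and at S_{i-1} S_i the braid identity
  \<open>T_S_S\<close> lowers its index by one; the rest commutes with T_{i-1}.\<close>

lemma T_Sw_shift:
  assumes "1 \<le> t" "t < i" "i < k"
  shows "gT i * Sw t \<doteq> Sw t * gT (i - 1)"
  using assms
proof (induction "i - t" arbitrary: t)
  case (Suc n)
  show ?case
  proof (cases "t = i - 1")
    case True
    then have i: "i = t + 1" using Suc by simp
    have comm: "gT t * Sw (Suc i) \<doteq> Sw (Suc i) * gT t"
      by (rule Sw_comm, rule T_far) (use i Suc in auto)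
    have "gT i * Sw t = gT (t + 1) * (S t * S (t + 1)) * Sw (Suc i)"
      using Suc i by (simp add: Sword_rec mult.assoc)
    also have "\<dots> \<doteq> S t * (S (t + 1) * gT t) * Sw (Suc i)"
      by (rule rewrite_left, rule T_S_S) (use Suc i in auto)
    also have "\<dots> = S t * (S (t + 1) * (gT t * Sw (Suc i)))" by (simp add: mult.assoc)
    also have "\<dots> \<doteq> S t * (S (t + 1) * (Sw (Suc i) * gT t))"
      by (intro rewrite_right comm)
    also have "\<dots> = Sw t * gT (i - 1)"
      using Suc i by (simp add: Sword_rec mult.assoc)
    finally show ?thesis .
  next
    case False
    then have t: "t < k" "Suc t < i" using Suc by auto
    have "gT i * Sw t = gT i * S t * Sw (Suc t)" using t by (simp add: Sword_rec mult.assoc)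
    also have "\<dots> \<doteq> S t * gT i * Sw (Suc t)"
      by (rule rewrite_left, rule T_far_S) (use Suc t in auto)
    also have "\<dots> = S t * (gT i * Sw (Suc t))" by (simp add: mult.assoc)
    also have "\<dots> \<doteq> S t * (Sw (Suc t) * gT (i - 1))"
      by (intro rewrite_right Suc(1)) (use Suc t in auto)
    also have "\<dots> = Sw t * gT (i - 1)" using t by (simp add: Sword_rec mult.assoc)
    finally show ?thesis .
  qed
qed simp

text \<open>The cases compare i with the starting index t. T_i commutes with the product, prolongs
  it through T_i = q S_i + (q - 1), cancels its first factor, or is shifted to T_{i-1}. A T_l that
  reaches the coefficient has l < k - 1 and so belongs to the smaller algebra.\<close>

lemma Uspan_T:
  assumes f: "f \<in> Uspan m G B" and G: "affine_gens (k - 1) \<subseteq> G" "G \<subseteq> dgens (k - 1)"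
    and i: "m' \<le> m" "1 \<le> m'" "m' \<le> i" "i < k"
  shows "gT i * f \<in> Uspan m' G B"
  unfolding Uspan_def
proof (rule Uspan_left[OF f], fold Uspan_def)
  fix t and p :: "int \<Rightarrow>\<^sub>0 (hecke_gen, 'k) free_alg"
  assume t: "m \<le> t" "t \<le> k" and p: "p \<in> coeff_set G B"
  have ik: "i \<in> {1..<k}" using i by simp
  have mult: "Sw t * (gT l * laurent k p) \<in> Uspan m' G B" if "1 \<le> l" "l < k - 1" for l
  proof (rule Uspan_eq)
    have l: "gT l \<in> free_span G" using that G by (auto simp: GenT_in)
    then show "Sw t * (gT l * laurent k p) \<doteq> Sw t * laurent k (Poly_Mapping.single 0 (gT l) * p)"
      using G free_span_mono by (intro rewrite_right mult_laurent) blast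
    show "Sw t * laurent k (Poly_Mapping.single 0 (gT l) * p) \<in> Uspan m' G B"
      using p t i l by (auto intro!: Uspan_incl coeff_set_mult coeff_set_single[of 0 "{0}"])
  qed
  consider "t > i + 1" | "t = i + 1" | "t = i" | "t < i" by linarith
  then show "gT i * (Sw t * laurent k p) \<in> Uspan m' G B"
  proof cases
    case 1
    have "gT i * Sw t \<doteq> Sw t * gT i"
      by (rule Sw_comm, rule T_far) (use 1 i in auto)
    then have "gT i * (Sw t * laurent k p) \<doteq> Sw t * (gT i * laurent k p)"
      using rewrite_left[of "gT i * Sw t" "Sw t * gT i"] by (simp add: mult.assoc)
    then show ?thesis using mult[of i] 1 t i by (auto intro: Uspan_eq)
  next
    case 2
    have "gT i * (Sw t * laurent k p)
        = free_const q * (Sw i * laurent k p) + free_const (q - 1) * (Sw t * laurent k p)"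
      using 2 i by (simp add: gT_eq_gS[OF q_nz, of i] Sword_rec[of i] algebra_simps)
    then show ?thesis using p t i 2 G
      by (auto intro!: Uspan_add Uspan_const Uspan_incl)
  next
    case 3
    have "gT i * (Sw t * laurent k p) \<doteq> Sw (Suc i) * laurent k p"
      using T_cancel(1)[OF ik, of "Sw (Suc i) * laurent k p"] 3 i by (simp add: Sword_rec mult.assoc)
    then show ?thesis using p t i 3 by (auto intro!: Uspan_incl intro: Uspan_eq)
  next
    case 4
    have "gT i * (Sw t * laurent k p) \<doteq> Sw t * (gT (i - 1) * laurent k p)"
      using rewrite_left[OF T_Sw_shift[of t i]] 4 i t by (simp add: mult.assoc)
    then show ?thesis using mult[of "i - 1"] 4 t i by (auto intro: Uspan_eq)
  qed
qed

lemma Uspan_laurent: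
  assumes f: "f \<in> Uspan i G B" and G: "G \<subseteq> dgens (k - 1)" and r: "r \<in> coeff_set G B'"
    and B: "\<And>a b. a \<in> B \<Longrightarrow> b \<in> B' \<Longrightarrow> a + b \<in> B''"
  shows "f * laurent k r \<in> Uspan i G B''"
  using f unfolding Uspan_def
proof (rule lin_hull_right, fold Uspan_def)
  fix e assume "e \<in> {Sw m * laurent k p |m p. i \<le> m \<and> m \<le> k \<and> p \<in> coeff_set G B}"
  then obtain m p where e: "e = Sw m * laurent k p" "i \<le> m" "m \<le> k" "p \<in> coeff_set G B" by blast
  have "Sw m * (laurent k p * laurent k r) \<doteq> Sw m * laurent k (p * r)"
    using e(4) free_span_mono[OF G] by (intro rewrite_right laurent_mult) (auto simp: coeff_set_def)
  moreover have "Sw m * laurent k (p * r) \<in> Uspan i G B''"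
    using e r B by (intro Uspan_incl coeff_set_mult)
  ultimately show "e * laurent k r \<in> Uspan i G B''"
    using e(1) by (auto simp: mult.assoc intro: Uspan_eq)
qed

abbreviation A0 where "A0 \<equiv> affine_gens (k - 1)"
abbreviation A1 where "A1 \<equiv> dgens (k - 1)"

text \<open>X_i turns into X_{i+1} at S_i, and so on up to X_k. Every error produced on the way has
  lost at least one inverse, has degree zero in \<open>X_k\<close>, and has coefficients without
  \<theta>.\<close>

lemma X_Sw_aux:
  assumes "1 \<le> i" "i \<le> k"
  shows "gX i * Sw i - Sw i * gX k \<in> Uspan (i + 1) A0 {0}"
  using assms
proof (induction "k - i" arbitrary: i)
  case 0
  then have i: "i = k" by simp
  show ?case unfolding i by (simp add: Uspan_0)
next
  case (Suc n)
  then have i: "i < k" "i \<in> {1..<k}" by auto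
  define D where "D = gX (i + 1) * Sw (i + 1) - Sw (i + 1) * gX k"
  have IH: "D \<in> Uspan (i + 2) A0 {0}" unfolding D_def using Suc(1)[of "i + 1"] Suc i by simp
  have comm: "gX i * Sw (i + 1) \<doteq> Sw (i + 1) * gX i"
    by (rule Sw_comm, rule cong_ideal_sym, rule T_X_far) (use Suc i in auto)
  have "gX i * Sw i - Sw i * gX k = gX i * S i * Sw (i + 1) - S i * (Sw (i + 1) * gX k)"
    using i by (simp add: Sword_rec mult.assoc)
  also have "\<dots> \<doteq> (S i * gX (i + 1) - free_const (1 - 1/q) * gX i) * Sw (i + 1) - S i * (Sw (i + 1) * gX k)"
    by (intro cong_ideal_diff rewrite_left X_S i cong_ideal_refl)
  also have "\<dots> = S i * D - free_const (1 - 1/q) * (gX i * Sw (i + 1))"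
    by (simp add: D_def algebra_simps)
  also have "\<dots> \<doteq> S i * D - free_const (1 - 1/q) * (Sw (i + 1) * gX i)"
    by (intro cong_ideal_diff rewrite_right comm cong_ideal_refl)
  finally have eq: "gX i * Sw i - Sw i * gX k \<doteq> S i * D - free_const (1 - 1/q) * (Sw (i + 1) * gX i)" .
  \<comment> \<open>\<open>D\<close> only involves inverses of index at least i + 2, so S_i commutes
    past them and turns into a coefficient.\<close>
  have "S i * D \<in> Uspan (i + 2) A0 {0}"
  proof (rule Uspan_mult_comm[OF IH affine_gens_dgens])
    show "S i * gT j \<doteq> gT j * S i" if "i + 2 \<le> j" "j < k" for j
      by (rule cong_ideal_sym, rule T_far_S) (use that Suc in auto)
  qed (use Suc in \<open>auto simp: GenT_in intro!: gS_free_span\<close>)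
  then have "S i * D \<in> Uspan (i + 1) A0 {0}" by (rule Uspan_mono) auto
  moreover have "Sw (i + 1) * laurent k (Poly_Mapping.single 0 (gX i)) \<in> Uspan (i + 1) A0 {0}"
    using i by (intro Uspan_incl coeff_set_single) (auto simp: GenX_in)
  ultimately show ?case
    using affine_gens_dgens by (intro Uspan_eq[OF eq] Uspan_diff Uspan_const) (auto simp: laurent_single)
qed

lemma X_Sw:
  assumes "1 \<le> i" "i \<le> k" "p \<in> coeff_set G B" "A0 \<subseteq> G" "G \<subseteq> A1"
    and B: "B \<subseteq> B'" "\<And>a. a \<in> B \<Longrightarrow> a + 1 \<in> B'"
  shows "gX i * (Sw i * laurent k p) \<in> Uspan i G B'"
proof -
  define D where "D = gX i * Sw i - Sw i * gX k"
  have D: "D \<in> Uspan i G {0}"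
    using X_Sw_aux[OF assms(1,2)] assms unfolding D_def by (auto intro: Uspan_mono)
  have "D * laurent k p \<in> Uspan i G B'"
    using D assms(3) by (rule Uspan_laurent[OF _ assms(5)]) (use B in auto)
  moreover have "Sw i * (gX k * laurent k p) \<in> Uspan i G B'"
    by (rule Uspan_eq[OF rewrite_right[OF X_laurent]], rule Uspan_incl)
      (use assms in \<open>auto intro!: coeff_set_mult coeff_set_single[of 1 "{1}"] simp: add.commute\<close>)
  moreover have "gX i * (Sw i * laurent k p) = D * laurent k p + Sw i * (gX k * laurent k p)"
    by (simp add: D_def algebra_simps)
  ultimately show ?thesis by (simp add: Uspan_add)
qed

text \<open>Repeated use of X_i\<inverse> S_i = (1/q) T_i X_{i+1}\<inverse>. No degree bound is
  tracked here, since negative powers do not occur in the differential of \<theta>.\<close>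

lemma Y_Sw:
  assumes "1 \<le> i" "i \<le> k" "p \<in> coeff_set A1 UNIV"
  shows "gXinv i * (Sw i * laurent k p) \<in> Uspan i A1 UNIV"
  using assms(1,2)
proof (induction "k - i" arbitrary: i)
  case 0
  then have i: "i = k" by simp
  have "Sw k * laurent k (Poly_Mapping.single (- 1) 1 * p) \<in> Uspan k A1 UNIV"
    using assms(3) by (intro Uspan_incl coeff_set_mult[of _ _ UNIV _ UNIV] coeff_set_single) auto
  then show ?case unfolding i using Y_laurent[of p] by (simp add: Uspan_eq)
next
  case (Suc n)
  then have i: "i < k" "i \<in> {1..<k}" by auto
  have "gXinv i * (Sw i * laurent k p) = gXinv i * S i * (Sw (i + 1) * laurent k p)"
    using i by (simp add: Sword_rec mult.assoc)
  also have "\<dots> \<doteq> free_const (1/q) * (gT i * gXinv (i + 1)) * (Sw (i + 1) * laurent k p)"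
    by (intro rewrite_left Y_S i)
  also have "\<dots> = free_const (1/q) * (gT i * (gXinv (i + 1) * (Sw (i + 1) * laurent k p)))"
    by (simp add: mult.assoc)
  finally have eq: "gXinv i * (Sw i * laurent k p) \<doteq> \<dots>" .
  have "gXinv (i + 1) * (Sw (i + 1) * laurent k p) \<in> Uspan (i + 1) A1 UNIV"
    using Suc(1)[of "i + 1"] Suc i by simp
  then have "gT i * (gXinv (i + 1) * (Sw (i + 1) * laurent k p)) \<in> Uspan i A1 UNIV"
    using affine_gens_dgens i by (intro Uspan_T[where m = "i + 1"]) auto
  then show ?case by (intro Uspan_eq[OF eq] Uspan_const) auto
qed

end


definition cyclotomic :: "'k list \<Rightarrow> ('g, 'k::field) free_alg \<Rightarrow> ('g, 'k) free_alg" where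
  "cyclotomic Qs x = foldr (\<lambda>c y. (x - free_const c) * y) Qs 1"

lemma cyclotomic_simps [simp]:
  "cyclotomic [] x = 1" "cyclotomic (c # Qs) x = (x - free_const c) * cyclotomic Qs x"
  by (simp_all add: cyclotomic_def)

context hecke_pos
begin

declare One_nat_def [simp del]

lemma Sw_1: "1 \<in> {1..<k} \<Longrightarrow> Sw 1 = S 1 * Sw 2"
  using Sword_rec[of 1 k q] by (simp add: numeral_2_eq_2 One_nat_def)

lemma Tword_1: "Tword 1 = gT 1"
  by (simp add: One_nat_def)

section \<open>Left multiplication on the full spanning set\<close>

abbreviation vterm where "vterm j x \<equiv> Tword j * (gTheta * (Sw 1 * x))"

definition dg_span :: "(hecke_gen, 'k) free_alg set" where
  "dg_span = lhull ({Sw m * laurent k p |m p. 1 \<le> m \<and> m \<le> k \<and> p \<in> coeff_set A1 UNIV} \<union>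
     {vterm j (laurent k p) |j p. j < k \<and> p \<in> coeff_set A1 UNIV})"

lemma dg_span_U: "f \<in> Uspan 1 A1 UNIV \<Longrightarrow> f \<in> dg_span"
  unfolding dg_span_def Uspan_def by (erule lin_hull_subset) (rule lin_hull_incl, blast)

lemma dg_span_V: "j < k \<Longrightarrow> p \<in> coeff_set A1 UNIV \<Longrightarrow> vterm j (laurent k p) \<in> dg_span"
  unfolding dg_span_def by (rule lin_hull_incl) blast

lemma dg_span_add: "f \<in> dg_span \<Longrightarrow> g \<in> dg_span \<Longrightarrow> f + g \<in> dg_span"
  unfolding dg_span_def by (rule lin_hull_add)

lemma dg_span_0: "0 \<in> dg_span"
  unfolding dg_span_def by (rule lin_hull.zero)

lemma dg_span_eq: "f \<doteq> g \<Longrightarrow> g \<in> dg_span \<Longrightarrow> f \<in> dg_span"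
  unfolding dg_span_def by (rule lin_hull_eq)

lemma dg_span_left:
  assumes "f \<in> dg_span"
    and "\<And>m p. 1 \<le> m \<Longrightarrow> m \<le> k \<Longrightarrow> p \<in> coeff_set A1 UNIV \<Longrightarrow> x * (Sw m * laurent k p) \<in> dg_span"
    and "\<And>j p. j < k \<Longrightarrow> p \<in> coeff_set A1 UNIV \<Longrightarrow> x * vterm j (laurent k p) \<in> dg_span"
  shows "x * f \<in> dg_span"
  using assms(1) unfolding dg_span_def
  by (rule lin_hull_left, fold dg_span_def) (use assms(2,3) in blast)

lemma coeff_set_mult_left:
  assumes "x \<in> free_span A1" "p \<in> coeff_set A1 UNIV"
  shows "Poly_Mapping.single 0 x * p \<in> coeff_set A1 UNIV"
  using assms by (intro coeff_set_mult[of _ _ UNIV _ UNIV] coeff_set_single) auto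

lemma dg_span_V_mult:
  assumes "j < k" "p \<in> coeff_set A1 UNIV" "x \<in> free_span A1"
  shows "vterm j (x * laurent k p) \<in> dg_span"
proof (rule dg_span_eq)
  show "vterm j (x * laurent k p) \<doteq> vterm j (laurent k (Poly_Mapping.single 0 x * p))"
    by (intro rewrite_right mult_laurent assms)
  show "vterm j (laurent k (Poly_Mapping.single 0 x * p)) \<in> dg_span"
    by (intro dg_span_V coeff_set_mult_left assms)
qed

lemma dg_span_U_mult:
  assumes "1 \<le> m" "m \<le> k" "p \<in> coeff_set A1 UNIV" "x \<in> free_span A1"
  shows "Sw m * (x * laurent k p) \<in> Uspan m A1 UNIV"
  by (rule Uspan_eq, rule rewrite_right, rule mult_laurent)
    (intro assms Uspan_incl coeff_set_mult_left order_refl)+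

lemma dg_span_const: "f \<in> dg_span \<Longrightarrow> free_const c * f \<in> dg_span"
proof (erule dg_span_left)
  fix j and p :: "int \<Rightarrow>\<^sub>0 (hecke_gen, 'k) free_alg"
  assume "j < k" "p \<in> coeff_set A1 UNIV"
  then have "vterm j (free_const c * laurent k p) \<in> dg_span" by (rule dg_span_V_mult) simp
  then show "free_const c * vterm j (laurent k p) \<in> dg_span"
    by (simp add: const_mid[of "Sw 1"] const_mid[of "Tword j"] gen_const')
next
  fix m and p :: "int \<Rightarrow>\<^sub>0 (hecke_gen, 'k) free_alg"
  assume m: "1 \<le> m" "m \<le> k" "p \<in> coeff_set A1 UNIV"
  show "free_const c * (Sw m * laurent k p) \<in> dg_span"
    by (intro dg_span_U Uspan_const Uspan_incl) (use m in auto)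
qed

lemma dg_span_uminus: "f \<in> dg_span \<Longrightarrow> - f \<in> dg_span"
  using dg_span_const[of f "- 1"] by (simp add: free_const_uminus)

lemma dg_span_diff: "f \<in> dg_span \<Longrightarrow> g \<in> dg_span \<Longrightarrow> f - g \<in> dg_span"
  using dg_span_add[OF _ dg_span_uminus, of f g] by simp

lemma comm_tail: "x * a \<doteq> a * x \<Longrightarrow> x * (a * y) \<doteq> a * (x * y)"
  using rewrite_left[of "x * a" "a * x" y] by (simp add: mult.assoc)

lemma comm_tail2: "x * a \<doteq> a * x' \<Longrightarrow> x * (a * y) \<doteq> a * (x' * y)"
  using rewrite_left[of "x * a" "a * x'" y] by (simp add: mult.assoc)

text \<open>For m = 1 a basis element with \<theta> arises. For m > 1 only T_j with j \<ge> 2 are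
  involved, so \<theta> passes them and becomes a coefficient; k \<ge> 2 then ensures that the
  smaller algebra contains \<theta>.\<close>

lemma dg_span_theta_U:
  assumes "f \<in> Uspan 1 A1 UNIV"
  shows "gTheta * f \<in> dg_span"
  unfolding dg_span_def
proof (rule Uspan_left[OF assms], fold dg_span_def)
  fix m and p :: "int \<Rightarrow>\<^sub>0 (hecke_gen, 'k) free_alg"
  assume m: "1 \<le> m" "m \<le> k" and p: "p \<in> coeff_set A1 UNIV"
  show "gTheta * (Sw m * laurent k p) \<in> dg_span"
  proof (cases "m = 1")
    case True
    then show ?thesis using dg_span_V[of 0 p] p k_pos by simp
  next
    case False
    then have "GenTheta \<in> A1" using m by (intro GenTheta_in) auto
    have "gTheta * (Sw m * laurent k p) \<doteq> Sw m * (gTheta * laurent k p)"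
      by (intro comm_tail Sw_comm cong_ideal_sym[OF T_theta]) (use m False in auto)
    then show ?thesis
      by (rule dg_span_eq)
        (use dg_span_U_mult[of m p gTheta] m p \<open>GenTheta \<in> A1\<close> in \<open>auto intro!: dg_span_U intro: Uspan_mono\<close>)
  qed
qed

lemma Tword_comm:
  assumes "\<And>i. 1 \<le> i \<Longrightarrow> i \<le> j \<Longrightarrow> x * gT i \<doteq> gT i * x"
  shows "x * Tword j \<doteq> Tword j * x"
  using assms by (induction j) (auto intro!: comm_mult)

text \<open>Mirror image of \<open>T_Sw_shift\<close>: in a descending product the braid relation
  raises the index by one.\<close>

lemma Tword_shift:
  assumes "1 \<le> i" "i < j" "j < k"
  shows "gT i * Tword j \<doteq> Tword j * gT (i + 1)"
  using assms
proof (induction j)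
  case (Suc j)
  show ?case
  proof (cases "i = j")
    case True
    then obtain l where l: "i = Suc l" "j = Suc l" using Suc(2) by (cases i) auto
    have comm: "gT (i + 1) * Tword l \<doteq> Tword l * gT (i + 1)"
      by (rule Tword_comm, rule T_far) (use l Suc in auto)
    have "gT i * Tword (Suc j) = gT i * (gT (i + 1) * gT i) * Tword l"
      using l by (simp add: mult.assoc One_nat_def)
    also have "\<dots> \<doteq> gT (i + 1) * (gT i * gT (i + 1)) * Tword l"
      by (rule rewrite_left, rule braid) (use l Suc in auto)
    also have "\<dots> = gT (i + 1) * (gT i * (gT (i + 1) * Tword l))" by (simp add: mult.assoc)
    also have "\<dots> \<doteq> gT (i + 1) * (gT i * (Tword l * gT (i + 1)))"
      by (intro rewrite_right comm)
    also have "\<dots> = Tword (Suc j) * gT (i + 1)" using l by (simp add: mult.assoc One_nat_def)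
    finally show ?thesis .
  next
    case False
    have "gT i * Tword (Suc j) \<doteq> gT (Suc j) * (gT i * Tword j)"
      unfolding Tword.simps by (rule comm_tail, rule T_far) (use False Suc in auto)
    also have "\<dots> \<doteq> gT (Suc j) * (Tword j * gT (i + 1))"
      by (rule rewrite_right, rule Suc.IH) (use False Suc in auto)
    finally show ?thesis by (simp add: mult.assoc)
  qed
qed simp

lemma T_vtail:
  assumes "2 \<le> l" "l < k"
  shows "gT l * (gTheta * (Sw 1 * x)) \<doteq> gTheta * (Sw 1 * (gT (l - 1) * x))"
proof -
  have "gT l * (gTheta * (Sw 1 * x)) \<doteq> gTheta * (gT l * (Sw 1 * x))"
    by (rule comm_tail, rule T_theta) (use assms in auto)
  also have "\<dots> \<doteq> gTheta * (Sw 1 * (gT (l - 1) * x))"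
    by (intro rewrite_right comm_tail2 T_Sw_shift) (use assms in auto)
  finally show ?thesis .
qed

text \<open>On T_j ... T_1 \<theta> S_1 ... S_{k-1}: for i > j + 1, T_i reaches the coefficient as
  T_{i-1}; for i = j + 1 it prolongs the product; for i = j the quadratic relation shortens it; for
  i < j it is raised to T_{i+1}, then lowered to T_i again at the inverses.\<close>

lemma dg_span_T:
  assumes i: "i \<in> {1..<k}" and f: "f \<in> dg_span"
  shows "gT i * f \<in> dg_span"
  using f
proof (rule dg_span_left)
  fix m and p :: "int \<Rightarrow>\<^sub>0 (hecke_gen, 'k) free_alg"
  assume m: "1 \<le> m" "m \<le> k" "p \<in> coeff_set A1 UNIV"
  show "gT i * (Sw m * laurent k p) \<in> dg_span"
    by (intro dg_span_U Uspan_T[of _ m] Uspan_incl) (use m i affine_gens_dgens in auto)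
next
  fix j and p :: "int \<Rightarrow>\<^sub>0 (hecke_gen, 'k) free_alg"
  assume j: "j < k" and p: "p \<in> coeff_set A1 UNIV"
  have V: "vterm j (gT l * laurent k p) \<in> dg_span" if "1 \<le> l" "l < k - 1" for l
    by (rule dg_span_V_mult[OF j p])
      (use that affine_gens_dgens[of "k - 1"] GenT_in[of l "k - 1"] in auto)
  consider "i > j + 1" | "i = j + 1" | "i = j" | "i < j" by linarith
  then show "gT i * vterm j (laurent k p) \<in> dg_span"
  proof cases
    case 1
    have "gT i * vterm j (laurent k p) \<doteq> Tword j * (gT i * (gTheta * (Sw 1 * laurent k p)))"
      by (rule comm_tail, rule Tword_comm, rule T_far) (use 1 i in auto)
    also have "\<dots> \<doteq> vterm j (gT (i - 1) * laurent k p)"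
      by (intro rewrite_right T_vtail) (use 1 i in auto)
    finally show ?thesis by (rule dg_span_eq) (use 1 i in \<open>auto intro!: V\<close>)
  next
    case 2
    then show ?thesis using dg_span_V[of "j + 1" p] p i by (simp add: mult.assoc One_nat_def)
  next
    case 3
    then obtain l where l: "j = Suc l" using i by (cases j) auto
    have "gT i * vterm j (laurent k p) = gT i * gT i * vterm l (laurent k p)"
      using l 3 by (simp add: mult.assoc)
    also have "\<dots> \<doteq> (free_const (q - 1) * gT i + free_const q) * vterm l (laurent k p)"
      by (intro rewrite_left T_quadratic i)
    also have "\<dots> = free_const (q - 1) * vterm j (laurent k p) + free_const q * vterm l (laurent k p)"
      using l 3 by (simp add: algebra_simps)
    finally show ?thesis
      by (rule dg_span_eq) (use l j p in \<open>auto intro!: dg_span_add dg_span_const dg_span_V simp del: Tword.simps\<close>)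
  next
    case 4
    have "gT i * vterm j (laurent k p) \<doteq> Tword j * (gT (i + 1) * (gTheta * (Sw 1 * laurent k p)))"
      by (rule comm_tail2, rule Tword_shift) (use 4 i j in auto)
    also have "\<dots> \<doteq> vterm j (gT i * laurent k p)"
      using T_vtail[of "i + 1"] 4 i j by (intro rewrite_right) auto
    finally show ?thesis by (rule dg_span_eq) (use 4 i j in \<open>auto intro!: V\<close>)
  qed
qed

lemma dg_span_S: "i \<in> {1..<k} \<Longrightarrow> f \<in> dg_span \<Longrightarrow> S i * f \<in> dg_span"
  by (auto simp: gS_def mult.assoc left_diff_distrib intro!: dg_span_const dg_span_diff dg_span_T)

text \<open>Reduces X_1, its inverse and \<theta> to the case j = 1: they commute with T_j, ...,
  T_2, and these are absorbed because \<open>dg_span\<close> is stable under every T_i.\<close>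

lemma dg_span_Tword_comm:
  assumes "\<And>i. 2 \<le> i \<Longrightarrow> i < k \<Longrightarrow> x * gT i \<doteq> gT i * x" "x * (gT 1 * y) \<in> dg_span"
    and "1 \<le> j" "j < k"
  shows "x * (Tword j * y) \<in> dg_span"
  using assms(3,4)
proof (induction j rule: dec_induct)
  case base
  then show ?case using assms(2) by (simp add: mult.assoc One_nat_def)
next
  case (step j)
  have "x * (Tword (Suc j) * y) = x * (gT (Suc j) * (Tword j * y))" by (simp add: mult.assoc)
  also have "\<dots> \<doteq> gT (Suc j) * (x * (Tword j * y))"
    by (rule comm_tail, rule assms(1)) (use step in auto)
  finally show ?case
    by (rule dg_span_eq) (use step in \<open>auto intro!: dg_span_T\<close>)
qed

lemma X1_Uspan:
  assumes f: "f \<in> Uspan 1 G B" and G: "A0 \<subseteq> G" "G \<subseteq> A1"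
    and B: "B \<subseteq> B'" "\<And>a. a \<in> B \<Longrightarrow> a + 1 \<in> B'"
  shows "gX 1 * f \<in> Uspan 1 G B'"
  unfolding Uspan_def
proof (rule Uspan_left[OF f], fold Uspan_def)
  fix m and p :: "int \<Rightarrow>\<^sub>0 (hecke_gen, 'k) free_alg"
  assume m: "1 \<le> m" "m \<le> k" and p: "p \<in> coeff_set G B"
  show "gX 1 * (Sw m * laurent k p) \<in> Uspan 1 G B'"
  proof (cases "m = 1")
    case True
    then show ?thesis using X_Sw[of 1 p G B B'] m p G B by simp
  next
    case False
    have "gX 1 * (Sw m * laurent k p) \<in> Uspan m G B"
    proof (rule Uspan_mult_comm)
      show "gX 1 * gT j \<doteq> gT j * gX 1" if "m \<le> j" "j < k" for j
        by (rule cong_ideal_sym, rule T_X_far) (use that m False in auto)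
      show "gX 1 \<in> free_span G" using G False m by (auto simp: GenX_in)
    qed (use m p G in \<open>auto intro: Uspan_incl\<close>)
    then show ?thesis by (rule Uspan_mono) (use m B in auto)
  qed
qed

text \<open>The critical case is j = 1: X_1 T_1 = q S_1 X_2, then X_2 passes \<theta>, and X_2 S_1 =
  (1/q) T_1 X_1, where X_1 passes S_2, ..., S_{k-1} and joins the coefficient.\<close>

lemma dg_span_X1:
  assumes f: "f \<in> dg_span"
  shows "gX 1 * f \<in> dg_span"
  using f
proof (rule dg_span_left)
  fix m and p :: "int \<Rightarrow>\<^sub>0 (hecke_gen, 'k) free_alg"
  assume m: "1 \<le> m" "m \<le> k" "p \<in> coeff_set A1 UNIV"
  show "gX 1 * (Sw m * laurent k p) \<in> dg_span"
    by (intro dg_span_U X1_Uspan[where B = UNIV] Uspan_incl) (use m affine_gens_dgens in auto)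
next
  fix j and p :: "int \<Rightarrow>\<^sub>0 (hecke_gen, 'k) free_alg"
  assume j: "j < k" and p: "p \<in> coeff_set A1 UNIV"
  let ?L = "laurent k p"
  show "gX 1 * vterm j ?L \<in> dg_span"
  proof (cases "j = 0")
    case True
    have "gX 1 * (gTheta * (Sw 1 * ?L)) \<doteq> gTheta * (gX 1 * (Sw 1 * ?L))"
      by (rule comm_tail, rule X_theta) (use k_pos in auto)
    moreover have "gTheta * (gX 1 * (Sw 1 * ?L)) \<in> dg_span"
      by (intro dg_span_theta_U X1_Uspan[where B = UNIV] Uspan_incl) (use k_pos p affine_gens_dgens in auto)
    ultimately show ?thesis using True by (auto intro: dg_span_eq)
  next
    case False
    then have k: "1 \<in> {1..<k}" "1 + 1 \<in> {1..k}" using j by auto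
    have X1: "gX 1 \<in> free_span A1" using k affine_gens_dgens[of "k - 1"] GenX_in[of 1 "k - 1"] by auto
    have X2: "gX (1 + 1) * (Sw 1 * ?L) \<in> Uspan 1 A1 UNIV"
    proof (rule Uspan_eq)
      have "gX (1 + 1) * (Sw 1 * ?L) = gX (1 + 1) * S 1 * (Sw 2 * ?L)"
        using k by (simp add: Sw_1[OF k(1)] mult.assoc)
      also have "\<dots> \<doteq> free_const (1/q) * (gT 1 * gX 1) * (Sw 2 * ?L)"
        by (rule rewrite_left[OF X_Suc_S[OF k(1)]])
      also have "\<dots> = free_const (1/q) * (gT 1 * (gX 1 * (Sw 2 * ?L)))" by (simp add: mult.assoc)
      also have "\<dots> \<doteq> free_const (1/q) * (gT 1 * (Sw 2 * (gX 1 * ?L)))"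
        by (intro rewrite_right comm_tail Sw_comm cong_ideal_sym[OF T_X_far]) (use k in auto)
      finally show "gX (1 + 1) * (Sw 1 * ?L) \<doteq> \<dots>" .
      have "Sw 2 * (gX 1 * ?L) \<in> Uspan 2 A1 UNIV"
        using k p X1 by (intro dg_span_U_mult) auto
      then show "free_const (1/q) * (gT 1 * (Sw 2 * (gX 1 * ?L))) \<in> Uspan 1 A1 UNIV"
        by (intro Uspan_const Uspan_T[where m = 2]) (use k affine_gens_dgens in auto)
    qed
    have "gX 1 * (gT 1 * (gTheta * (Sw 1 * ?L))) = (gX 1 * gT 1) * (gTheta * (Sw 1 * ?L))"
      by (simp add: mult.assoc)
    also have "\<dots> \<doteq> free_const q * (S 1 * gX (1 + 1)) * (gTheta * (Sw 1 * ?L))"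
      by (rule rewrite_left[OF X_T[OF k(1)]])
    also have "\<dots> = free_const q * (S 1 * (gX (1 + 1) * (gTheta * (Sw 1 * ?L))))"
      by (simp add: mult.assoc)
    also have "\<dots> \<doteq> free_const q * (S 1 * (gTheta * (gX (1 + 1) * (Sw 1 * ?L))))"
      by (intro rewrite_right comm_tail X_theta k)
    finally have eq: "gX 1 * (gT 1 * (gTheta * (Sw 1 * ?L))) \<doteq> \<dots>" .
    show ?thesis
    proof (rule dg_span_Tword_comm)
      show "gX 1 * gT i \<doteq> gT i * gX 1" if "2 \<le> i" "i < k" for i
        by (rule cong_ideal_sym, rule T_X_far) (use that in auto)
      show "gX 1 * (gT 1 * (gTheta * (Sw 1 * ?L))) \<in> dg_span"
        by (rule dg_span_eq[OF eq]) (intro dg_span_const dg_span_S dg_span_theta_U X2 k)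
    qed (use False j in auto)
  qed
qed

text \<open>As for X_1, except that moving the inverse past T_1 and S_1 leaves correction terms;
  these are covered by the case j = 0 and by \<open>Y_Sw\<close>.\<close>

lemma dg_span_Y1:
  assumes f: "f \<in> dg_span"
  shows "gXinv 1 * f \<in> dg_span"
  using f
proof (rule dg_span_left)
  fix m and p :: "int \<Rightarrow>\<^sub>0 (hecke_gen, 'k) free_alg"
  assume m: "1 \<le> m" "m \<le> k" "p \<in> coeff_set A1 UNIV"
  show "gXinv 1 * (Sw m * laurent k p) \<in> dg_span"
  proof (cases "m = 1")
    case True
    then show ?thesis using Y_Sw[of 1 p] m by (simp add: dg_span_U)
  next
    case False
    have "gXinv 1 * (Sw m * laurent k p) \<in> Uspan m A1 UNIV"
    proof (rule Uspan_mult_comm)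
      show "gXinv 1 * gT j \<doteq> gT j * gXinv 1" if "m \<le> j" "j < k" for j
        by (rule cong_ideal_sym, rule T_Y_far) (use that m False in auto)
      show "gXinv 1 \<in> free_span A1"
        using False m affine_gens_dgens[of "k - 1"] GenXinv_in[of 1 "k - 1"] by auto
    qed (use m in \<open>auto intro: Uspan_incl\<close>)
    then show ?thesis by (intro dg_span_U, rule Uspan_mono) (use m in auto)
  qed
next
  fix j and p :: "int \<Rightarrow>\<^sub>0 (hecke_gen, 'k) free_alg"
  assume j: "j < k" and p: "p \<in> coeff_set A1 UNIV"
  let ?L = "laurent k p"
  have Y1: "gXinv 1 * (gTheta * (Sw 1 * ?L)) \<in> dg_span"
  proof (rule dg_span_eq)
    show "gXinv 1 * (gTheta * (Sw 1 * ?L)) \<doteq> gTheta * (gXinv 1 * (Sw 1 * ?L))"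
      by (rule comm_tail, rule Y_theta) (use k_pos in auto)
    show "gTheta * (gXinv 1 * (Sw 1 * ?L)) \<in> dg_span"
      by (intro dg_span_theta_U Y_Sw) (use k_pos p in auto)
  qed
  show "gXinv 1 * vterm j ?L \<in> dg_span"
  proof (cases "j = 0")
    case True
    then show ?thesis using Y1 by simp
  next
    case False
    then have k: "1 \<in> {1..<k}" "1 + 1 \<in> {1..k}" using j by auto
    have Y1': "gXinv 1 \<in> free_span A1"
      using k affine_gens_dgens[of "k - 1"] GenXinv_in[of 1 "k - 1"] by auto
    have Y2: "gXinv (1 + 1) * (Sw 1 * ?L) \<in> Uspan 1 A1 UNIV"
    proof (rule Uspan_eq)
      have "gXinv (1 + 1) * (Sw 1 * ?L) = gXinv (1 + 1) * S 1 * (Sw 2 * ?L)"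
        using k by (simp add: Sw_1[OF k(1)] mult.assoc)
      also have "\<dots> \<doteq> (S 1 * gXinv 1 - free_const (1 - 1/q) * gXinv (1 + 1)) * (Sw 2 * ?L)"
        by (rule rewrite_left[OF Y_Suc_S[OF k(1)]])
      also have "\<dots> = S 1 * (gXinv 1 * (Sw 2 * ?L)) - free_const (1 - 1/q) * (gXinv 2 * (Sw 2 * ?L))"
        by (simp add: algebra_simps)
      also have "\<dots> \<doteq> S 1 * (Sw 2 * (gXinv 1 * ?L)) - free_const (1 - 1/q) * (gXinv 2 * (Sw 2 * ?L))"
        by (intro cong_ideal_diff cong_ideal_refl rewrite_right comm_tail Sw_comm
            cong_ideal_sym[OF T_Y_far]) (use k in auto)
      also have "\<dots> = Sw 1 * (gXinv 1 * ?L) - free_const (1 - 1/q) * (gXinv 2 * (Sw 2 * ?L))"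
        using k by (simp add: Sw_1[OF k(1)] mult.assoc)
      finally show "gXinv (1 + 1) * (Sw 1 * ?L) \<doteq> \<dots>" .
      have "gXinv 2 * (Sw 2 * ?L) \<in> Uspan 1 A1 UNIV"
        by (rule Uspan_mono[OF Y_Sw]) (use k p in auto)
      then show "Sw 1 * (gXinv 1 * ?L) - free_const (1 - 1/q) * (gXinv 2 * (Sw 2 * ?L)) \<in> Uspan 1 A1 UNIV"
        using k p Y1' by (intro Uspan_diff Uspan_const dg_span_U_mult) auto
    qed
    have "gXinv 1 * (gT 1 * (gTheta * (Sw 1 * ?L))) = (gXinv 1 * gT 1) * (gTheta * (Sw 1 * ?L))"
      by (simp add: mult.assoc)
    also have "\<dots> \<doteq> (gT 1 * gXinv (1 + 1) + free_const (q - 1) * gXinv 1) * (gTheta * (Sw 1 * ?L))"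
      by (rule rewrite_left[OF Y_T[OF k(1)]])
    also have "\<dots> = gT 1 * (gXinv (1 + 1) * (gTheta * (Sw 1 * ?L)))
        + free_const (q - 1) * (gXinv 1 * (gTheta * (Sw 1 * ?L)))"
      by (simp add: algebra_simps)
    also have "\<dots> \<doteq> gT 1 * (gTheta * (gXinv (1 + 1) * (Sw 1 * ?L)))
        + free_const (q - 1) * (gXinv 1 * (gTheta * (Sw 1 * ?L)))"
      by (intro cong_ideal_add cong_ideal_refl rewrite_right comm_tail Y_theta k)
    finally have eq: "gXinv 1 * (gT 1 * (gTheta * (Sw 1 * ?L))) \<doteq> \<dots>" .
    show ?thesis
    proof (rule dg_span_Tword_comm)
      show "gXinv 1 * gT i \<doteq> gT i * gXinv 1" if "2 \<le> i" "i < k" for i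
        by (rule cong_ideal_sym, rule T_Y_far) (use that in auto)
      show "gXinv 1 * (gT 1 * (gTheta * (Sw 1 * ?L))) \<in> dg_span"
        by (rule dg_span_eq[OF eq]) (intro dg_span_add dg_span_const dg_span_T dg_span_theta_U Y2 k Y1)
    qed (use False j in auto)
  qed
qed

text \<open>\<theta> \<theta> vanishes for j = 0. For j \<ge> 1 the anticommutation with T_1
  \<theta> S_1 moves \<theta> to the right of S_1, where it passes the remaining inverses and
  becomes a coefficient.\<close>

lemma dg_span_theta:
  assumes f: "f \<in> dg_span"
  shows "gTheta * f \<in> dg_span"
  using f
proof (rule dg_span_left)
  fix m and p :: "int \<Rightarrow>\<^sub>0 (hecke_gen, 'k) free_alg"
  assume m: "1 \<le> m" "m \<le> k" "p \<in> coeff_set A1 UNIV"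
  show "gTheta * (Sw m * laurent k p) \<in> dg_span"
    by (intro dg_span_theta_U Uspan_incl) (use m in auto)
next
  fix j and p :: "int \<Rightarrow>\<^sub>0 (hecke_gen, 'k) free_alg"
  assume j: "j < k" and p: "p \<in> coeff_set A1 UNIV"
  let ?L = "laurent k p"
  show "gTheta * vterm j ?L \<in> dg_span"
  proof (cases "j = 0")
    case True
    have "gTheta * vterm j ?L \<doteq> 0"
      using rewrite_left[OF theta_theta, of "Sw 1 * ?L"] True by (simp add: mult.assoc)
    then show ?thesis by (rule dg_span_eq) (rule dg_span_0)
  next
    case False
    then have k: "1 \<in> {1..<k}" "1 < k" using j by auto
    then have theta: "gTheta \<in> free_span A1" by (simp add: GenTheta_in)
    have "gTheta * (gT 1 * (gTheta * (Sw 1 * ?L))) = gTheta * (gT 1 * (gTheta * S 1)) * (Sw 2 * ?L)"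
      using k by (simp add: Sw_1[OF k(1)] mult.assoc)
    also have "\<dots> \<doteq> - (gT 1 * (gTheta * (S 1 * gTheta))) * (Sw 2 * ?L)"
      by (rule rewrite_left[OF theta_T_theta_S[OF k(2)]])
    also have "\<dots> = - (gT 1 * (gTheta * (S 1 * (gTheta * (Sw 2 * ?L)))))"
      by (simp add: mult.assoc)
    also have "\<dots> \<doteq> - (gT 1 * (gTheta * (S 1 * (Sw 2 * (gTheta * ?L)))))"
      by (intro cong_ideal_uminus rewrite_right comm_tail Sw_comm cong_ideal_sym[OF T_theta]) auto
    also have "\<dots> = - vterm 1 (gTheta * ?L)"
      using k by (simp add: Sw_1[OF k(1)] mult.assoc Tword_1)
    finally have eq: "gTheta * (gT 1 * (gTheta * (Sw 1 * ?L))) \<doteq> \<dots>" .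
    show ?thesis
    proof (rule dg_span_Tword_comm)
      show "gTheta * gT i \<doteq> gT i * gTheta" if "2 \<le> i" "i < k" for i
        by (rule cong_ideal_sym, rule T_theta) (use that in auto)
      show "gTheta * (gT 1 * (gTheta * (Sw 1 * ?L))) \<in> dg_span"
        by (rule dg_span_eq[OF eq]) (intro dg_span_uminus dg_span_V_mult k p theta)
    qed (use False j in auto)
  qed
qed

lemma dg_span_X: "1 \<le> i \<Longrightarrow> i \<le> k \<Longrightarrow> f \<in> dg_span \<Longrightarrow> gX i * f \<in> dg_span"
proof (induction i arbitrary: f rule: dec_induct)
  case base
  then show ?case by (simp add: dg_span_X1)
next
  case (step i)
  then have i: "i \<in> {1..<k}" by auto
  have "gX (Suc i) * f \<doteq> free_const (1/q) * (gT i * (gX i * gT i)) * f"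
    using X_from_T[OF i] by (intro rewrite_left) (simp add: One_nat_def)
  then show ?case
    unfolding mult.assoc
    by (rule dg_span_eq) (intro dg_span_const dg_span_T i step.IH, use step.prems in auto)
qed

lemma dg_span_Y: "1 \<le> i \<Longrightarrow> i \<le> k \<Longrightarrow> f \<in> dg_span \<Longrightarrow> gXinv i * f \<in> dg_span"
proof (induction i arbitrary: f rule: dec_induct)
  case base
  then show ?case by (simp add: dg_span_Y1)
next
  case (step i)
  then have i: "i \<in> {1..<k}" by auto
  have "gXinv (Suc i) * f \<doteq> free_const q * (S i * (gXinv i * S i)) * f"
    using Y_from_S[OF i] by (intro rewrite_left) (simp add: One_nat_def)
  then show ?case
    unfolding mult.assoc
    by (rule dg_span_eq) (intro dg_span_const dg_span_S i step.IH, use step.prems in auto)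
qed

text \<open>\<open>dg_span\<close> contains the constants (starting index k, an empty product) and
  is stable under left multiplication by every generator, since X_i and its inverse reduce to index
  1 by conjugation.\<close>

theorem free_span_dg_span: "f \<in> free_span (dgens k) \<Longrightarrow> f \<in> dg_span"
proof (induction f rule: free_span_induct)
  case (word c u)
  then show ?case
  proof (induction u)
    case Nil
    have "Sw k * laurent k (Poly_Mapping.single 0 (free_const c)) \<in> dg_span"
      by (intro dg_span_U Uspan_incl coeff_set_single) (use k_pos in auto)
    then show ?case by (simp add: laurent_single free_const_eq)
  next
    case (Cons g u)
    then have "g \<in> dgens k" "word_term u c \<in> dg_span" by auto
    then show ?case unfolding word_term_Cons
      by (cases rule: dgens_cases) (auto intro: dg_span_T dg_span_X dg_span_Y dg_span_theta)
  qed
qed (rule dg_span_add)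

text \<open>The index is shifted by one so that j matches \<open>vcomb\<close>: replacing \<theta>
  by 1 turns \<open>vterm j\<close> into the product starting at \<open>Suc j\<close>, see
  \<open>Tword_Sw\<close>.\<close>

definition ucomb :: "(nat \<Rightarrow> int \<Rightarrow>\<^sub>0 (hecke_gen, 'k) free_alg) \<Rightarrow> (hecke_gen, 'k) free_alg" where
  "ucomb p = (\<Sum>j<k. Sw (Suc j) * laurent k (p j))"

definition vcomb :: "(nat \<Rightarrow> int \<Rightarrow>\<^sub>0 (hecke_gen, 'k) free_alg) \<Rightarrow> (hecke_gen, 'k) free_alg" where
  "vcomb p = (\<Sum>j<k. vterm j (laurent k (p j)))"

lemma ucomb_add: "ucomb (\<lambda>j. p j + r j) = ucomb p + ucomb r"
  and vcomb_add: "vcomb (\<lambda>j. p j + r j) = vcomb p + vcomb r"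
  by (simp_all add: ucomb_def vcomb_def laurent_add algebra_simps sum.distrib)

lemma ucomb_0 [simp]: "ucomb (\<lambda>j. 0) = 0"
  and vcomb_0 [simp]: "vcomb (\<lambda>j. 0) = 0"
  by (simp_all add: ucomb_def vcomb_def)

lemma ucomb_uminus: "ucomb (\<lambda>j. - p j) = - ucomb p"
  and vcomb_uminus: "vcomb (\<lambda>j. - p j) = - vcomb p"
  by (simp_all add: ucomb_def vcomb_def laurent_uminus sum_negf)

lemma ucomb_single: "m < k \<Longrightarrow> ucomb (\<lambda>j. if j = m then p else 0) = Sw (Suc m) * laurent k p"
  unfolding ucomb_def by (subst sum.remove[of _ m]) (auto intro!: sum.neutral)

lemma vcomb_single: "m < k \<Longrightarrow> vcomb (\<lambda>j. if j = m then p else 0) = vterm m (laurent k p)"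
  unfolding vcomb_def by (subst sum.remove[of _ m]) (auto intro!: sum.neutral)

lemma Uspan_ucomb:
  assumes "f \<in> Uspan 1 G B"
  shows "\<exists>p. (\<forall>j. p j \<in> coeff_set G B) \<and> f \<doteq> ucomb p"
  using assms unfolding Uspan_def
proof induction
  case zero
  then show ?case by (intro exI[of _ "\<lambda>j. 0"]) simp
next
  case (add e f)
  then obtain p where p: "\<forall>j. p j \<in> coeff_set G B" "f \<doteq> ucomb p" by blast
  from add obtain m r where e: "e = Sw m * laurent k r" "1 \<le> m" "m \<le> k" "r \<in> coeff_set G B" by blast
  have "e = ucomb (\<lambda>j. if j = m - 1 then r else 0)"
    using e by (subst ucomb_single) auto
  then have "e + f \<doteq> ucomb (\<lambda>j. (if j = m - 1 then r else 0) + p j)"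
    unfolding ucomb_add using p by (simp add: cong_ideal_add)
  then show ?case using p e
    by (intro exI[of _ "\<lambda>j. (if j = m - 1 then r else 0) + p j"]) (auto intro!: coeff_set_add)
next
  case (cong f g)
  then show ?case by (meson cong_ideal_sym cong_ideal_trans)
qed

theorem spanning:
  assumes "f \<in> free_span (dgens k)"
  shows "\<exists>p r. (\<forall>j. p j \<in> coeff_set A1 UNIV) \<and> (\<forall>j. r j \<in> coeff_set A1 UNIV) \<and> f \<doteq> ucomb p + vcomb r"
  using free_span_dg_span[OF assms] unfolding dg_span_def
proof induction
  case zero
  then show ?case by (intro exI[of _ "\<lambda>j. 0"]) simp
next
  case (add e f)
  then obtain p r where p: "\<forall>j. p j \<in> coeff_set A1 UNIV" "\<forall>j. r j \<in> coeff_set A1 UNIV"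
    "f \<doteq> ucomb p + vcomb r" by blast
  have "\<exists>p r. (\<forall>j. p j \<in> coeff_set A1 UNIV) \<and> (\<forall>j. r j \<in> coeff_set A1 UNIV) \<and> e = ucomb p + vcomb r"
    using add(1)
  proof
    assume "e \<in> {Sw m * laurent k p |m p. 1 \<le> m \<and> m \<le> k \<and> p \<in> coeff_set A1 UNIV}"
    then obtain m s where e: "e = Sw m * laurent k s" "1 \<le> m" "m \<le> k" "s \<in> coeff_set A1 UNIV" by blast
    then have "e = ucomb (\<lambda>j. if j = m - 1 then s else 0) + vcomb (\<lambda>j. 0)"
      by (subst ucomb_single) auto
    then show ?thesis using e(4)
      by (intro exI[of _ "\<lambda>j. if j = m - 1 then s else 0"] exI[of _ "\<lambda>j. 0"]) auto
  next
    assume "e \<in> {vterm j (laurent k p) |j p. j < k \<and> p \<in> coeff_set A1 UNIV}"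
    then obtain m s where e: "e = vterm m (laurent k s)" "m < k" "s \<in> coeff_set A1 UNIV" by blast
    then have "e = ucomb (\<lambda>j. 0) + vcomb (\<lambda>j. if j = m then s else 0)"
      by (subst vcomb_single) auto
    then show ?thesis using e(3)
      by (intro exI[of _ "\<lambda>j. 0"] exI[of _ "\<lambda>j. if j = m then s else 0"]) auto
  qed
  then obtain p' r' where p': "\<forall>j. p' j \<in> coeff_set A1 UNIV" "\<forall>j. r' j \<in> coeff_set A1 UNIV"
    "e = ucomb p' + vcomb r'" by blast
  have "e + f \<doteq> (ucomb p' + vcomb r') + (ucomb p + vcomb r)"
    using p p' by (simp add: cong_ideal_add)
  also have "\<dots> = ucomb (\<lambda>j. p' j + p j) + vcomb (\<lambda>j. r' j + r j)"
    by (simp add: ucomb_add vcomb_add algebra_simps)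
  finally show ?case using p p'
    by (intro exI[of _ "\<lambda>j. p' j + p j"] exI[of _ "\<lambda>j. r' j + r j"]) (auto intro!: coeff_set_add)
next
  case (cong f g)
  then show ?case by (meson cong_ideal_sym cong_ideal_trans)
qed

section \<open>The leading term of the differential\<close>

text \<open>Each factor X_1 - c raises the degree in \<open>X_k\<close> by at most one, and the only
  term reaching the new top degree is the one in which X_1 passes all inverses as X_k.\<close>

lemma cyclotomic_Sw:
  "cyclotomic Qs (gX 1) * Sw 1 - Sw 1 * Xpow k (int (length Qs)) \<in> Uspan 1 A0 {..<int (length Qs)}"
proof (induction Qs)
  case Nil
  then show ?case by (simp add: Uspan_0)
next
  case (Cons c Qs)
  define l where "l = int (length Qs)"
  define D where "D = cyclotomic Qs (gX 1) * Sw 1 - Sw 1 * Xpow k l"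
  define D1 where "D1 = gX 1 * Sw 1 - Sw 1 * gX k"
  define L where "L = laurent k (Poly_Mapping.single l (1 :: (hecke_gen, 'k) free_alg))"
  have L: "L = Xpow k l" by (simp add: L_def laurent_single)
  have D: "D \<in> Uspan 1 A0 {..<l}" using Cons by (simp add: D_def l_def)
  have "D1 \<in> Uspan 1 A0 {0}"
    unfolding D1_def by (rule Uspan_mono[OF X_Sw_aux]) (use k_pos in auto)
  then have D1: "D1 * L \<in> Uspan 1 A0 {..<l + 1}"
    unfolding L_def by (rule Uspan_laurent[OF _ affine_gens_dgens coeff_set_single[of l "{l}"]]) auto
  have SL: "Sw 1 * L \<in> Uspan 1 A0 {..<l + 1}"
    unfolding L_def using k_pos by (intro Uspan_incl coeff_set_single) auto
  have D': "D \<in> Uspan 1 A0 {..<l + 1}" by (rule Uspan_mono[OF D]) auto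
  have XD: "gX 1 * D \<in> Uspan 1 A0 {..<l + 1}"
    using D by (rule X1_Uspan) (auto simp: affine_gens_dgens)
  \<comment> \<open>An identity in the free algebra. The first four summands have degree below l +
    1; the last one vanishes modulo the relations.\<close>
  have "cyclotomic (c # Qs) (gX 1) * Sw 1 - Sw 1 * Xpow k (l + 1)
    = gX 1 * D - free_const c * D + D1 * L - free_const c * (Sw 1 * L)
        + Sw 1 * (gX k * Xpow k l - Xpow k (l + 1))"
    by (simp add: D_def D1_def L algebra_simps)
  also have "\<dots> \<doteq> gX 1 * D - free_const c * D + D1 * L - free_const c * (Sw 1 * L) + Sw 1 * 0"
    using cong_ideal_diff[OF Xpow_Suc[of l] cong_ideal_refl, of "Xpow k (l + 1)"]
    by (intro cong_ideal_add rewrite_right cong_ideal_refl) simp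
  finally have "cyclotomic (c # Qs) (gX 1) * Sw 1 - Sw 1 * Xpow k (l + 1) \<in> Uspan 1 A0 {..<l + 1}"
    by (rule Uspan_eq)
      (use XD D' D1 SL affine_gens_dgens in \<open>auto intro!: Uspan_add Uspan_diff Uspan_const\<close>)
  then show ?case by (simp add: l_def add.commute)
qed

lemma Tword_Sw: "j < k \<Longrightarrow> Tword j * Sw 1 \<doteq> Sw (Suc j)"
proof (induction j)
  case (Suc j)
  have "Tword (Suc j) * Sw 1 = gT (Suc j) * (Tword j * Sw 1)" by (simp add: mult.assoc)
  also have "\<dots> \<doteq> gT (Suc j) * Sw (Suc j)" using Suc by (intro rewrite_right) auto
  also have "\<dots> = gT (Suc j) * (S (Suc j) * Sw (Suc (Suc j)))" using Suc by (simp add: Sword_rec)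
  also have "\<dots> \<doteq> Sw (Suc (Suc j))" using Suc by (intro T_cancel) auto
  finally show ?case .
qed (simp add: One_nat_def)

lemma Tword_Uspan:
  assumes "f \<in> Uspan 1 G B" "A0 \<subseteq> G" "G \<subseteq> A1" "j < k"
  shows "Tword j * f \<in> Uspan 1 G B"
  using assms(4)
proof (induction j)
  case (Suc j)
  then show ?case using Uspan_T[of "Tword j * f" 1 G B 1 "Suc j"] assms by (simp add: mult.assoc)
qed (use assms in simp)

text \<open>The left side is what remains of the differential of the j-th element with \<theta> when
  its Laurent coefficient is 1.\<close>

theorem boundary_leading_term:
  assumes "j < k"
  shows "\<exists>w. (\<forall>i. w i \<in> coeff_set A0 {..<int (length Qs)}) \<and>
    Tword j * (cyclotomic Qs (gX 1) * Sw 1)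
      \<doteq> Sw (Suc j) * Xpow k (int (length Qs)) + ucomb w"
proof -
  define l where "l = int (length Qs)"
  define D where "D = cyclotomic Qs (gX 1) * Sw 1 - Sw 1 * Xpow k l"
  have "Tword j * D \<in> Uspan 1 A0 {..<l}"
    using cyclotomic_Sw[of Qs] assms affine_gens_dgens
    unfolding D_def l_def by (intro Tword_Uspan) auto
  then obtain w where w: "\<forall>i. w i \<in> coeff_set A0 {..<l}" "Tword j * D \<doteq> ucomb w"
    using Uspan_ucomb by blast
  have "Tword j * (cyclotomic Qs (gX 1) * Sw 1) = (Tword j * Sw 1) * Xpow k l + Tword j * D"
    by (simp add: D_def algebra_simps)
  also have "\<dots> \<doteq> Sw (Suc j) * Xpow k l + ucomb w"
    by (intro cong_ideal_add rewrite_left Tword_Sw assms w)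
  finally show ?thesis using w by (auto simp: l_def)
qed

end


section \<open>A faithful family of representations\<close>

text \<open>
  A state assigns to each position a label and an occupation number. The labels play the role of
  evaluation points for the \<open>X\<^sub>i\<close>, and a position is occupied if the corresponding
  exterior generator is present, so that functions of states are an evaluated form of
  Laurent polynomials tensored with an exterior algebra. \<open>T\<^sub>i\<close> acts by a Demazure-Lusztig operator.
\<close>

type_synonym 'k state = "nat \<Rightarrow> 'k \<times> bool"

definition swap_at :: "nat \<Rightarrow> 'k state \<Rightarrow> 'k state" where
  "swap_at i z = z(i := z (Suc i), Suc i := z i)"

text \<open>The coefficient of the swapped argument. The complementary coefficient
  \<open>q - demazure_coeff q x y\<close> equals (q - 1) y / (y - x), the divided-difference part of
  the Demazure-Lusztig operator.\<close>

definition demazure_coeff :: "'k::field \<Rightarrow> 'k \<Rightarrow> 'k \<Rightarrow> 'k" where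
  "demazure_coeff q x y = (y - q * x) / (y - x)"

text \<open>Two exterior generators anticommute, hence the sign when both positions are
  occupied.\<close>

definition swap_sign :: "bool \<Rightarrow> bool \<Rightarrow> 'k::field" where
  "swap_sign a b = (if a \<and> b then - 1 else 1)"

text \<open>The generators \<open>T\<^sub>i\<close> that are not available for the given \<open>d\<close> act by zero.\<close>

fun act :: "nat \<Rightarrow> 'k::field \<Rightarrow> hecke_gen \<Rightarrow> ('k state \<Rightarrow> 'k) \<Rightarrow> 'k state \<Rightarrow> 'k" where
  "act d q (GenT i) \<phi> z = (if i \<in> {1..<d} then
     (q - demazure_coeff q (fst (z i)) (fst (z (Suc i)))) * \<phi> z
     + demazure_coeff q (fst (z i)) (fst (z (Suc i)))
       * (swap_sign (snd (z i)) (snd (z (Suc i))) * \<phi> (swap_at i z)) else 0)"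
| "act d q (GenX i) \<phi> z = fst (z i) * \<phi> z"
| "act d q (GenXinv i) \<phi> z = inverse (fst (z i)) * \<phi> z"
| "act d q GenTheta \<phi> z = (if snd (z 1) then \<phi> (z(1 := (fst (z 1), False))) else 0)"

primrec act_word :: "nat \<Rightarrow> 'k::field \<Rightarrow> hecke_gen list \<Rightarrow> ('k state \<Rightarrow> 'k) \<Rightarrow> 'k state \<Rightarrow> 'k" where
  "act_word d q [] \<phi> = \<phi>"
| "act_word d q (g # u) \<phi> = act d q g (act_word d q u \<phi>)"

definition rep :: "nat \<Rightarrow> 'k::field \<Rightarrow> (hecke_gen, 'k) free_alg \<Rightarrow> ('k state \<Rightarrow> 'k) \<Rightarrow> 'k state \<Rightarrow> 'k" where
  "rep d q f \<phi> z = (\<Sum>w\<in>Poly_Mapping.keys f. Poly_Mapping.lookup f w * act_word d q (letters w) \<phi> z)"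

text \<open>Distinct labels keep the denominators nonzero, excluding the ratio q keeps the swap
  coefficients nonzero, and nonzero labels make the inverses of the X_i act correctly.\<close>

definition generic_states :: "nat \<Rightarrow> 'k::field \<Rightarrow> 'k state set" where
  "generic_states d q = {z. \<forall>i\<in>{1..d}. fst (z i) \<noteq> 0 \<and>
     (\<forall>j\<in>{1..d}. i \<noteq> j \<longrightarrow> fst (z i) \<noteq> fst (z j) \<and> fst (z i) \<noteq> q * fst (z j))}"

definition annihilator :: "nat \<Rightarrow> 'k::field \<Rightarrow> (hecke_gen, 'k) free_alg set" where
  "annihilator d q = {f. \<forall>\<phi>. \<forall>z\<in>generic_states d q. rep d q f \<phi> z = 0}"

lemma rep_add: "rep d q (f + g) \<phi> z = rep d q f \<phi> z + rep d q g \<phi> z"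
  unfolding rep_def by (rule setsum_keys_plus_distrib) (simp_all add: algebra_simps)

lemma rep_0 [simp]: "rep d q 0 \<phi> z = 0"
  by (simp add: rep_def)

lemma rep_uminus: "rep d q (- f) \<phi> z = - rep d q f \<phi> z"
  using rep_add[of d q f "- f" \<phi> z] by (simp add: eq_neg_iff_add_eq_0 add.commute)

lemma rep_diff: "rep d q (f - g) \<phi> z = rep d q f \<phi> z - rep d q g \<phi> z"
  using rep_add[of d q f "- g" \<phi> z] by (simp add: rep_uminus)

lemma rep_sum: "rep d q (sum f I) \<phi> z = (\<Sum>i\<in>I. rep d q (f i) \<phi> z)"
  by (induction I rule: infinite_finite_induct) (auto simp: rep_add)

lemma rep_word_term: "rep d q (word_term u c) \<phi> z = c * act_word d q u \<phi> z"
  by (simp add: rep_def)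

lemma rep_gen: "rep d q (free_gen g) = act d q g"
  by (rule ext)+ (simp add: free_gen_def rep_word_term)

lemma rep_const: "rep d q (free_const c) \<phi> z = c * \<phi> z"
  by (simp add: free_const_eq rep_word_term)

lemma rep_1 [simp]: "rep d q 1 \<phi> z = \<phi> z"
  using rep_const[of d q 1] by simp

lemma act_add: "act d q g (\<lambda>z. \<phi> z + \<psi> z) z = act d q g \<phi> z + act d q g \<psi> z"
  by (cases g) (auto simp: algebra_simps)

lemma act_scale: "act d q g (\<lambda>z. c * \<phi> z) z = c * act d q g \<phi> z"
  by (cases g) (auto simp: algebra_simps)

lemma act_word_add: "act_word d q u (\<lambda>z. \<phi> z + \<psi> z) z = act_word d q u \<phi> z + act_word d q u \<psi> z"
proof (induction u arbitrary: z)
  case (Cons g u)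
  then have "act_word d q u (\<lambda>z. \<phi> z + \<psi> z) = (\<lambda>z. act_word d q u \<phi> z + act_word d q u \<psi> z)"
    by (intro ext)
  then show ?case by (simp add: act_add)
qed simp

lemma act_word_scale: "act_word d q u (\<lambda>z. c * \<phi> z) z = c * act_word d q u \<phi> z"
proof (induction u arbitrary: z)
  case (Cons g u)
  then have "act_word d q u (\<lambda>z. c * \<phi> z) = (\<lambda>z. c * act_word d q u \<phi> z)" by (intro ext)
  then show ?case by (simp add: act_scale)
qed simp

lemma act_word_append: "act_word d q (u @ v) \<phi> = act_word d q u (act_word d q v \<phi>)"
  by (induction u) auto

lemma rep_mult: "rep d q (f * g) \<phi> = rep d q f (rep d q g \<phi>)"
proof
  fix z
  show "rep d q (f * g) \<phi> z = rep d q f (rep d q g \<phi>) z"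
  proof (induction f rule: free_alg_induct)
    case (word c u)
    show ?case
    proof (induction g rule: free_alg_induct)
      case (word e v)
      have "rep d q (word_term v e) \<phi> = (\<lambda>z. e * act_word d q v \<phi> z)"
        by (rule ext) (simp add: rep_word_term)
      then show ?case by (simp add: word_term_mult rep_word_term act_word_append act_word_scale)
    next
      case (add f g)
      have "rep d q (f + g) \<phi> = (\<lambda>z. rep d q f \<phi> z + rep d q g \<phi> z)"
        by (rule ext) (simp add: rep_add)
      then show ?case using add by (simp add: algebra_simps rep_add rep_word_term act_word_add)
    qed
  qed (simp add: algebra_simps rep_add)
qed

text \<open>Generic states are stable under swaps and under changes of the occupation at position 1,
  so a function vanishing on them keeps doing so. Restriction to generic states is therefore
  compatible with composition.\<close>

lemma rep_vanish:
  assumes "\<And>z. z \<in> generic_states d q \<Longrightarrow> \<phi> z = 0" "z \<in> generic_states d q"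
  shows "rep d q f \<phi> z = 0"
proof (induction f rule: free_alg_induct)
  case (word c u)
  have "act_word d q u \<phi> z = 0" using assms(2)
  proof (induction u arbitrary: z)
    case (Cons g u)
    have "swap_at i z \<in> generic_states d q" if "i \<in> {1..<d}" for i
      using Cons.prems that by (auto simp: generic_states_def swap_at_def)
    moreover have "z(1 := (fst (z 1), False)) \<in> generic_states d q"
      using Cons.prems by (auto simp: generic_states_def)
    ultimately show ?case using Cons by (cases g) auto
  qed (use assms in simp)
  then show ?case by (simp add: rep_word_term)
qed (simp add: rep_add)

lemma swap_at_generic: "z \<in> generic_states d q \<Longrightarrow> i \<in> {1..<d} \<Longrightarrow> swap_at i z \<in> generic_states d q"
  by (auto simp: generic_states_def swap_at_def)

lemma occupy_generic: "z \<in> generic_states d q \<Longrightarrow> z(1 := (fst (z 1), b)) \<in> generic_states d q"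
  by (auto simp: generic_states_def)

lemma generic_neq:
  assumes "z \<in> generic_states d q" "i \<in> {1..d}" "j \<in> {1..d}" "i \<noteq> j"
  shows "fst (z i) \<noteq> fst (z j)" "fst (z i) \<noteq> q * fst (z j)"
  using assms by (auto simp: generic_states_def)

section \<open>The defining relations for the Demazure-Lusztig operators\<close>

lemma demazure_quadratic: "x \<noteq> y \<Longrightarrow> demazure_coeff q x y + demazure_coeff q y x = q + 1"
  by (simp add: demazure_coeff_def divide_simps) (simp add: algebra_simps)

lemma swap_sign_square [simp]: "swap_sign a b * swap_sign a b = 1"
  "swap_sign a b * (swap_sign a b * c) = c"
  by (simp_all add: swap_sign_def)

lemma swap_sign_commute: "swap_sign a b = swap_sign b a"
  by (auto simp: swap_sign_def)

lemma swap_at_simps [simp]: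
  "swap_at i z i = z (Suc i)" "swap_at i z (Suc i) = z i"
  "j \<noteq> i \<Longrightarrow> j \<noteq> Suc i \<Longrightarrow> swap_at i z j = z j"
  "swap_at i (swap_at i z) = z"
  by (auto simp: swap_at_def)

lemma rep_T_quadratic:
  assumes "z \<in> generic_states d q" "i \<in> {1..<d}"
  shows "rep d q ((gT i - free_const q) * (gT i + 1)) \<phi> z = 0"
proof -
  define a where "a = demazure_coeff q (fst (z i)) (fst (z (Suc i)))"
  define a' where "a' = demazure_coeff q (fst (z (Suc i))) (fst (z i))"
  define s :: 'a where "s = swap_sign (snd (z i)) (snd (z (Suc i)))"
  have "a + a' = q + 1" unfolding a_def a'_def
    by (rule demazure_quadratic) (use generic_neq[OF assms(1), of i "Suc i"] assms(2) in auto)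
  then have a': "a' = q + 1 - a" by (simp add: algebra_simps)
  have ss: "s * s = 1" "swap_sign (snd (z (Suc i))) (snd (z i)) = s"
    by (simp_all add: s_def swap_sign_commute)
  have "rep d q ((gT i - free_const q) * (gT i + 1)) \<phi> z =
     - a * (((q - a) * \<phi> z + a * (s * \<phi> (swap_at i z))) + \<phi> z)
     + a * (s * (((q - a') * \<phi> (swap_at i z) + a' * (s * \<phi> z)) + \<phi> (swap_at i z)))"
    using assms(2) ss
    by (simp add: rep_mult rep_diff rep_gen rep_const rep_add flip: a_def a'_def s_def)
       (simp add: algebra_simps)
  also have "\<dots> = a * (q + 1 - a) * (s * s - 1) * \<phi> z"
    unfolding a' by (simp add: algebra_simps)
  finally show ?thesis using ss(1) by simp
qed

text \<open>Expanding the braid relation over the six permutations of three labels leaves three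
  nontrivial comparisons: the identity and the two simple swaps. These are the required
  identities.\<close>

lemma demazure_braid:
  fixes q :: "'k::field"
  assumes "x \<noteq> y" "x \<noteq> w" "y \<noteq> w"
  defines "A \<equiv> demazure_coeff q" and "B \<equiv> \<lambda>x y. q - demazure_coeff q x y"
  shows "B x y * B x y * B y w + A x y * A y x * B x w = B y w * B y w * B x y + A y w * A w y * B x w"
    "B x y * B y w + B y x * B x w = B y w * B x w"
    "B x y * B x w = B y w * B x y + B x w * B w y"
proof -
  have nz: "y - x \<noteq> 0" "w - x \<noteq> 0" "w - y \<noteq> 0" "x - y \<noteq> 0" "y - w \<noteq> 0" using assms by auto
  have B: "B u v = (q - 1) * v / (v - u)" if "v - u \<noteq> 0" for u v
    using that by (simp add: B_def demazure_coeff_def field_simps)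
  show h2: "B x y * B y w + B y x * B x w = B y w * B x w"
    and "B x y * B x w = B y w * B x y + B x w * B w y"
    using nz by (simp_all add: B divide_simps) (simp_all add: algebra_simps)
  have A: "A y x = q + 1 - A x y" "A w y = q + 1 - A y w"
    using demazure_quadratic[of x y q] demazure_quadratic[of y w q] assms(1,3)
    by (simp_all add: A_def algebra_simps)
  show "B x y * B x y * B y w + A x y * A y x * B x w = B y w * B y w * B x y + A y w * A w y * B x w"
  proof -
    define a c e where "a = A x y" and "c = A y w" and "e = A x w"
    have h: "(q - a) * (q - c) + (a - 1) * (q - e) - (q - c) * (q - e) = 0"
      using h2 A unfolding B_def A_def[symmetric] a_def c_def e_def by (simp add: algebra_simps)
    \<comment> \<open>The first identity follows from the second one: the two sides differ by c - a
      times the expression in \<open>h\<close>.\<close>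
    have "(q - a) * (q - a) * (q - c) + a * (q + 1 - a) * (q - e)
        - ((q - c) * (q - c) * (q - a) + c * (q + 1 - c) * (q - e))
      = (c - a) * ((q - a) * (q - c) + (a - 1) * (q - e) - (q - c) * (q - e))"
      by (simp add: algebra_simps)
    also have "\<dots> = 0" by (simp add: h)
    finally show ?thesis
      unfolding A B_def A_def[symmetric] a_def c_def e_def by (simp only: right_minus_eq)
  qed
qed

text \<open>The values of the function at the six permuted states are kept as independent unknowns
  and their coefficients are compared.\<close>

lemma rep_braid:
  fixes q :: "'k::field"
  assumes z: "z \<in> generic_states d q" and i: "1 \<le> i" "i + 1 < d"
  shows "rep d q (gT i * gT (i + 1) * gT i) \<phi> z = rep d q (gT (i + 1) * gT i * gT (i + 1)) \<phi> z"
proof -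
  let ?A = "demazure_coeff q" and ?B = "\<lambda>x y. q - demazure_coeff q x y"
  define s12 :: 'k where "s12 = swap_sign (snd (z i)) (snd (z (Suc i)))"
  define s13 :: 'k where "s13 = swap_sign (snd (z i)) (snd (z (Suc (Suc i))))"
  define s23 :: 'k where "s23 = swap_sign (snd (z (Suc i))) (snd (z (Suc (Suc i))))"
  have s: "swap_sign (snd (z (Suc i))) (snd (z i)) = s12"
    "swap_sign (snd (z (Suc (Suc i)))) (snd (z i)) = s13"
    "swap_sign (snd (z (Suc (Suc i)))) (snd (z (Suc i))) = s23"
    "s12 * s12 = 1" "s13 * s13 = 1" "s23 * s23 = 1"
    by (simp_all add: s12_def s13_def s23_def swap_sign_commute)
  have s': "s12 * (s12 * c) = c" "s23 * (s23 * c) = c" for c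
    by (simp_all add: s12_def s23_def)
  define x where "x = fst (z i)"
  define y where "y = fst (z (Suc i))"
  define w where "w = fst (z (Suc (Suc i)))"
  have neq: "x \<noteq> y" "x \<noteq> w" "y \<noteq> w" unfolding x_def y_def w_def
    by (rule generic_neq[OF z]; use i in simp)+
  have i': "1 \<le> i" "i < d" "Suc i < d" using i by auto
  have perm: "swap_at (Suc i) (swap_at i (swap_at (Suc i) z)) = swap_at i (swap_at (Suc i) (swap_at i z))"
    by (rule ext) (auto simp: swap_at_def)
  define f1 where "f1 = \<phi> z"
  define f2 where "f2 = \<phi> (swap_at i z)"
  define f3 where "f3 = \<phi> (swap_at (Suc i) z)"
  define f4 where "f4 = \<phi> (swap_at (Suc i) (swap_at i z))"
  define f5 where "f5 = \<phi> (swap_at i (swap_at (Suc i) z))"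
  define f6 where "f6 = \<phi> (swap_at i (swap_at (Suc i) (swap_at i z)))"
  define axy ayx axw awx ayw awy where "axy = ?A x y" and "ayx = ?A y x" and "axw = ?A x w"
    and "awx = ?A w x" and "ayw = ?A y w" and "awy = ?A w y"
  note defs = f1_def f2_def f3_def f4_def f5_def f6_def axy_def ayx_def axw_def awx_def ayw_def awy_def
    x_def y_def w_def s12_def s13_def s23_def
  have L: "rep d q (gT i * gT (i + 1) * gT i) \<phi> z =
     (q - axy) * ((q - ayw) * ((q - axy) * f1 + axy * (s12 * f2))
        + ayw * (s23 * ((q - axw) * f3 + axw * (s13 * f5))))
     + axy * (s12 * ((q - axw) * ((q - ayx) * f2 + ayx * (s12 * f1))
        + axw * (s13 * ((q - ayw) * f4 + ayw * (s23 * f6)))))"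
    using i' s(1-3) by (simp add: rep_mult rep_gen flip: defs)
  have R: "rep d q (gT (i + 1) * gT i * gT (i + 1)) \<phi> z =
     (q - ayw) * ((q - axy) * ((q - ayw) * f1 + ayw * (s23 * f3))
        + axy * (s12 * ((q - axw) * f2 + axw * (s13 * f4))))
     + ayw * (s23 * ((q - axw) * ((q - awy) * f3 + awy * (s23 * f1))
        + axw * (s13 * ((q - axy) * f5 + axy * (s12 * f6)))))"
    using i' s(1-3) perm by (simp add: rep_mult rep_gen flip: defs)
  have h1: "(q - axy) * (q - axy) * (q - ayw) + axy * ayx * (q - axw)
      = (q - ayw) * (q - ayw) * (q - axy) + ayw * awy * (q - axw)"
    and h2: "(q - axy) * (q - ayw) + (q - ayx) * (q - axw) = (q - ayw) * (q - axw)"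
    and h3: "(q - axy) * (q - axw) = (q - ayw) * (q - axy) + (q - axw) * (q - awy)"
    using demazure_braid[OF neq, of q] unfolding axy_def ayx_def axw_def awx_def ayw_def awy_def
    by blast+
  \<comment> \<open>Squares of signs cancel. The coefficients of \<open>f4\<close>,
    \<open>f5\<close> and \<open>f6\<close> then agree on both sides as they stand.\<close>
  have L': "rep d q (gT i * gT (i + 1) * gT i) \<phi> z =
     ((q - axy) * (q - axy) * (q - ayw) + axy * ayx * (q - axw)) * f1
     + axy * s12 * ((q - axy) * (q - ayw) + (q - ayx) * (q - axw)) * f2
     + ayw * s23 * ((q - axy) * (q - axw)) * f3
     + axy * axw * s12 * s13 * (q - ayw) * f4 + ayw * axw * s23 * s13 * (q - axy) * f5
     + axy * axw * ayw * s12 * s13 * s23 * f6"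
    unfolding L by (simp add: algebra_simps s' s(4))
  have R': "rep d q (gT (i + 1) * gT i * gT (i + 1)) \<phi> z =
     ((q - ayw) * (q - ayw) * (q - axy) + ayw * awy * (q - axw)) * f1
     + axy * s12 * ((q - ayw) * (q - axw)) * f2
     + ayw * s23 * ((q - ayw) * (q - axy) + (q - axw) * (q - awy)) * f3
     + axy * axw * s12 * s13 * (q - ayw) * f4 + ayw * axw * s23 * s13 * (q - axy) * f5
     + axy * axw * ayw * s12 * s13 * s23 * f6"
    unfolding R by (simp add: algebra_simps s' s(6))
  show ?thesis unfolding L' R' h1 h2 h3 ..
qed

text \<open>The coefficient of the swapped value cancels, and the coefficient of the value at z
  itself is q times the label at position i + 1.\<close>

lemma rep_T_X_T:
  fixes q :: "'k::field"
  assumes z: "z \<in> generic_states d q" and i: "i \<in> {1..<d}"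
  shows "rep d q (gT i * gX i * gT i) \<phi> z = rep d q (free_const q * gX (i + 1)) \<phi> z"
proof -
  define s :: 'k where "s = swap_sign (snd (z i)) (snd (z (Suc i)))"
  have s: "swap_sign (snd (z (Suc i))) (snd (z i)) = s" "s * s = 1"
    by (simp_all add: s_def swap_sign_commute)
  have s': "s * (s * c) = c" for c by (simp add: s_def)
  define x where "x = fst (z i)"
  define y where "y = fst (z (Suc i))"
  have neq: "x \<noteq> y" unfolding x_def y_def by (rule generic_neq[OF z]) (use i in auto)
  have i': "1 \<le> i" "i < d" using i by auto
  define a where "a = demazure_coeff q x y"
  define a' where "a' = demazure_coeff q y x"
  define f1 where "f1 = \<phi> z"
  define f2 where "f2 = \<phi> (swap_at i z)"
  note defs = f1_def f2_def a_def a'_def x_def y_def s_def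
  have eq: "rep d q (gT i * gX i * gT i) \<phi> z
      = (q - a) * (x * ((q - a) * f1 + a * (s * f2))) + a * (s * (y * ((q - a') * f2 + a' * (s * f1))))"
    using i' s(1) by (simp add: rep_mult rep_gen flip: defs)
  have "(q - a) * x * (q - a) + a * y * a' = q * y" "(q - a) * x + y * (q - a') = 0"
    using neq by (simp_all add: a_def a'_def demazure_coeff_def divide_simps) (simp_all add: algebra_simps)
  then have "(q - a) * (x * ((q - a) * f1 + a * (s * f2))) + a * (s * (y * ((q - a') * f2 + a' * (s * f1))))
      = q * y * f1"
  proof -
    assume h: "(q - a) * x * (q - a) + a * y * a' = q * y" "(q - a) * x + y * (q - a') = 0"
    have "(q - a) * (x * ((q - a) * f1 + a * (s * f2))) + a * (s * (y * ((q - a') * f2 + a' * (s * f1))))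
        = ((q - a) * x * (q - a) + a * y * a') * f1 + a * s * f2 * ((q - a) * x + y * (q - a'))"
      by (simp add: algebra_simps s' s(2))
    then show ?thesis unfolding h by simp
  qed
  then show ?thesis using eq by (simp add: rep_mult rep_gen rep_const y_def f1_def)
qed

text \<open>Only positions 1 and 2 are involved; after \<open>quad\<close> eliminates the reversed
  coefficient, each of the four occupation patterns is a polynomial identity.\<close>

lemma rep_theta_T_theta:
  fixes q :: "'k::field"
  assumes z: "z \<in> generic_states d q" and d: "d > 1"
  shows "rep d q (gT 1 * gTheta * gT 1 * gTheta + gTheta * gT 1 * gTheta * gT 1
              - free_const (q - 1) * gTheta * gT 1 * gTheta) \<phi> z = 0"
proof -
  define x where "x = fst (z 1)"
  define y where "y = fst (z 2)"
  have neq: "x \<noteq> y" unfolding x_def y_def by (rule generic_neq[OF z]) (use d in auto)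
  obtain a b where zz: "z 1 = (x, a)" "z 2 = (y, b)" by (simp add: x_def y_def prod_eq_iff)
  have d': "Suc 0 < d" using d by simp
  have quad: "demazure_coeff q y x = q + 1 - demazure_coeff q x y"
    using demazure_quadratic[OF neq, of q] by (simp add: algebra_simps)
  have swap: "swap_at (Suc 0) u = u(1 := u 2, 2 := u 1)" for u :: "'k state"
    by (simp add: swap_at_def eval_nat_numeral)
  show ?thesis
    using d' zz
    by (cases a; cases b) (simp_all add: rep_mult rep_gen rep_const rep_add rep_diff swap
        swap_sign_def eval_nat_numeral fun_upd_twist[of "Suc 0" "Suc (Suc 0)"] quad algebra_simps)
qed

lemma relators_annihilate:
  fixes q :: "'k::field"
  assumes "r \<in> dg_relators d q" and z: "z \<in> generic_states d q"
  shows "rep d q r \<phi> z = 0"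
proof -
  have nz: "fst (z r) \<noteq> 0" if "r \<in> {1..d}" for r using z that by (auto simp: generic_states_def)
  have *: "rep d q r \<phi> z = 0" if "r \<in> affine_relators d q"
    using that unfolding affine_relators_def
  proof (elim UnE CollectE exE conjE)
    fix r' assume "r = gX r' * gXinv r' - 1" "r' \<in> {1..d}"
    then show ?thesis using nz[of r'] by (simp add: rep_mult rep_gen rep_diff)
  next
    fix r' assume "r = gXinv r' * gX r' - 1" "r' \<in> {1..d}"
    then show ?thesis using nz[of r'] by (simp add: rep_mult rep_gen rep_diff)
  next
    fix x y i j
    assume "r = x * y - y * x" "x \<in> {gX i, gXinv i}" "y \<in> {gX j, gXinv j}"
    then show ?thesis by (auto simp: rep_mult rep_gen rep_diff)
  next
    fix i assume "r = (gT i - free_const q) * (gT i + 1)" "i \<in> {1..<d}"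
    then show ?thesis using rep_T_quadratic[OF z] by simp
  next
    fix i j assume r: "r = gT i * gT j - gT j * gT i" "i \<in> {1..<d}" "j \<in> {1..<d}" "1 < \<bar>int i - int j\<bar>"
    then have "Suc i < j \<or> Suc j < i" by auto
    then have "swap_at j (swap_at i z) = swap_at i (swap_at j z)" "i \<noteq> j" "Suc i \<noteq> j" "Suc j \<noteq> i"
      by (auto simp: swap_at_def)
    then show ?thesis unfolding r(1) using r(2,3)
      by (simp add: rep_mult rep_gen rep_diff) (simp add: algebra_simps)
  next
    fix i assume "r = gT i * gT (i + 1) * gT i - gT (i + 1) * gT i * gT (i + 1)" "i \<in> {1..<d}" "i + 1 \<in> {1..<d}"
    then show ?thesis using rep_braid[OF z, of i] by (simp add: rep_diff)
  next
    fix i j assume r: "r = gT i * gX j - gX j * gT i" "i \<in> {1..<d}" "int j - int i \<notin> {0, 1}"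
    then have "j \<noteq> i" "j \<noteq> Suc i" by auto
    then show ?thesis unfolding r(1) using r(2)
      by (simp add: rep_mult rep_gen rep_diff) (simp add: algebra_simps)
  next
    fix i assume "r = gT i * gX i * gT i - free_const q * gX (i + 1)" "i \<in> {1..<d}"
    then show ?thesis using rep_T_X_T[OF z] by (simp add: rep_diff)
  qed
  show ?thesis using assms(1) unfolding dg_relators_def
  proof (elim UnE CollectE exE conjE)
    assume "r \<in> {gTheta * gTheta}"
    then show ?thesis by (simp add: rep_mult rep_gen)
  next
    fix r' assume r: "r = gX r' * gTheta - gTheta * gX r'"
    show ?thesis unfolding r by (cases "r' = 1") (simp_all add: rep_mult rep_gen rep_diff)
  next
    fix r' assume r: "r = gXinv r' * gTheta - gTheta * gXinv r'"
    show ?thesis unfolding r by (cases "r' = 1") (simp_all add: rep_mult rep_gen rep_diff)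
  next
    fix i assume r: "r = gT i * gTheta - gTheta * gT i" "i \<in> {1..<d}" "1 < i"
    have "swap_at i (z(Suc 0 := (fst (z (Suc 0)), False))) = (swap_at i z)(Suc 0 := (fst (z (Suc 0)), False))"
      using r by (auto simp: swap_at_def)
    then show ?thesis unfolding r(1) using r(2,3) by (simp add: rep_mult rep_gen rep_diff)
  next
    assume "r \<in> (if d > 1
      then {gT 1 * gTheta * gT 1 * gTheta + gTheta * gT 1 * gTheta * gT 1
              - free_const (q - 1) * gTheta * gT 1 * gTheta}
      else {})"
    then show ?thesis using rep_theta_T_theta[OF z] by (auto split: if_splits)
  qed (rule *)
qed

lemma ideal_annihilates:
  "ideal_hull (dg_relators d q) \<subseteq> annihilator d q"
proof
  fix f assume "f \<in> ideal_hull (dg_relators d q)"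
  then show "f \<in> annihilator d q"
  proof induction
    case (add r f u v)
    have "rep d q (u * r * v) \<phi> z = 0" if "z \<in> generic_states d q" for \<phi> z
      unfolding mult.assoc rep_mult[of d q u] rep_mult[of d q r]
      by (rule rep_vanish[OF relators_annihilate[OF add(1)] that])
    then show ?case using add by (simp add: annihilator_def rep_add)
  qed (simp add: annihilator_def)
qed


section \<open>Linear independence\<close>

definition test_linear :: "(('k state \<Rightarrow> 'k::field) \<Rightarrow> 'k state \<Rightarrow> 'k) \<Rightarrow> bool" where
  "test_linear M \<longleftrightarrow> (\<forall>c \<phi> \<psi>. M (\<lambda>z. c * \<phi> z + \<psi> z) = (\<lambda>z. c * M \<phi> z + M \<psi> z))"

lemma rep_commutes:
  assumes M: "test_linear M" and f: "f \<in> free_span G"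
    and G: "\<And>g \<phi>. g \<in> G \<Longrightarrow> act d q g (M \<phi>) = M (act d q g \<phi>)"
  shows "rep d q f (M \<phi>) = M (rep d q f \<phi>)"
  using f
proof (induction f rule: free_span_induct)
  case (word c u)
  \<comment> \<open>Linearity with scalar -1 on zero functions yields M 0 = 0, which is then used to
    drop the second summand.\<close>
  have M_scale: "M (\<lambda>z. c * \<psi> z) = (\<lambda>z. c * M \<psi> z)" for \<psi>
    using M[unfolded test_linear_def, rule_format, of "- 1" "\<lambda>z. 0" "\<lambda>z. 0"]
      M[unfolded test_linear_def, rule_format, of c \<psi> "\<lambda>z. 0"]
    by (auto simp: fun_eq_iff)
  have u: "act_word d q u (M \<phi>) = M (act_word d q u \<phi>)"
    using word by (induction u) (auto simp: G)
  have "rep d q (word_term u c) \<psi> = (\<lambda>z. c * act_word d q u \<psi> z)" for \<psi>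
    by (rule ext) (rule rep_word_term)
  then show ?case by (simp only: u M_scale)
next
  case (add f g)
  have "rep d q (f + g) \<psi> = (\<lambda>z. 1 * rep d q f \<psi> z + rep d q g \<psi> z)" for \<psi>
    by (rule ext) (simp add: rep_add)
  then show ?case using M[unfolded test_linear_def, rule_format, of 1] add by (simp only:)
qed

text \<open>The algebra for k - 1 never looks at position k, and \<open>X_k\<close> acts there by a
  scalar without changing the state.\<close>

lemma rep_scale_position:
  assumes "f \<in> free_span G" "G \<subseteq> insert (GenX k) (insert (GenXinv k) (dgens (k - 1)))" "k \<ge> 1"
  shows "rep d q f (\<lambda>z. \<chi> (z k) * \<phi> z) = (\<lambda>z. \<chi> (z k) * rep d q f \<phi> z)"
proof (rule rep_commutes[OF _ assms(1), where M = "\<lambda>\<phi> z. \<chi> (z k) * \<phi> z"])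
  fix g and \<phi> :: "'a state \<Rightarrow> 'a" assume "g \<in> G"
  then consider "g = GenX k" | "g = GenXinv k" | "g \<in> dgens (k - 1)" using assms by auto
  then show "act d q g (\<lambda>z. \<chi> (z k) * \<phi> z) = (\<lambda>z. \<chi> (z k) * act d q g \<phi> z)"
  proof cases
    case 3
    then show ?thesis
      by (cases rule: dgens_cases) (auto intro!: ext simp: algebra_simps)
  qed (auto intro!: ext)
qed (auto simp: test_linear_def algebra_simps)

text \<open>Here the content of position k is overwritten, so \<open>X_k\<close> and its inverse
  have to be excluded.\<close>

lemma rep_update_position:
  assumes "f \<in> free_span (dgens (k - 1))" "k \<ge> 1"
  shows "rep d q f (\<lambda>z. \<phi> (z(k := p))) = (\<lambda>z. rep d q f \<phi> (z(k := p)))"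
proof (rule rep_commutes[OF _ assms(1), where M = "\<lambda>\<phi> z. \<phi> (z(k := p))"])
  fix g and \<phi> :: "'a state \<Rightarrow> 'a" assume "g \<in> dgens (k - 1)"
  then show "act d q g (\<lambda>z. \<phi> (z(k := p))) = (\<lambda>z. act d q g \<phi> (z(k := p)))"
  proof (cases rule: dgens_cases)
    case (T i)
    then have "(swap_at i z)(k := p) = swap_at i (z(k := p))" for z :: "'a state"
      by (auto simp: swap_at_def)
    then show ?thesis using T by (auto intro!: ext)
  next
    case theta
    then have "k \<noteq> 1" by auto
    then have "z(1 := b, k := p) = z(k := p, 1 := b)" for z :: "'a state" and b
      by (rule fun_upd_twist[symmetric])
    then show ?thesis using theta \<open>k \<noteq> 1\<close> by (auto intro!: ext)
  qed (auto intro!: ext)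
qed (auto simp: test_linear_def)

text \<open>
  For independence, evaluate at functions supported on states in which a fixed label \<open>b\<close> sits in
  prescribed positions with prescribed occupation. Each basis element moves the label in a
  triangular way, and its position tells the basis elements apart.
\<close>

definition label_support :: "nat \<Rightarrow> 'k::field \<Rightarrow> 'k \<Rightarrow> (nat \<times> bool) set \<Rightarrow> ('k state \<Rightarrow> 'k) \<Rightarrow> bool" where
  "label_support d q b Q \<phi> \<longleftrightarrow>
     (\<forall>z\<in>generic_states d q. \<phi> z \<noteq> 0 \<longrightarrow> (\<exists>(i, o')\<in>Q. z i = (b, o')))"

text \<open>In a generic state the label b sits in at most one of the positions 1, ..., d; if its
  actual place and occupation are not in \<open>Q\<close>, no member of \<open>Q\<close> can be
  realized.\<close>

lemma label_support_zero:
  assumes "label_support d q b Q \<phi>" "z \<in> generic_states d q" "z m = (b, o')" "m \<in> {1..d}"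
    and "(m, o') \<notin> Q" "\<And>i a. (i, a) \<in> Q \<Longrightarrow> i \<in> {1..d}"
  shows "\<phi> z = 0"
proof (rule ccontr)
  assume "\<phi> z \<noteq> 0"
  then obtain i a where i: "(i, a) \<in> Q" "z i = (b, a)"
    using assms(1,2) by (auto simp: label_support_def)
  then have "i = m" using generic_neq(1)[OF assms(2), of i m] assms by force
  then show False using i assms by auto
qed

lemma label_support_mono: "label_support d q b Q \<phi> \<Longrightarrow> Q \<subseteq> Q' \<Longrightarrow> label_support d q b Q' \<phi>"
  unfolding label_support_def by blast

lemma label_support_T:
  assumes "label_support d q b Q \<phi>" "Q \<subseteq> Q'" "i \<in> {1..<d}"
    and Q: "\<And>a. (i, a) \<in> Q \<Longrightarrow> (Suc i, a) \<in> Q'" "\<And>a. (Suc i, a) \<in> Q \<Longrightarrow> (i, a) \<in> Q'"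
  shows "label_support d q b Q' (act d q (GenT i) \<phi>)"
  unfolding label_support_def
proof (intro ballI impI)
  fix z assume z: "z \<in> generic_states d q" "act d q (GenT i) \<phi> z \<noteq> 0"
  then have "\<phi> z \<noteq> 0 \<or> \<phi> (swap_at i z) \<noteq> 0" by (auto split: if_splits)
  then show "\<exists>(l, a)\<in>Q'. z l = (b, a)"
  proof
    assume "\<phi> z \<noteq> 0"
    then show ?thesis using assms(1,2) z unfolding label_support_def by blast
  next
    assume "\<phi> (swap_at i z) \<noteq> 0"
    then obtain l a where l: "(l, a) \<in> Q" "swap_at i z l = (b, a)"
      using assms(1) swap_at_generic[OF z(1) assms(3)] by (auto simp: label_support_def)
    consider "l = i" | "l = Suc i" | "l \<noteq> i" "l \<noteq> Suc i" by blast
    then show ?thesis using l Q assms(2) by cases auto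
  qed
qed

lemma label_support_lin:
  assumes "label_support d q b Q \<phi>" "label_support d q b Q \<psi>"
  shows "label_support d q b Q (\<lambda>z. c * (\<phi> z - e * \<psi> z))"
  using assms unfolding label_support_def by (metis diff_self mult_zero_right)

section \<open>Supports and leading coefficients of the basis elements\<close>

lemma rep_gS:
  "rep d q (gS q i) \<phi> = (\<lambda>z. 1 / q * (act d q (GenT i) \<phi> z - (q - 1) * \<phi> z))"
  by (rule ext) (simp add: gS_def rep_mult rep_const rep_diff rep_gen)

lemma label_support_Sword:
  assumes "1 \<le> m" "m \<le> k" "k \<le> d" "label_support d q b {(k, False)} \<psi>"
  shows "label_support d q b ({m..k} \<times> {False}) (rep d q (Sword q m k) \<psi>)"
  using assms(1,2)
proof (induction "k - m" arbitrary: m)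
  case 0
  then have "m = k" by simp
  moreover have "rep d q 1 \<psi> = \<psi>" by (rule ext) simp
  ultimately show ?case using assms(4) by (auto intro: label_support_mono)
next
  case (Suc n)
  then have m: "m < k" "m \<in> {1..<d}" using assms by auto
  let ?g = "rep d q (Sword q (Suc m) k) \<psi>"
  have IH: "label_support d q b ({Suc m..k} \<times> {False}) ?g" using Suc by auto
  have "label_support d q b ({m..k} \<times> {False}) (act d q (GenT m) ?g)"
    by (rule label_support_T[OF IH]) (use m in auto)
  moreover have "label_support d q b ({m..k} \<times> {False}) ?g"
    by (rule label_support_mono[OF IH]) auto
  ultimately show ?case
    unfolding Sword_rec[OF m(1)] rep_mult rep_gS by (rule label_support_lin)
qed

lemma demazure_coeff_nz:
  assumes "z \<in> generic_states d q" "i \<in> {1..<d}"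
  shows "demazure_coeff q (fst (z i)) (fst (z (Suc i))) \<noteq> 0"
  using generic_neq[OF assms(1), of "Suc i" i] assms(2) by (auto simp: demazure_coeff_def)

lemma swap_sign_nz: "swap_sign a b \<noteq> (0 :: 'k::field)"
  by (simp add: swap_sign_def)

text \<open>The label b is carried from position k down to m by successive swaps. At the state x
  reached in this way exactly one path contributes, with a nonzero coefficient; x and the
  coefficient do not depend on the function tested.\<close>

lemma Sword_leading:
  assumes "1 \<le> m" "m \<le> k" "k \<le> d" "y \<in> generic_states d q" "y k = (b, False)" "q \<noteq> 0"
  shows "\<exists>x\<in>generic_states d q. x m = (b, False) \<and> (\<exists>\<kappa>. \<kappa> \<noteq> 0 \<and>
     (\<forall>\<psi>. label_support d q b {(k, False)} \<psi> \<longrightarrow> rep d q (Sword q m k) \<psi> x = \<kappa> * \<psi> y))"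
  using assms(1,2)
proof (induction "k - m" arbitrary: m)
  case 0
  then have "m = k" by simp
  then show ?case using assms(4,5) by (intro bexI[of _ y]) (auto intro!: exI[of _ 1])
next
  case (Suc n)
  then have m: "m < k" "m \<in> {1..<d}" using assms by auto
  have m': "n = k - Suc m" "1 \<le> Suc m" "Suc m \<le> k" using Suc m by auto
  obtain x' \<kappa> where x': "x' \<in> generic_states d q" "x' (Suc m) = (b, False)" "\<kappa> \<noteq> 0"
    and k: "\<And>\<psi>. label_support d q b {(k, False)} \<psi> \<Longrightarrow>
      rep d q (Sword q (Suc m) k) \<psi> x' = \<kappa> * \<psi> y"
    using Suc(1)[OF m'] by auto
  define x where "x = swap_at m x'"
  have x: "x \<in> generic_states d q" "x m = (b, False)" "swap_at m x = x'"
    using swap_at_generic[OF x'(1) m(2)] x' by (auto simp: x_def)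
  define \<kappa>' where "\<kappa>' = 1 / q * (demazure_coeff q (fst (x m)) (fst (x (Suc m)))
    * swap_sign (snd (x m)) (snd (x (Suc m))))"
  have "\<kappa>' \<noteq> 0" using demazure_coeff_nz[OF x(1) m(2)] swap_sign_nz assms(6) by (auto simp: \<kappa>'_def)
  moreover have "rep d q (Sword q m k) \<psi> x = \<kappa>' * \<kappa> * \<psi> y"
    if psi: "label_support d q b {(k, False)} \<psi>" for \<psi>
  proof -
    \<comment> \<open>In x the label sits at m, below the support of the shorter product, so only
      the swap term of S_m survives.\<close>
    have "rep d q (Sword q (Suc m) k) \<psi> x = 0"
      by (rule label_support_zero[OF label_support_Sword[OF _ _ assms(3) psi, of "Suc m"] x(1,2)])
        (use m assms in auto)
    then show ?thesis
      using m k[OF psi] x(3) by (simp add: Sword_rec[OF m(1)] rep_mult rep_gS \<kappa>'_def)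
  qed
  ultimately show ?case using x x' by (intro bexI[of _ x]) (auto intro!: exI[of _ "\<kappa>' * \<kappa>"])
qed

text \<open>After \<theta> the label is either at position 1 and occupied, or elsewhere and
  unoccupied. Applying T_j ... T_1 carries the occupied label no further than position j + 1, which
  is what distinguishes the index j.\<close>

abbreviation vsupport :: "nat \<Rightarrow> nat \<Rightarrow> (nat \<times> bool) set" where
  "vsupport k j \<equiv> {1..k} \<times> {False} \<union> {1..Suc j} \<times> {True}"

lemma label_support_theta:
  assumes "label_support d q b ({1..k} \<times> {False}) \<psi>"
  shows "label_support d q b (vsupport k 0) (act d q GenTheta \<psi>)"
  unfolding label_support_def
proof (intro ballI impI)
  fix z assume z: "z \<in> generic_states d q" "act d q GenTheta \<psi> z \<noteq> 0"
  then have 1: "snd (z 1)" "\<psi> (z(1 := (fst (z 1), False))) \<noteq> 0" by (auto split: if_splits)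
  then obtain i where i: "i \<in> {1..k}" "(z(1 := (fst (z 1), False))) i = (b, False)"
    using assms occupy_generic[OF z(1)] unfolding label_support_def by blast
  show "\<exists>(i, o')\<in>vsupport k 0. z i = (b, o')"
  proof (cases "i = 1")
    case True
    then have "z 1 = (b, True)" using i 1 by (metis fun_upd_same prod.collapse prod.inject)
    then show ?thesis by auto
  next
    case False
    then show ?thesis using i by auto
  qed
qed

lemma label_support_Tword:
  assumes "j < k" "k \<le> d" "label_support d q b (vsupport k 0) g"
  shows "label_support d q b (vsupport k j) (rep d q (Tword j) g)"
  using assms(1)
proof (induction j)
  case 0
  have "rep d q 1 g = g" by (rule ext) simp
  then show ?case using assms by simp
next
  case (Suc j)
  then have "label_support d q b (vsupport k j) (rep d q (Tword j) g)" by simp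
  then have "label_support d q b (vsupport k (Suc j)) (act d q (GenT (Suc j)) (rep d q (Tword j) g))"
    by (rule label_support_T) (use Suc assms in auto)
  then show ?case unfolding Tword.simps rep_mult rep_gen .
qed

lemma Tword_leading:
  assumes "j < k" "k \<le> d" "x0 \<in> generic_states d q" "x0 1 = (b, True)"
  shows "\<exists>x\<in>generic_states d q. x (Suc j) = (b, True) \<and> (\<exists>\<kappa>. \<kappa> \<noteq> 0 \<and>
     (\<forall>g. label_support d q b (vsupport k 0) g \<longrightarrow> rep d q (Tword j) g x = \<kappa> * g x0))"
  using assms(1)
proof (induction j)
  case 0
  then show ?case using assms(3,4) by (intro bexI[of _ x0]) (auto intro!: exI[of _ 1])
next
  case (Suc j)
  then obtain x' \<kappa> where x': "x' \<in> generic_states d q" "x' (Suc j) = (b, True)" "\<kappa> \<noteq> 0"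
    and k: "\<And>g. label_support d q b (vsupport k 0) g \<Longrightarrow> rep d q (Tword j) g x' = \<kappa> * g x0"
    by auto
  have j: "Suc j \<in> {1..<d}" using Suc assms by auto
  define x where "x = swap_at (Suc j) x'"
  have x: "x \<in> generic_states d q" "x (Suc (Suc j)) = (b, True)" "swap_at (Suc j) x = x'"
    using swap_at_generic[OF x'(1) j] x' by (auto simp: x_def)
  define \<kappa>' where "\<kappa>' = demazure_coeff q (fst (x (Suc j))) (fst (x (Suc (Suc j))))
    * swap_sign (snd (x (Suc j))) (snd (x (Suc (Suc j))))"
  have "\<kappa>' \<noteq> 0" using demazure_coeff_nz[OF x(1) j] swap_sign_nz by (auto simp: \<kappa>'_def)
  moreover have "rep d q (Tword (Suc j)) g x = \<kappa>' * \<kappa> * g x0"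
    if g: "label_support d q b (vsupport k 0) g" for g
  proof -
    have "rep d q (Tword j) g x = 0"
      by (rule label_support_zero[OF label_support_Tword[OF _ assms(2) g] x(1,2)])
        (use Suc assms in auto)
    then show ?thesis
      using j k[OF g] x(3) by (simp add: rep_mult rep_gen \<kappa>'_def)
  qed
  ultimately show ?case using x x' by (intro bexI[of _ x]) (auto intro!: exI[of _ "\<kappa>' * \<kappa>"])
qed

lemma label_support_vterm:
  assumes "j < k" "k \<le> d" "label_support d q b {(k, False)} \<psi>"
  shows "label_support d q b (vsupport k j) (rep d q (Tword j * (gTheta * Sword q 1 k)) \<psi>)"
  unfolding rep_mult rep_gen
  using assms by (intro label_support_Tword label_support_theta label_support_Sword) auto

text \<open>Concatenates three moves of the label: from k down to 1 unoccupied, becoming occupied at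
  1, and up to j + 1.\<close>

lemma vterm_leading:
  assumes "j < k" "k \<le> d" "y \<in> generic_states d q" "y k = (b, False)" "q \<noteq> 0"
  shows "\<exists>x\<in>generic_states d q. x (Suc j) = (b, True) \<and> (\<exists>\<kappa>. \<kappa> \<noteq> 0 \<and>
     (\<forall>\<psi>. label_support d q b {(k, False)} \<psi> \<longrightarrow>
        rep d q (Tword j * (gTheta * Sword q 1 k)) \<psi> x = \<kappa> * \<psi> y))"
proof -
  obtain x1 \<kappa>1 where x1: "x1 \<in> generic_states d q" "x1 1 = (b, False)" "\<kappa>1 \<noteq> 0"
    and k1: "\<And>\<psi>. label_support d q b {(k, False)} \<psi> \<Longrightarrow> rep d q (Sword q 1 k) \<psi> x1 = \<kappa>1 * \<psi> y"
    using Sword_leading[of 1 k d y q b] assms by auto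
  define x0 where "x0 = x1(1 := (b, True))"
  have x0: "x0 \<in> generic_states d q" "x0 1 = (b, True)"
    using occupy_generic[OF x1(1), of True] x1(2) by (auto simp: x0_def)
  obtain x \<kappa> where x: "x \<in> generic_states d q" "x (Suc j) = (b, True)" "\<kappa> \<noteq> 0"
    and k: "\<And>g. label_support d q b (vsupport k 0) g \<Longrightarrow> rep d q (Tword j) g x = \<kappa> * g x0"
    using Tword_leading[OF assms(1,2) x0] by auto
  have "rep d q (Tword j * (gTheta * Sword q 1 k)) \<psi> x = \<kappa> * \<kappa>1 * \<psi> y"
    if psi: "label_support d q b {(k, False)} \<psi>" for \<psi>
  proof -
    have upd: "x1(1 := (b, False)) = x1" using x1(2) by auto
    have "label_support d q b (vsupport k 0) (act d q GenTheta (rep d q (Sword q 1 k) \<psi>))"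
      using assms psi by (intro label_support_theta label_support_Sword) auto
    moreover have "act d q GenTheta (rep d q (Sword q 1 k) \<psi>) x0 = \<kappa>1 * \<psi> y"
      using k1[OF psi] x0 upd by (simp add: x0_def)
    ultimately show ?thesis unfolding rep_mult rep_gen using k by simp
  qed
  then show ?thesis using x x1(3) by (intro bexI[of _ x]) (auto intro!: exI[of _ "\<kappa> * \<kappa>1"])
qed

text \<open>A common shift makes all exponents nonnegative; the resulting polynomial has infinitely
  many roots.\<close>

lemma laurent_coeffs_zero:
  fixes \<beta> :: "int \<Rightarrow> 'k::field"
  assumes "finite K" "infinite C" "\<And>c. c \<in> C \<Longrightarrow> c \<noteq> 0 \<and> (\<Sum>a\<in>K. c powi a * \<beta> a) = 0"
    and "a \<in> K"
  shows "\<beta> a = 0"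
proof -
  obtain N where N: "\<And>a. a \<in> K \<Longrightarrow> a + N \<ge> 0"
  proof (cases "K = {}")
    case False
    then have "a + (- Min K) \<ge> 0" if "a \<in> K" for a using Min_le[OF assms(1) that] by simp
    then show ?thesis using that by blast
  qed auto
  define P where "P = (\<Sum>a\<in>K. Polynomial.monom (\<beta> a) (nat (a + N)))"
  have "poly P c = 0" if "c \<in> C" for c
  proof -
    have "poly P c = (\<Sum>a\<in>K. \<beta> a * c ^ nat (a + N))"
      by (simp add: P_def poly_sum poly_monom)
    also have "\<dots> = (\<Sum>a\<in>K. c powi N * (c powi a * \<beta> a))"
    proof (rule sum.cong[OF refl])
      fix a assume "a \<in> K"
      then have "c ^ nat (a + N) = c powi (a + N)" using N by (simp add: power_int_def)
      also have "\<dots> = c powi a * c powi N" using assms(3)[OF that] by (simp add: power_int_add)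
      finally show "\<beta> a * c ^ nat (a + N) = c powi N * (c powi a * \<beta> a)" by simp
    qed
    also have "\<dots> = 0" using assms(3)[OF that] by (simp flip: sum_distrib_left)
    finally show ?thesis .
  qed
  then have "C \<subseteq> {c. poly P c = 0}" by blast
  then have "infinite {c. poly P c = 0}" using assms(2) finite_subset by blast
  then have "P = 0" using poly_roots_finite by blast
  have "Polynomial.coeff P (nat (a + N)) = (\<Sum>b\<in>K. if b = a then \<beta> b else 0)"
    unfolding P_def Polynomial.coeff_sum coeff_monom using N assms(4)
    by (intro sum.cong) (auto simp: eq_nat_nat_iff)
  also have "\<dots> = \<beta> a" using assms by simp
  finally show ?thesis using \<open>P = 0\<close> by simp
qed

lemma generic_update_infinite:
  assumes "infinite (UNIV :: 'k::field set)" "z \<in> generic_states d (q :: 'k)" "q \<noteq> 0"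
  shows "infinite {c. z(k := (c, a)) \<in> generic_states d q}"
proof
  assume fin: "finite {c. z(k := (c, a)) \<in> generic_states d q}"
  \<comment> \<open>The values ruled out by genericity: zero, the labels themselves, and their
    multiples by q and by 1/q.\<close>
  let ?F = "{0} \<union> (\<lambda>i. fst (z i)) ` {1..d} \<union> (\<lambda>i. q * fst (z i)) ` {1..d} \<union> (\<lambda>i. fst (z i) / q) ` {1..d}"
  have "c \<in> ?F \<or> z(k := (c, a)) \<in> generic_states d q" for c
  proof (rule disjCI)
    assume "z(k := (c, a)) \<notin> generic_states d q"
    moreover have "c = x / q \<longleftrightarrow> x = q * c" for x using assms(3) by (auto simp: field_simps)
    ultimately show "c \<in> ?F" using assms(2)
      by (auto simp: generic_states_def image_iff split: if_splits)
  qed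
  then have "UNIV \<subseteq> ?F \<union> {c. z(k := (c, a)) \<in> generic_states d q}" by blast
  moreover have "finite (?F \<union> {c. z(k := (c, a)) \<in> generic_states d q})" using fin by simp
  ultimately show False using assms(1) finite_subset by blast
qed

lemma generic_states_nonempty:
  assumes "infinite (UNIV :: 'k::field set)" "q \<noteq> 0"
  shows "generic_states d (q :: 'k) \<noteq> {}"
proof (induction d)
  case 0
  then show ?case by (auto simp: generic_states_def)
next
  case (Suc d)
  then obtain z where z: "z \<in> generic_states d q" by blast
  let ?F = "{0} \<union> (\<lambda>i. fst (z i)) ` {1..d} \<union> (\<lambda>i. q * fst (z i)) ` {1..d} \<union> (\<lambda>i. fst (z i) / q) ` {1..d}"
  have "finite ?F" by simp
  from ex_new_if_finite[OF assms(1) this] obtain c where c: "c \<notin> ?F" ..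
  have "z(Suc d := (c, False)) \<in> generic_states (Suc d) q"
  proof -
    have "c = x / q \<longleftrightarrow> x = q * c" for x using assms(2) by (auto simp: field_simps)
    then show ?thesis
      using z c by (auto simp: generic_states_def atLeastAtMostSuc_conv image_iff)
  qed
  then show ?case by blast
qed

context hecke_pos
begin

lemma Xpow_act: "z \<in> generic_states d q \<Longrightarrow> k \<le> d \<Longrightarrow> rep d q (Xpow k a) \<phi> z = fst (z k) powi a * \<phi> z"
proof -
  assume z: "z \<in> generic_states d q" and k: "k \<le> d"
  have X: "rep d q (gX k ^ n) \<phi> z = fst (z k) ^ n * \<phi> z" for n
    by (induction n) (auto simp: rep_mult rep_gen)
  have Y: "rep d q (gXinv k ^ n) \<phi> z = inverse (fst (z k)) ^ n * \<phi> z" for n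
    by (induction n) (auto simp: rep_mult rep_gen)
  show ?thesis by (auto simp: Xpow_def power_int_def X Y)
qed

text \<open>The label c at position k is varied while the coefficients act on the remaining
  positions. Evaluation gives a Laurent polynomial in c that vanishes for infinitely many c.\<close>

lemma laurent_annihilates:
  assumes inf: "infinite (UNIV :: 'k set)" and d: "k \<le> d" and p: "p \<in> coeff_set A1 UNIV"
    and zero: "\<And>\<psi> y. y \<in> generic_states d q \<Longrightarrow> snd (y k) = a \<Longrightarrow> rep d q (laurent k p) \<psi> y = 0"
  shows "Poly_Mapping.lookup p m \<in> annihilator d q"
  unfolding annihilator_def
proof (intro CollectI allI ballI)
  fix \<phi> and z :: "'k state" assume z: "z \<in> generic_states d q"
  let ?\<alpha> = "Poly_Mapping.lookup p"
  let ?C = "{c. z(k := (c, a)) \<in> generic_states d q}"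
  have C: "c \<noteq> 0 \<and> (\<Sum>m\<in>Poly_Mapping.keys p. c powi m * rep d q (?\<alpha> m) \<phi> z) = 0"
    if "c \<in> ?C" for c
  proof -
    define y where "y = z(k := (c, a))"
    have y: "y \<in> generic_states d q" using that by (simp add: y_def)
    \<comment> \<open>The test function restores the original content of position k, so the
      coefficients contribute values independent of c.\<close>
    have upd: "rep d q (?\<alpha> m) (\<lambda>u. \<phi> (u(k := z k))) y = rep d q (?\<alpha> m) \<phi> z" for m
    proof -
      have "?\<alpha> m \<in> free_span A1" using p by (simp add: coeff_set_def)
      then have "rep d q (?\<alpha> m) (\<lambda>u. \<phi> (u(k := z k))) y = rep d q (?\<alpha> m) \<phi> (y(k := z k))"
        using rep_update_position[of "?\<alpha> m" k d q \<phi> "z k"] k_pos by simp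
      then show ?thesis by (simp add: y_def)
    qed
    have "0 = rep d q (laurent k p) (\<lambda>u. \<phi> (u(k := z k))) y"
      by (rule zero[OF y, symmetric]) (simp add: y_def)
    also have "\<dots> = (\<Sum>m\<in>Poly_Mapping.keys p. c powi m * rep d q (?\<alpha> m) \<phi> z)"
      unfolding laurent_def rep_sum rep_mult Xpow_act[OF y d] upd by (simp add: y_def)
    finally have "(\<Sum>m\<in>Poly_Mapping.keys p. c powi m * rep d q (?\<alpha> m) \<phi> z) = 0" ..
    moreover have "fst (y k) \<noteq> 0" using y k_pos d by (auto simp: generic_states_def)
    then have "c \<noteq> 0" by (simp add: y_def)
    ultimately show ?thesis by blast
  qed
  have "rep d q (?\<alpha> m) \<phi> z = 0" if "m \<in> Poly_Mapping.keys p"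
    by (rule laurent_coeffs_zero[where \<beta> = "\<lambda>m. rep d q (?\<alpha> m) \<phi> z",
          OF finite_keys generic_update_infinite[OF inf z q_nz, of k a] C that])
  then show "rep d q (?\<alpha> m) \<phi> z = 0"
    by (cases "m \<in> Poly_Mapping.keys p") (auto simp: in_keys_iff)
qed

lemma laurent_free_span:
  fixes p :: "int \<Rightarrow>\<^sub>0 (hecke_gen, 'k) free_alg"
  assumes "p \<in> coeff_set A1 UNIV"
  shows "laurent k p \<in> free_span (insert (GenX k) (insert (GenXinv k) A1))"
proof -
  let ?G = "insert (GenX k) (insert (GenXinv k) A1)"
  have pow: "x ^ n \<in> free_span ?G" if "x \<in> free_span ?G" for x :: "(hecke_gen, 'k) free_alg" and n
    using that by (induction n) (auto intro: free_span_mult)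
  have "Poly_Mapping.lookup p a \<in> free_span ?G" for a
    using assms free_span_mono[of A1 ?G] by (auto simp: coeff_set_def)
  moreover have "(Xpow k a :: (hecke_gen, 'k) free_alg) \<in> free_span ?G" for a
    unfolding Xpow_def by (auto intro!: pow)
  ultimately show ?thesis unfolding laurent_def by (intro free_span_sum free_span_mult) auto
qed

lemma annihilator_mult_left: "f \<in> annihilator d q \<Longrightarrow> x * f \<in> annihilator d q"
proof -
  assume f: "f \<in> annihilator d q"
  have "rep d q x (rep d q f \<phi>) z = 0" if "z \<in> generic_states d q" for \<phi> z
    by (rule rep_vanish[OF _ that]) (use f in \<open>simp add: annihilator_def\<close>)
  then show ?thesis by (simp add: annihilator_def rep_mult)
qed

lemma annihilator_diff: "f \<in> annihilator d q \<Longrightarrow> g \<in> annihilator d q \<Longrightarrow> f - g \<in> annihilator d q"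
  by (simp add: annihilator_def rep_diff)

lemma annihilator_sum: "(\<And>i. i \<in> I \<Longrightarrow> f i \<in> annihilator d q) \<Longrightarrow> sum f I \<in> annihilator d q"
  by (simp add: annihilator_def rep_sum)

lemma laurent_annihilator:
  "(\<And>a. Poly_Mapping.lookup p a \<in> annihilator d q) \<Longrightarrow> laurent k p \<in> annihilator d q"
  unfolding laurent_def by (intro annihilator_sum annihilator_mult_left)

text \<open>The indicator of a prescribed content at position k commutes with the smaller algebra
  and with powers of \<open>X_k\<close>, so cutting off the function before or after applying a
  Laurent polynomial is the same.\<close>

lemma indicator_support:
  fixes b :: 'k and a :: bool
  assumes "p \<in> coeff_set A1 UNIV"
  defines "\<chi> \<equiv> \<lambda>s. if s = (b, a) then 1 else (0 :: 'k)"
  shows "label_support d q b {(k, a)} (rep d q (laurent k p) (\<lambda>z. \<chi> (z k) * \<phi> z))"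
    and "y k = (b, a) \<Longrightarrow> rep d q (laurent k p) (\<lambda>z. \<chi> (z k) * \<phi> z) y = rep d q (laurent k p) \<phi> y"
proof -
  have "rep d q (laurent k p) (\<lambda>z. \<chi> (z k) * \<phi> z) = (\<lambda>z. \<chi> (z k) * rep d q (laurent k p) \<phi> z)"
    by (rule rep_scale_position[OF laurent_free_span[OF assms(1)] _ k_pos]) auto
  then show "label_support d q b {(k, a)} (rep d q (laurent k p) (\<lambda>z. \<chi> (z k) * \<phi> z))"
    and "y k = (b, a) \<Longrightarrow> rep d q (laurent k p) (\<lambda>z. \<chi> (z k) * \<phi> z) y = rep d q (laurent k p) \<phi> y"
    by (auto simp: label_support_def \<chi>_def)
qed

lemma rep_ucomb: "rep d q (ucomb p) \<phi> z = (\<Sum>j<k. rep d q (Sw (Suc j)) (rep d q (laurent k (p j)) \<phi>) z)"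
  and rep_vcomb: "rep d q (vcomb r) \<phi> z
    = (\<Sum>j<k. rep d q (Tword j * (gTheta * Sw 1)) (rep d q (laurent k (r j)) \<phi>) z)"
  unfolding ucomb_def vcomb_def rep_sum by (simp_all add: rep_mult)

text \<open>Downward induction on j, testing at the state where the label is occupied at position j
  + 1.\<close>

lemma vcomb_independent_aux:
  assumes d: "k \<le> d" and coeffs: "\<And>j. p j \<in> coeff_set A1 UNIV" "\<And>j. r j \<in> coeff_set A1 UNIV"
    and zero: "ucomb p + vcomb r \<in> annihilator d q"
    and "j < k" "y \<in> generic_states d q" "y k = (b, False)"
  shows "rep d q (laurent k (r j)) \<phi> y = 0"
  using assms(5-7)
proof (induction "k - j" arbitrary: j y b \<phi> rule: less_induct)
  case less
  define \<psi> where "\<psi> = (\<lambda>z. (if z k = (b, False) then 1 else 0) * \<phi> z)"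
  have supp: "label_support d q b {(k, False)} (rep d q (laurent k s) \<psi>)"
    if "s \<in> coeff_set A1 UNIV" for s
    using indicator_support(1)[OF that, of d b False \<phi>] by (simp add: \<psi>_def)
  obtain x \<kappa> where x: "x \<in> generic_states d q" "x (Suc j) = (b, True)" "\<kappa> \<noteq> 0"
    and k: "\<And>\<psi>. label_support d q b {(k, False)} \<psi> \<Longrightarrow>
        rep d q (Tword j * (gTheta * Sw 1)) \<psi> x = \<kappa> * \<psi> y"
    using vterm_leading[OF less.prems(1) d less.prems(2,3) q_nz] by auto
  \<comment> \<open>The elements without \<theta> never see the label in an occupied
    position.\<close>
  have u: "rep d q (Sw (Suc m)) (rep d q (laurent k (p m)) \<psi>) x = 0" if "m < k" for m
    by (rule label_support_zero[OF label_support_Sword[OF _ _ d supp[OF coeffs(1)]] x(1,2)])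
      (use less.prems that d in auto)
  \<comment> \<open>For m < j the occupied label cannot get as far as j + 1; for m > j the Laurent
    coefficient already acts by zero, by the induction hypothesis.\<close>
  have v: "rep d q (Tword m * (gTheta * Sw 1)) (rep d q (laurent k (r m)) \<psi>) x = 0"
    if "m < k" "m \<noteq> j" for m
  proof (cases "m < j")
    case True
    show ?thesis
      by (rule label_support_zero[OF label_support_vterm[OF \<open>m < k\<close> d supp[OF coeffs(2)]] x(1,2)])
        (use less.prems that d True in auto)
  next
    case False
    have vanish: "rep d q (laurent k (r m)) \<psi> y' = 0" if y': "y' \<in> generic_states d q" for y'
    proof (cases "y' k = (b, False)")
      case True
      then show ?thesis using less.hyps[of m y' b \<psi>] y' \<open>m < k\<close> \<open>m \<noteq> j\<close> False by auto
    next
      case False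
      then show ?thesis
        using supp[OF coeffs(2)] y' by (auto simp: label_support_def)
    qed
    show ?thesis by (rule rep_vanish[OF vanish x(1)])
  qed
  have "0 = rep d q (ucomb p + vcomb r) \<psi> x"
    using zero x(1) by (simp add: annihilator_def)
  also have "\<dots> = (\<Sum>m<k. rep d q (Tword m * (gTheta * Sw 1)) (rep d q (laurent k (r m)) \<psi>) x)"
    by (simp add: rep_add rep_ucomb rep_vcomb u)
  also have "\<dots> = rep d q (Tword j * (gTheta * Sw 1)) (rep d q (laurent k (r j)) \<psi>) x"
    using less.prems(1) v by (subst sum.remove[of _ j]) (auto intro!: sum.neutral)
  also have "\<dots> = \<kappa> * rep d q (laurent k (r j)) \<phi> y"
    using k[OF supp[OF coeffs(2)]] indicator_support(2)[where a = False and y = y, OF coeffs(2)[of j] less.prems(3), of d \<phi>]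
    by (simp add: \<psi>_def)
  finally show ?case using x(3) by simp
qed

text \<open>Upward induction, since the product starting at m + 1 has support from position m + 1
  on: larger indices miss position j + 1, smaller ones are already eliminated.\<close>

lemma ucomb_independent_aux:
  assumes d: "k \<le> d" and coeffs: "\<And>j. p j \<in> coeff_set A1 UNIV"
    and zero: "ucomb p \<in> annihilator d q"
    and "j < k" "y \<in> generic_states d q" "y k = (b, False)"
  shows "rep d q (laurent k (p j)) \<phi> y = 0"
  using assms(4-6)
proof (induction j arbitrary: y b \<phi> rule: less_induct)
  case (less j)
  define \<psi> where "\<psi> = (\<lambda>z. (if z k = (b, False) then 1 else 0) * \<phi> z)"
  have supp: "label_support d q b {(k, False)} (rep d q (laurent k s) \<psi>)"
    if "s \<in> coeff_set A1 UNIV" for s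
    using indicator_support(1)[OF that, of d b False \<phi>] by (simp add: \<psi>_def)
  obtain x \<kappa> where x: "x \<in> generic_states d q" "x (Suc j) = (b, False)" "\<kappa> \<noteq> 0"
    and k: "\<And>\<psi>. label_support d q b {(k, False)} \<psi> \<Longrightarrow> rep d q (Sw (Suc j)) \<psi> x = \<kappa> * \<psi> y"
    using Sword_leading[of "Suc j" k d y q b] less.prems d q_nz by auto
  have u: "rep d q (Sw (Suc m)) (rep d q (laurent k (p m)) \<psi>) x = 0" if "m < k" "m \<noteq> j" for m
  proof (cases "m > j")
    case True
    show ?thesis
      by (rule label_support_zero[OF label_support_Sword[OF _ _ d supp[OF coeffs]] x(1,2)])
        (use less.prems that d True in auto)
  next
    case False
    have vanish: "rep d q (laurent k (p m)) \<psi> y' = 0" if y': "y' \<in> generic_states d q" for y'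
    proof (cases "y' k = (b, False)")
      case True
      then show ?thesis using less.IH[of m y' b \<psi>] y' \<open>m < k\<close> \<open>m \<noteq> j\<close> False by auto
    next
      case False
      then show ?thesis
        using supp[OF coeffs] y' by (auto simp: label_support_def)
    qed
    show ?thesis by (rule rep_vanish[OF vanish x(1)])
  qed
  have "0 = rep d q (ucomb p) \<psi> x"
    using zero x(1) by (simp add: annihilator_def)
  also have "\<dots> = rep d q (Sw (Suc j)) (rep d q (laurent k (p j)) \<psi>) x"
    unfolding rep_ucomb using less.prems(1) u by (subst sum.remove[of _ j]) (auto intro!: sum.neutral)
  also have "\<dots> = \<kappa> * rep d q (laurent k (p j)) \<phi> y"
    using k[OF supp[OF coeffs]] indicator_support(2)[where a = False and y = y, OF coeffs[of j] less.prems(3), of d \<phi>]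
    by (simp add: \<psi>_def)
  finally show ?case using x(3) by simp
qed

text \<open>The elements with \<theta> come first, because occupied positions are invisible to the
  others; their part is then subtracted and the rest treated separately.\<close>

lemma independence_annihilator:
  assumes inf: "infinite (UNIV :: 'k set)" and d: "k \<le> d"
    and coeffs: "\<And>j. p j \<in> coeff_set A1 UNIV" "\<And>j. r j \<in> coeff_set A1 UNIV"
    and zero: "ucomb p + vcomb r \<in> annihilator d q"
    and j: "j < k"
  shows "Poly_Mapping.lookup (p j) m \<in> annihilator d q" "Poly_Mapping.lookup (r j) m \<in> annihilator d q"
proof -
  have r: "Poly_Mapping.lookup (r j) m \<in> annihilator d q" if "j < k" for j m
  proof (rule laurent_annihilates[OF inf d coeffs(2), where a = False])
    fix \<psi> y assume "y \<in> generic_states d q" "snd (y k) = False"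
    then show "rep d q (laurent k (r j)) \<psi> y = 0"
      using vcomb_independent_aux[OF d coeffs zero that, of y "fst (y k)"] by (simp add: prod_eq_iff)
  qed
  then have "vcomb r \<in> annihilator d q"
    unfolding vcomb_def by (intro annihilator_sum annihilator_mult_left laurent_annihilator) auto
  then have u: "ucomb p \<in> annihilator d q"
    using annihilator_diff[OF zero] by fastforce
  show "Poly_Mapping.lookup (p j) m \<in> annihilator d q"
  proof (rule laurent_annihilates[OF inf d coeffs(1), where a = False])
    fix \<psi> y assume "y \<in> generic_states d q" "snd (y k) = False"
    then show "rep d q (laurent k (p j)) \<psi> y = 0"
      using ucomb_independent_aux[OF d coeffs(1) u j, of y "fst (y k)"] by (simp add: prod_eq_iff)
  qed
  show "Poly_Mapping.lookup (r j) m \<in> annihilator d q" using r[OF j] .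
qed

end

text \<open>Induction on k with d fixed: after expansion in the spanning set, independence shows
  that the coefficients from the algebra for k - 1 annihilate the same representation on d
  positions. For k = 0 an element is a constant.\<close>

theorem faithful:
  fixes q :: "'k::field"
  assumes inf: "infinite (UNIV :: 'k set)" and q: "q \<noteq> 0" and "k \<le> d"
    and "f \<in> free_span (dgens k)" "f \<in> annihilator d q"
  shows "f \<in> ideal_hull (dg_relators k q)"
  using assms(3-)
proof (induction k arbitrary: f)
  case 0
  then have "Poly_Mapping.keys f \<subseteq> {0}"
    by (auto simp: free_span_def dgens_def zero_free_word_def) (metis free_word.collapse)
  then have "f = free_const (Poly_Mapping.lookup f 0)"
    by (intro poly_mapping_eqI) (auto simp: free_const_def lookup_single when_def in_keys_iff)
  then obtain c where f: "f = free_const c" by blast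
  obtain z where "z \<in> generic_states d q" using generic_states_nonempty[OF inf q] by blast
  then have "rep d q f (\<lambda>z. 1) z = 0" using 0(3) by (simp add: annihilator_def)
  then have "c = 0" by (simp add: f rep_const)
  then show ?case by (simp add: f ideal_hull.zero)
next
  case (Suc k)
  interpret hecke_pos q "Suc k" by unfold_locales (use q in auto)
  obtain p r where pr: "\<And>j. p j \<in> coeff_set (dgens (Suc k - 1)) UNIV"
      "\<And>j. r j \<in> coeff_set (dgens (Suc k - 1)) UNIV"
      "cong_ideal (dg_relators (Suc k) q) f (ucomb p + vcomb r)"
    using spanning[OF Suc.prems(2)] by blast
  have "f - (ucomb p + vcomb r) \<in> annihilator d q"
    using pr(3) ideal_hull_subset[of "dg_relators (Suc k) q" "dg_relators d q"]
      dg_relators_mono[OF Suc.prems(1), of q] ideal_annihilates[of d q]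
    unfolding cong_ideal_def by (meson ideal_hull_incl subset_iff)
  from annihilator_diff[OF Suc.prems(3) this] have "ucomb p + vcomb r \<in> annihilator d q"
    by (simp add: add.commute)
  note ann = independence_annihilator[OF inf Suc.prems(1) pr(1,2) this]
  have sub: "ideal_hull (dg_relators k q) \<subseteq> ideal_hull (dg_relators (Suc k) q)"
    using dg_relators_mono[of k "Suc k" q] by (intro ideal_hull_subset) (auto intro: ideal_hull_incl)
  have mem: "x \<in> ideal_hull (dg_relators (Suc k) q)"
    if "x \<in> free_span (dgens k)" "x \<in> annihilator d q" for x
    using Suc.IH[OF _ that] Suc.prems(1) sub by auto
  have "Poly_Mapping.lookup (p j) m \<in> ideal_hull (dg_relators (Suc k) q)"
    "Poly_Mapping.lookup (r j) m \<in> ideal_hull (dg_relators (Suc k) q)" if "j < Suc k" for j m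
    using ann[OF that, of m] pr(1,2)[of j] by (auto intro!: mem simp: coeff_set_def)
  then have "ucomb p + vcomb r \<in> ideal_hull (dg_relators (Suc k) q)"
    unfolding ucomb_def vcomb_def laurent_def
    by (intro ideal_hull_add ideal_hull_sum ideal_hull_mult_left) auto
  then show ?case using cong_ideal_mem_iff[OF pr(3)] by blast
qed

text \<open>Independence is first obtained as annihilation in the representation for d = k and then
  turned into membership in the ideal for k - 1 by faithfulness.\<close>

theorem (in hecke_pos) independence:
  assumes inf: "infinite (UNIV :: 'k set)"
    and coeffs: "\<And>j. p j \<in> coeff_set A1 UNIV" "\<And>j. r j \<in> coeff_set A1 UNIV"
    and zero: "ucomb p + vcomb r \<in> ideal_hull (dg_relators k q)"
    and j: "j < k"
  shows "Poly_Mapping.lookup (p j) m \<in> ideal_hull (dg_relators (k - 1) q)"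
    "Poly_Mapping.lookup (r j) m \<in> ideal_hull (dg_relators (k - 1) q)"
proof -
  have z: "ucomb p + vcomb r \<in> annihilator k q" using ideal_annihilates[of k q] zero by blast
  note ann = independence_annihilator[OF inf order_refl coeffs z j, of m]
  show "Poly_Mapping.lookup (p j) m \<in> ideal_hull (dg_relators (k - 1) q)"
    by (rule faithful[OF inf q_nz _ _ ann(1)]) (use coeffs in \<open>auto simp: coeff_set_def\<close>)
  show "Poly_Mapping.lookup (r j) m \<in> ideal_hull (dg_relators (k - 1) q)"
    by (rule faithful[OF inf q_nz _ _ ann(2)]) (use coeffs in \<open>auto simp: coeff_set_def\<close>)
qed


section \<open>The differential on the free algebra\<close>

declare One_nat_def [simp del]

abbreviation theta_count :: "hecke_gen list \<Rightarrow> nat" where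
  "theta_count u \<equiv> count_list u GenTheta"

definition homogeneous :: "nat \<Rightarrow> (hecke_gen, 'k::field) free_alg set" where
  "homogeneous n = {f. \<forall>w\<in>Poly_Mapping.keys f. theta_count (letters w) = n}"

text \<open>The signed Leibniz rule with respect to the first letter; it defines the derivation on
  the free algebra before any relation is imposed.\<close>

primrec diff_word :: "'k::field list \<Rightarrow> hecke_gen list \<Rightarrow> (hecke_gen, 'k) free_alg" where
  "diff_word Qs [] = 0"
| "diff_word Qs (g # u) =
     (if g = GenTheta then cyclotomic Qs (gX 1) * word_term u 1 - gTheta * diff_word Qs u
      else free_gen g * diff_word Qs u)"

definition diff_free :: "'k::field list \<Rightarrow> (hecke_gen, 'k) free_alg \<Rightarrow> (hecke_gen, 'k) free_alg" where
  "diff_free Qs f = (\<Sum>w\<in>Poly_Mapping.keys f.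
     free_const (Poly_Mapping.lookup f w) * diff_word Qs (letters w))"

lemma homogeneous_0 [simp]: "0 \<in> homogeneous n"
  by (simp add: homogeneous_def)

lemma homogeneous_add: "f \<in> homogeneous n \<Longrightarrow> g \<in> homogeneous n \<Longrightarrow> f + g \<in> homogeneous n"
  unfolding homogeneous_def using keys_add[of f g] by blast

lemma homogeneous_uminus: "f \<in> homogeneous n \<Longrightarrow> - f \<in> homogeneous n"
  by (simp add: homogeneous_def in_keys_iff)

lemma homogeneous_diff: "f \<in> homogeneous n \<Longrightarrow> g \<in> homogeneous n \<Longrightarrow> f - g \<in> homogeneous n"
  using homogeneous_add[OF _ homogeneous_uminus, of f n g] by simp

lemma homogeneous_sum: "(\<And>i. i \<in> I \<Longrightarrow> f i \<in> homogeneous n) \<Longrightarrow> sum f I \<in> homogeneous n"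
  by (induction I rule: infinite_finite_induct) (auto intro: homogeneous_add)

lemma homogeneous_mult:
  assumes "f \<in> homogeneous m" "g \<in> homogeneous n"
  shows "f * g \<in> homogeneous (m + n)"
proof -
  have "theta_count (letters w) = m + n" if w: "w \<in> Poly_Mapping.keys (f * g)" for w
    using subsetD[OF keys_mult w] assms
    by (auto simp: homogeneous_def letters_plus count_list_append)
  then show ?thesis by (simp add: homogeneous_def)
qed

lemma homogeneous_word_term: "theta_count u = n \<Longrightarrow> word_term u c \<in> homogeneous n"
  by (auto simp: homogeneous_def)

lemma homogeneous_const: "free_const c \<in> homogeneous 0"
  by (simp add: free_const_eq homogeneous_word_term)

lemma homogeneous_gen: "g \<noteq> GenTheta \<Longrightarrow> free_gen g \<in> homogeneous 0"
  and homogeneous_theta: "gTheta \<in> homogeneous (Suc 0)"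
  by (auto simp: free_gen_def homogeneous_word_term)

lemma homogeneous_affine: "f \<in> free_span (affine_gens k) \<Longrightarrow> f \<in> homogeneous 0"
  by (auto simp: free_span_def homogeneous_def count_list_0_iff affine_gens_def)

lemma diff_free_0 [simp]: "diff_free Qs 0 = 0"
  by (simp add: diff_free_def)

lemma diff_free_add: "diff_free Qs (f + g) = diff_free Qs f + diff_free Qs g"
  unfolding diff_free_def
  by (rule setsum_keys_plus_distrib) (simp_all add: algebra_simps free_const_add)

lemma diff_free_uminus: "diff_free Qs (- f) = - diff_free Qs f"
  using diff_free_add[of Qs f "- f"] by (simp add: eq_neg_iff_add_eq_0 add.commute)

lemma diff_free_diff: "diff_free Qs (f - g) = diff_free Qs f - diff_free Qs g"
  using diff_free_add[of Qs f "- g"] by (simp add: diff_free_uminus)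

lemma diff_free_sum: "diff_free Qs (sum f I) = (\<Sum>i\<in>I. diff_free Qs (f i))"
  by (induction I rule: infinite_finite_induct) (auto simp: diff_free_add)

lemma diff_free_word_term: "diff_free Qs (word_term u c) = free_const c * diff_word Qs u"
  by (simp add: diff_free_def)

lemma diff_word_append:
  "diff_word Qs (u @ v) = diff_word Qs u * word_term v 1
     + free_const ((- 1) ^ theta_count u) * (word_term u 1 * diff_word Qs v)"
proof (induction u)
  case Nil
  have "word_term [] 1 = (1 :: (hecke_gen, 'a) free_alg)"
    using free_const_eq[of "1 :: 'a"] by (simp del: single_one)
  then show ?case by simp
next
  case (Cons g u)
  show ?case
    unfolding append_Cons diff_word.simps Cons word_term_Cons
    by (simp add: algebra_simps gen_const' free_const_uminus word_term_mult power_add)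
qed

lemma diff_free_word_mult:
  "diff_free Qs (word_term u c * g) = diff_free Qs (word_term u c) * g
     + free_const ((- 1) ^ theta_count u) * (word_term u c * diff_free Qs g)"
proof (induction g rule: free_alg_induct)
  case (word e v)
  have 1: "word_term v e = free_const e * word_term v 1" "word_term u c = free_const c * word_term u 1"
    by (simp_all add: free_const_mult_word_term)
  show ?case
    unfolding word_term_mult diff_free_word_term diff_word_append
    unfolding 1 by (simp add: algebra_simps const_const' const_mid[of "diff_word Qs u"]
        const_mid[of "word_term u 1"] mult.commute)
next
  case (add f g)
  then show ?case by (simp add: algebra_simps diff_free_add)
qed

lemma diff_free_mult:
  assumes "f \<in> homogeneous n"
  shows "diff_free Qs (f * g) = diff_free Qs f * g + free_const ((- 1) ^ n) * (f * diff_free Qs g)"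
proof -
  have *: "diff_free Qs (Poly_Mapping.single w c * g) = diff_free Qs (Poly_Mapping.single w c) * g
      + free_const ((- 1) ^ n) * (Poly_Mapping.single w c * diff_free Qs g)"
    if "w \<in> Poly_Mapping.keys f" for w c
    using diff_free_word_mult[of Qs "letters w" c g] assms that by (simp add: homogeneous_def)
  let ?s = "\<lambda>w. Poly_Mapping.single w (Poly_Mapping.lookup f w)"
  have f: "f = (\<Sum>w\<in>Poly_Mapping.keys f. ?s w)" by (rule poly_mapping_eq_sum_single)
  have "diff_free Qs (f * g) = (\<Sum>w\<in>Poly_Mapping.keys f. diff_free Qs (?s w * g))"
    by (subst (1) f) (simp add: sum_distrib_right diff_free_sum)
  also have "\<dots> = (\<Sum>w\<in>Poly_Mapping.keys f. diff_free Qs (?s w) * g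
      + free_const ((- 1) ^ n) * (?s w * diff_free Qs g))"
    by (intro sum.cong refl *)
  also have "\<dots> = diff_free Qs (\<Sum>w\<in>Poly_Mapping.keys f. ?s w) * g
      + free_const ((- 1) ^ n) * ((\<Sum>w\<in>Poly_Mapping.keys f. ?s w) * diff_free Qs g)"
    by (simp add: sum.distrib diff_free_sum sum_distrib_right sum_distrib_left)
  finally show ?thesis by (simp flip: f)
qed

lemma diff_free_homogeneous_0:
  assumes "f \<in> homogeneous 0"
  shows "diff_free Qs f = 0"
proof -
  have "diff_word Qs u = 0" if "theta_count u = 0" for u
    using that by (induction u) (auto split: if_splits)
  then show ?thesis using assms by (simp add: diff_free_def homogeneous_def)
qed

lemma diff_free_mult_0:
  "f \<in> homogeneous 0 \<Longrightarrow> diff_free Qs (f * g) = f * diff_free Qs g"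
  by (simp add: diff_free_mult diff_free_homogeneous_0)

lemma diff_free_theta: "diff_free Qs gTheta = cyclotomic Qs (gX 1)"
  by (simp add: free_gen_def diff_free_word_term flip: free_const_eq)

lemma diff_free_theta_mult:
  "diff_free Qs (gTheta * g) = cyclotomic Qs (gX 1) * g - gTheta * diff_free Qs g"
  by (simp add: diff_free_mult[OF homogeneous_theta] diff_free_theta free_const_uminus)

lemma cyclotomic_free_span: "x \<in> free_span S \<Longrightarrow> cyclotomic Qs x \<in> free_span S"
  by (induction Qs) (auto intro!: free_span_intros)

lemma cyclotomic_homogeneous: "cyclotomic Qs (gX 1) \<in> homogeneous 0"
  by (rule homogeneous_affine[of _ 1], rule cyclotomic_free_span) (simp add: GenX_in)

lemma diff_free_free_span:
  assumes "f \<in> free_span (dgens k)"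
  shows "diff_free Qs f \<in> free_span (dgens k)"
  using assms
proof (induction f rule: free_span_induct)
  case (word c u)
  then have "diff_word Qs u \<in> free_span (dgens k)"
  proof (induction u)
    case (Cons g u)
    have "GenTheta \<in> dgens k \<Longrightarrow> GenX 1 \<in> dgens k"
      by (auto simp: dgens_def dg_gens_def affine_gens_def split: if_splits)
    then show ?case using Cons
      by (auto intro!: free_span_intros cyclotomic_free_span free_span_word_term)
  qed simp
  then show ?case by (simp add: diff_free_word_term free_span_mult)
qed (simp add: diff_free_add free_span_add)

text \<open>The square already vanishes in the free algebra, since the differential of \<theta> has
  degree zero.\<close>

lemma diff_free_diff_free: "diff_free Qs (diff_free Qs f) = 0"
proof (induction f rule: free_alg_induct)
  case (word c u)
  have "diff_free Qs (diff_word Qs u) = 0"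
  proof (induction u)
    case (Cons g u)
    have "diff_free Qs (word_term u 1) = diff_word Qs u" by (simp add: diff_free_word_term)
    then show ?case using Cons
      by (auto simp: diff_free_diff diff_free_theta_mult diff_free_mult_0 homogeneous_gen
          cyclotomic_homogeneous)
  qed simp
  then show ?case by (simp add: diff_free_word_term diff_free_mult_0 homogeneous_const)
qed (simp add: diff_free_add)

section \<open>Compatibility of the differential with the relations\<close>

lemma affine_relators_free_span: "affine_relators k q \<subseteq> free_span (affine_gens k)"
proof
  fix r assume "r \<in> affine_relators k q"
  then show "r \<in> free_span (affine_gens k)"
    unfolding affine_relators_def
    by (auto intro!: free_span_intros simp: GenT_in GenX_in GenXinv_in)
qed

lemma dg_relators_free_span:
  assumes "k \<ge> 1"
  shows "dg_relators k q \<subseteq> free_span (dgens k)"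
proof
  fix r assume "r \<in> dg_relators k q"
  then consider "r \<in> affine_relators k q" | "r = gTheta * gTheta"
    | i where "r = gX i * gTheta - gTheta * gX i" "i \<in> {1..k}"
    | i where "r = gXinv i * gTheta - gTheta * gXinv i" "i \<in> {1..k}"
    | i where "r = gT i * gTheta - gTheta * gT i" "i \<in> {1..<k}"
    | "r = gT 1 * gTheta * gT 1 * gTheta + gTheta * gT 1 * gTheta * gT 1
              - free_const (q - 1) * gTheta * gT 1 * gTheta" "k > 1"
    unfolding dg_relators_def by (auto split: if_splits)
  then show "r \<in> free_span (dgens k)"
    using assms affine_relators_free_span[of k q] free_span_mono[OF affine_gens_dgens[of k]]
    by cases (auto intro!: free_span_intros simp: dgens_def dg_gens_def affine_gens_def)
qed

primrec eval_cyclotomic :: "'k::field list \<Rightarrow> 'k \<Rightarrow> 'k" where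
  "eval_cyclotomic [] x = 1"
| "eval_cyclotomic (c # Qs) x = (x - c) * eval_cyclotomic Qs x"

lemma rep_cyclotomic:
  "rep d q (cyclotomic Qs (gX 1)) \<phi> z = eval_cyclotomic Qs (fst (z 1)) * \<phi> z"
  by (induction Qs) (simp_all add: rep_mult rep_diff rep_gen rep_const algebra_simps)

text \<open>The expression is what the Leibniz rule yields for the relator with two \<theta>. The
  element \<open>P\<close> acts by its value at the label in position 1, and the four occupation
  patterns are checked separately.\<close>

lemma rep_diff_theta_T_theta:
  fixes q :: "'k::field" and Qs :: "'k list"
  assumes z: "z \<in> generic_states d q" and d: "d > 1"
  defines "P \<equiv> cyclotomic Qs (gX 1)"
  shows "rep d q (gT 1 * (P * (gT 1 * gTheta) - gTheta * (gT 1 * P))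
     + (P * (gT 1 * (gTheta * gT 1)) - gTheta * (gT 1 * (P * gT 1)))
     - free_const (q - 1) * (P * (gT 1 * gTheta) - gTheta * (gT 1 * P))) \<phi> z = 0"
proof -
  define x where "x = fst (z 1)"
  define y where "y = fst (z 2)"
  have neq: "x \<noteq> y" unfolding x_def y_def by (rule generic_neq[OF z]) (use d in auto)
  obtain a b where zz: "z 1 = (x, a)" "z 2 = (y, b)" by (simp add: x_def y_def prod_eq_iff)
  have d': "Suc 0 < d" using d by simp
  have quad: "demazure_coeff q y x = q + 1 - demazure_coeff q x y"
    using demazure_quadratic[OF neq, of q] by (simp add: algebra_simps)
  have swap: "swap_at (Suc 0) u = u(1 := u 2, 2 := u 1)" for u :: "'k state"
    by (simp add: swap_at_def numeral_2_eq_2 One_nat_def)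
  show ?thesis unfolding P_def
    using d' zz
    by (cases a; cases b) (simp_all add: rep_mult rep_gen rep_const rep_add rep_diff
        rep_cyclotomic[unfolded One_nat_def] swap One_nat_def swap_sign_def numeral_2_eq_2 fun_upd_twist[of "Suc 0" "Suc (Suc 0)"] quad algebra_simps)
qed

text \<open>By faithfulness it suffices that the image acts by zero. Affine relators have image zero
  by degree; in the others \<open>P\<close> acts by a function of the label at position 1, which X_i
  and T_i with i > 1 respect.\<close>

lemma diff_relator:
  fixes q :: "'k::field"
  assumes inf: "infinite (UNIV :: 'k set)" and q: "q \<noteq> 0" and k: "k \<ge> 1" and r: "r \<in> dg_relators k q"
  shows "diff_free Qs r \<in> ideal_hull (dg_relators k q)"
proof (rule faithful[OF inf q order_refl])
  show "diff_free Qs r \<in> free_span (dgens k)"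
    using dg_relators_free_span[OF k, of q] r by (blast intro: diff_free_free_span)
  let ?P = "cyclotomic Qs (gX 1) :: (hecke_gen, 'k) free_alg"
  note dsimps = diff_free_diff diff_free_add diff_free_mult_0[OF homogeneous_gen]
    diff_free_theta_mult diff_free_theta diff_free_homogeneous_0[OF homogeneous_gen]
    diff_free_mult_0[OF homogeneous_const]
  consider "r \<in> affine_relators k q" | "r = gTheta * gTheta"
    | i where "r = gX i * gTheta - gTheta * gX i" "i \<in> {1..k}"
    | i where "r = gXinv i * gTheta - gTheta * gXinv i" "i \<in> {1..k}"
    | i where "r = gT i * gTheta - gTheta * gT i" "i \<in> {1..<k}" "i > 1"
    | "r = gT 1 * gTheta * gT 1 * gTheta + gTheta * gT 1 * gTheta * gT 1
              - free_const (q - 1) * gTheta * gT 1 * gTheta" "k > 1"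
    using r unfolding dg_relators_def by (auto split: if_splits)
  then have "rep k q (diff_free Qs r) \<phi> z = 0" if z: "z \<in> generic_states k q" for \<phi> z
  proof cases
    case 1
    then have "r \<in> homogeneous 0" using affine_relators_free_span homogeneous_affine by blast
    then show ?thesis by (simp add: diff_free_homogeneous_0)
  next
    case 2
    then show ?thesis by (simp add: dsimps rep_diff rep_mult rep_gen rep_cyclotomic)
  next
    case 3
    then show ?thesis by (simp add: dsimps rep_diff rep_mult rep_gen rep_cyclotomic)
  next
    case 4
    then show ?thesis by (simp add: dsimps rep_diff rep_mult rep_gen rep_cyclotomic)
  next
    case 5
    then show ?thesis unfolding 5(1)
      by (simp add: dsimps rep_diff rep_mult rep_gen rep_cyclotomic) (simp add: algebra_simps)
  next
    case 6
    have "diff_free Qs r = gT 1 * (?P * (gT 1 * gTheta) - gTheta * (gT 1 * ?P))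
     + (?P * (gT 1 * (gTheta * gT 1)) - gTheta * (gT 1 * (?P * gT 1)))
     - free_const (q - 1) * (?P * (gT 1 * gTheta) - gTheta * (gT 1 * ?P))"
      unfolding 6(1) by (simp add: dsimps mult.assoc)
    then show ?thesis using rep_diff_theta_T_theta[OF z 6(2)] by simp
  qed
  then show "diff_free Qs r \<in> annihilator k q" by (simp add: annihilator_def)
qed

lemma dg_relators_homogeneous:
  assumes "r \<in> dg_relators k q"
  shows "\<exists>n. r \<in> homogeneous n"
proof -
  consider "r \<in> affine_relators k q" | "r = gTheta * gTheta"
    | i where "r = gX i * gTheta - gTheta * gX i"
    | i where "r = gXinv i * gTheta - gTheta * gXinv i"
    | i where "r = gT i * gTheta - gTheta * gT i"
    | "r = gT 1 * gTheta * gT 1 * gTheta + gTheta * gT 1 * gTheta * gT 1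
              - free_const (q - 1) * gTheta * gT 1 * gTheta"
    using assms unfolding dg_relators_def by (auto split: if_splits)
  then show ?thesis
  proof cases
    case 1
    then show ?thesis using affine_relators_free_span homogeneous_affine by blast
  next
    case 2
    have "gTheta * gTheta \<in> homogeneous (Suc 0 + Suc 0)"
      by (intro homogeneous_mult homogeneous_theta)
    then show ?thesis using 2 by blast
  next
    case 6
    let ?T = "gT 1 :: (hecke_gen, 'a) free_alg"
    have T: "?T \<in> homogeneous 0" by (simp add: homogeneous_gen)
    have TT: "?T * gTheta \<in> homogeneous 1" "gTheta * ?T \<in> homogeneous 1"
      using homogeneous_mult[OF T homogeneous_theta] homogeneous_mult[OF homogeneous_theta T]
      by (simp_all add: One_nat_def)
    have "(?T * gTheta) * (?T * gTheta) \<in> homogeneous 2" "(gTheta * ?T) * (gTheta * ?T) \<in> homogeneous 2"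
      using homogeneous_mult[OF TT(1) TT(1)] homogeneous_mult[OF TT(2) TT(2)] by (simp_all only: one_add_one)
    moreover have "free_const (q - 1) * ((gTheta * ?T) * gTheta) \<in> homogeneous 2"
      using homogeneous_mult[OF homogeneous_const homogeneous_mult[OF TT(2) homogeneous_theta]]
      by (simp add: eval_nat_numeral One_nat_def)
    ultimately have "r \<in> homogeneous 2"
      unfolding 6 by (simp add: mult.assoc homogeneous_add homogeneous_diff)
    then show ?thesis by blast
  next
    case (3 i)
    then have "r \<in> homogeneous (Suc 0)"
      using homogeneous_mult[OF homogeneous_gen[of "GenX i"] homogeneous_theta]
        homogeneous_mult[OF homogeneous_theta homogeneous_gen[of "GenX i"]]
      by (auto intro: homogeneous_diff)
    then show ?thesis by blast
  next
    case (4 i)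
    then have "r \<in> homogeneous (Suc 0)"
      using homogeneous_mult[OF homogeneous_gen[of "GenXinv i"] homogeneous_theta]
        homogeneous_mult[OF homogeneous_theta homogeneous_gen[of "GenXinv i"]]
      by (auto intro: homogeneous_diff)
    then show ?thesis by blast
  next
    case (5 i)
    then have "r \<in> homogeneous (Suc 0)"
      using homogeneous_mult[OF homogeneous_gen[of "GenT i"] homogeneous_theta]
        homogeneous_mult[OF homogeneous_theta homogeneous_gen[of "GenT i"]]
      by (auto intro: homogeneous_diff)
    then show ?thesis by blast
  qed
qed

text \<open>The relator being homogeneous, the Leibniz rule applies to it in the middle of u r v,
  and every resulting term contains r or its differential.\<close>

theorem diff_free_ideal:
  fixes q :: "'k::field"
  assumes inf: "infinite (UNIV :: 'k set)" and q: "q \<noteq> 0" and k: "k \<ge> 1"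
    and f: "f \<in> ideal_hull (dg_relators k q)"
  shows "diff_free Qs f \<in> ideal_hull (dg_relators k q)"
  using f
proof induction
  case (add r f u v)
  obtain n where n: "r \<in> homogeneous n" using dg_relators_homogeneous[OF add(1)] by blast
  have r: "r \<in> ideal_hull (dg_relators k q)" using add(1) by (rule ideal_hull_incl)
  have rv: "diff_free Qs (r * v) \<in> ideal_hull (dg_relators k q)"
    unfolding diff_free_mult[OF n] using diff_relator[OF inf q k add(1), of Qs] r
    by (intro ideal_hull_add ideal_hull_mult_left ideal_hull_mult_right)
  have "diff_free Qs (u * (r * v)) \<in> ideal_hull (dg_relators k q)"
  proof (induction u rule: free_alg_induct)
    case (word c u)
    then show ?case
      unfolding diff_free_word_mult using rv r
      by (intro ideal_hull_add ideal_hull_mult_left ideal_hull_mult_right)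
  qed (simp add: distrib_right diff_free_add ideal_hull_add)
  then show ?case using add by (simp add: diff_free_add mult.assoc ideal_hull_add)
qed (simp add: ideal_hull.zero)

section \<open>Acyclicity in positive degrees\<close>

text \<open>Projection to \<theta>-degree zero, which is also the ring homomorphism sending \<theta>
  to 0.\<close>

definition theta_free :: "(hecke_gen, 'k::field) free_alg \<Rightarrow> (hecke_gen, 'k) free_alg" where
  "theta_free = restrict_words (\<lambda>u. GenTheta \<notin> set u)"

lemma theta_free_0 [simp]: "theta_free 0 = 0"
  and theta_free_add: "theta_free (f + g) = theta_free f + theta_free g"
  and theta_free_diff: "theta_free (f - g) = theta_free f - theta_free g"
  and theta_free_sum: "theta_free (sum h I) = (\<Sum>i\<in>I. theta_free (h i))"
  and theta_free_free_span: "f \<in> free_span S \<Longrightarrow> theta_free f \<in> free_span S"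
  by (simp_all add: theta_free_def restrict_words_add restrict_words_diff restrict_words_uminus
      restrict_words_sum restrict_words_free_span)

lemma theta_free_mult: "theta_free (f * g) = theta_free f * theta_free g"
  unfolding theta_free_def by (rule restrict_words_mult) auto

lemma theta_free_homogeneous: "theta_free f \<in> homogeneous 0"
  by (auto simp: theta_free_def homogeneous_def in_keys_iff lookup_restrict_words when_def
      count_list_0_iff split: if_splits)

lemma theta_free_ident: "f \<in> homogeneous 0 \<Longrightarrow> theta_free f = f"
  unfolding theta_free_def homogeneous_def by (rule restrict_words_ident) (simp add: count_list_0_iff)

lemma theta_free_idem: "theta_free (theta_free f) = theta_free f"
  by (rule theta_free_ident[OF theta_free_homogeneous])

lemma theta_free_theta [simp]: "theta_free gTheta = 0"
  by (simp add: theta_free_def free_gen_def restrict_words_word_term)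

lemma theta_free_affine_span:
  "f \<in> free_span (dgens k) \<Longrightarrow> theta_free f \<in> free_span (affine_gens k)"
  by (fastforce simp: theta_free_def free_span_def in_keys_iff lookup_restrict_words when_def
      dgens_def dg_gens_def split: if_splits)

lemma theta_free_relator:
  assumes "r \<in> dg_relators k q"
  shows "theta_free r = 0 \<or> theta_free r \<in> affine_relators k q"
proof (cases "r \<in> affine_relators k q")
  case True
  then have "r \<in> homogeneous 0" using affine_relators_free_span homogeneous_affine by blast
  then show ?thesis using True by (simp add: theta_free_ident)
next
  case False
  then show ?thesis using assms unfolding dg_relators_def
    by (auto simp: theta_free_mult theta_free_diff theta_free_add split: if_splits)
qed

text \<open>Setting \<theta> to 0 either fixes a relator as an affine one or kills it. Hence the
  affine Hecke algebra embeds as the part of degree zero.\<close>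

lemma theta_free_ideal_affine:
  "f \<in> ideal_hull (dg_relators k q) \<Longrightarrow> theta_free f \<in> ideal_hull (affine_relators k q)"
proof (induction rule: ideal_hull.induct)
  case (add r f u v)
  then have "theta_free r \<in> ideal_hull (affine_relators k q)"
    using theta_free_relator[OF add(1)] ideal_hull_incl ideal_hull.zero by metis
  then show ?case using add
    by (simp add: theta_free_add theta_free_mult ideal_hull_add ideal_hull_mult_left ideal_hull_mult_right)
qed (simp add: ideal_hull.zero)

lemma affine_ideal_subset: "ideal_hull (affine_relators k q) \<subseteq> ideal_hull (dg_relators k q)"
  by (rule ideal_hull_subset) (auto simp: dg_relators_def intro: ideal_hull_incl)

lemma theta_free_ideal:
  "f \<in> ideal_hull (dg_relators k q) \<Longrightarrow> theta_free f \<in> ideal_hull (dg_relators k q)"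
  using theta_free_ideal_affine affine_ideal_subset by blast

text \<open>The witness is the component of \<theta>-degree one: words with fewer \<theta> have
  differential zero, words with more have a differential without degree-zero part.\<close>

lemma theta_free_diff_free:
  fixes f :: "(hecke_gen, 'k::field) free_alg"
  assumes "f \<in> free_span S"
  shows "\<exists>g\<in>free_span S. theta_free (diff_free Qs f) = diff_free Qs g"
  using assms
proof (induction f rule: free_span_induct)
  case (word c u)
  consider "theta_count u = 0" | "theta_count u = 1" | "theta_count u \<ge> 2" by linarith
  then show ?case
  proof cases
    case 1
    then have "diff_free Qs (word_term u c) = 0"
      by (intro diff_free_homogeneous_0 homogeneous_word_term)
    then show ?thesis by (intro bexI[of _ 0]) auto
  next
    case 2
    have "diff_word Qs v \<in> homogeneous 0" if "theta_count v = 1" for v :: "hecke_gen list"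
      using that
    proof (induction v)
      case (Cons g v)
      then show ?case
        using homogeneous_mult[OF cyclotomic_homogeneous homogeneous_word_term[of v 0 1]]
          homogeneous_mult[OF homogeneous_gen[of g] Cons.IH]
          diff_free_homogeneous_0[OF homogeneous_word_term[of v 0 1], of Qs]
        by (auto simp: diff_free_word_term split: if_splits)
    qed simp
    from this[OF 2] have "theta_free (diff_free Qs (word_term u c)) = diff_free Qs (word_term u c)"
      using homogeneous_mult[OF homogeneous_const] by (intro theta_free_ident) (fastforce simp: diff_free_word_term)
    then show ?thesis using word by (intro bexI[of _ "word_term u c"]) (auto intro: free_span_word_term)
  next
    case 3
    have "theta_free (diff_word Qs v) = 0" if "theta_count v \<ge> 2" for v :: "hecke_gen list"
      using that
    proof (induction v)
      case (Cons g v)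
      have "theta_free (word_term v (1 :: 'k)) = 0" if "theta_count v \<ge> 1"
        using that count_list_0_iff[of v GenTheta]
        by (auto simp: theta_free_def restrict_words_word_term)
      then show ?case using Cons by (auto simp: theta_free_diff theta_free_mult)
    qed simp
    then have "theta_free (diff_free Qs (word_term u c)) = 0"
      using 3 by (simp add: diff_free_word_term theta_free_mult)
    then show ?thesis by (intro bexI[of _ 0]) auto
  qed
next
  case (add f g)
  then obtain f' g' where "f' \<in> free_span S" "g' \<in> free_span S"
    "theta_free (diff_free Qs f) = diff_free Qs f'" "theta_free (diff_free Qs g) = diff_free Qs g'" by blast
  then show ?case
    by (intro bexI[of _ "f' + g'"]) (auto simp: diff_free_add theta_free_add free_span_add)
qed

section \<open>Coefficientwise operations on normal forms\<close>

definition coeff_map :: "('a::zero \<Rightarrow> 'b::zero) \<Rightarrow> (int \<Rightarrow>\<^sub>0 'a) \<Rightarrow> int \<Rightarrow>\<^sub>0 'b" where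
  "coeff_map h p = Poly_Mapping.mapp (\<lambda>_. h) p"

lemma lookup_coeff_map:
  "h 0 = 0 \<Longrightarrow> Poly_Mapping.lookup (coeff_map h p) a = h (Poly_Mapping.lookup p a)"
  by (auto simp: coeff_map_def lookup_mapp in_keys_iff when_def)

lemma laurent_coeff_map:
  assumes "h 0 = 0"
  shows "laurent k (coeff_map h p) = (\<Sum>a\<in>Poly_Mapping.keys p. Xpow k a * h (Poly_Mapping.lookup p a))"
proof -
  have "Poly_Mapping.keys (coeff_map h p) \<subseteq> Poly_Mapping.keys p"
    unfolding coeff_map_def by (rule keys_mapp_subset)
  then show ?thesis unfolding laurent_def
    by (intro sum.mono_neutral_cong_left) (auto simp: lookup_coeff_map[of h, OF assms] in_keys_iff assms)
qed

lemma coeff_set_coeff_map: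
  assumes "p \<in> coeff_set G UNIV" "h 0 = 0" "\<And>x. x \<in> free_span G \<Longrightarrow> h x \<in> free_span G'"
  shows "coeff_map h p \<in> coeff_set G' UNIV"
  using assms by (auto simp: coeff_set_def lookup_coeff_map)

lemma Xpow_homogeneous: "Xpow k a \<in> homogeneous 0"
proof -
  have "x ^ n \<in> homogeneous 0" if "x \<in> homogeneous 0" for x :: "(hecke_gen, 'a) free_alg" and n
    using that homogeneous_mult[of x 0 _ 0] homogeneous_const[of 1] by (induction n) auto
  then show ?thesis by (simp add: Xpow_def homogeneous_gen)
qed

lemma diff_free_laurent: "diff_free Qs (laurent k p) = laurent k (coeff_map (diff_free Qs) p)"
  by (simp add: laurent_coeff_map) (simp add: laurent_def diff_free_sum diff_free_mult_0[OF Xpow_homogeneous])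

lemma theta_free_laurent: "theta_free (laurent k p) = laurent k (coeff_map theta_free p)"
  by (simp add: laurent_coeff_map)
    (simp add: laurent_def theta_free_sum theta_free_mult theta_free_ident[OF Xpow_homogeneous])

lemma gS_homogeneous: "gS q i \<in> homogeneous 0"
  unfolding gS_def
  using homogeneous_mult[OF homogeneous_const homogeneous_diff[OF homogeneous_gen homogeneous_const]]
  by fastforce

lemma Sword_homogeneous: "Sword q m k \<in> homogeneous 0"
proof (induction "k - m" arbitrary: m)
  case 0
  then show ?case using homogeneous_const[of 1] by simp
next
  case (Suc n)
  then show ?case using homogeneous_mult[OF gS_homogeneous, of "Sword q (Suc m) k" 0 q m]
    by (simp add: Sword_rec)
qed

lemma Tword_homogeneous: "Tword j \<in> homogeneous 0"
proof (induction j)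
  case 0
  then show ?case using homogeneous_const[of 1] by simp
next
  case (Suc j)
  then show ?case using homogeneous_mult[OF homogeneous_gen[of "GenT (Suc j)"], of "Tword j" 0] by simp
qed


context hecke_pos
begin

abbreviation J where "J \<equiv> ideal_hull (dg_relators k q)"
abbreviation J' where "J' \<equiv> ideal_hull (dg_relators (k - 1) q)"

lemma J'_subset: "x \<in> J' \<Longrightarrow> x \<in> J"
proof -
  have "J' \<subseteq> J"
    using dg_relators_mono[of "k - 1" k q] by (intro ideal_hull_subset) (auto intro: ideal_hull_incl)
  then show "x \<in> J' \<Longrightarrow> x \<in> J" by blast
qed

text \<open>The part of the differential of \<open>vcomb r\<close> in which \<theta> itself is
  differentiated.\<close>

definition wcomb :: "'k list \<Rightarrow> (nat \<Rightarrow> int \<Rightarrow>\<^sub>0 (hecke_gen, 'k) free_alg) \<Rightarrow> (hecke_gen, 'k) free_alg" where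
  "wcomb Qs r = (\<Sum>j<k. Tword j * (cyclotomic Qs (gX 1) * (Sw 1 * laurent k (r j))))"

lemma diff_free_ucomb: "diff_free Qs (ucomb p) = ucomb (\<lambda>j. coeff_map (diff_free Qs) (p j))"
  by (simp add: ucomb_def diff_free_sum diff_free_mult_0[OF Sword_homogeneous] diff_free_laurent)

lemma diff_free_vcomb:
  "diff_free Qs (vcomb r) = wcomb Qs r - vcomb (\<lambda>j. coeff_map (diff_free Qs) (r j))"
  by (simp add: vcomb_def wcomb_def diff_free_sum diff_free_mult_0[OF Tword_homogeneous]
      diff_free_theta_mult diff_free_mult_0[OF Sword_homogeneous] diff_free_laurent
      right_diff_distrib sum_subtractf)

lemma theta_free_ucomb: "theta_free (ucomb p) = ucomb (\<lambda>j. coeff_map theta_free (p j))"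
  by (simp add: ucomb_def theta_free_sum theta_free_mult theta_free_ident[OF Sword_homogeneous]
      theta_free_laurent)

lemma theta_free_vcomb: "theta_free (vcomb r) = 0"
  by (simp add: vcomb_def theta_free_sum theta_free_mult)

lemma ucomb_in_J:
  assumes "\<And>j m. j < k \<Longrightarrow> Poly_Mapping.lookup (p j) m \<in> J"
  shows "ucomb p \<in> J" "vcomb p \<in> J"
  unfolding ucomb_def vcomb_def laurent_def
  by (intro ideal_hull_sum ideal_hull_mult_left assms; simp)+

lemma ucomb_cong:
  assumes "\<And>j m. j < k \<Longrightarrow> Poly_Mapping.lookup (p j) m - Poly_Mapping.lookup (r j) m \<in> J'"
  shows "ucomb p \<doteq> ucomb r" "vcomb p \<doteq> vcomb r"
proof -
  have "Poly_Mapping.lookup (p j + - r j) m \<in> J" if "j < k" for j m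
    using J'_subset[OF assms[OF that, of m]] by (simp add: lookup_minus)
  then have "ucomb (\<lambda>j. p j + - r j) \<in> J" "vcomb (\<lambda>j. p j + - r j) \<in> J"
    using ucomb_in_J[of "\<lambda>j. p j + - r j"] by simp_all
  then show "ucomb p \<doteq> ucomb r" "vcomb p \<doteq> vcomb r"
    by (simp_all only: ucomb_add vcomb_add ucomb_uminus vcomb_uminus cong_ideal_def) simp_all
qed

lemma ucomb_laurent:
  assumes "\<And>i. p i \<in> coeff_set A1 UNIV"
  shows "ucomb p * laurent k r \<doteq> ucomb (\<lambda>i. p i * r)"
  unfolding ucomb_def sum_distrib_right mult.assoc
  using assms by (intro cong_ideal_sum rewrite_right laurent_mult) (auto simp: coeff_set_def)

lemma ucomb_sum: "ucomb (\<lambda>i. \<Sum>j\<in>I. p j i) = (\<Sum>j\<in>I. ucomb (p j))"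
  by (induction I rule: infinite_finite_induct) (simp_all add: ucomb_add)

text \<open>\<open>w\<close> is chosen before \<open>r\<close>: in terms of coefficients the map is
  one matrix, X_k to the power l on the diagonal plus entries of lower degree without
  \<theta>.\<close>

lemma wcomb_ucomb:
  "\<exists>w. (\<forall>j i. w j i \<in> coeff_set A0 {..<int (length Qs)}) \<and>
    (\<forall>r. wcomb Qs r \<doteq> ucomb (\<lambda>i. Poly_Mapping.single (int (length Qs)) 1 * r i + (\<Sum>j<k. w j i * r j)))"
proof -
  define l where "l = int (length Qs)"
  let ?P = "\<lambda>j w. (\<forall>i. w i \<in> coeff_set A0 {..<l}) \<and>
    (j < k \<longrightarrow> Tword j * (cyclotomic Qs (gX 1) * Sw 1) \<doteq> Sw (Suc j) * Xpow k l + ucomb w)"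
  have "\<exists>w. ?P j w" for j
  proof (cases "j < k")
    case True
    then show ?thesis using boundary_leading_term[of j Qs] by (auto simp: l_def)
  next
    case False
    then show ?thesis by (intro exI[of _ "\<lambda>i. 0"]) auto
  qed
  then obtain w where w: "\<And>j. ?P j (w j)" by metis
  have w1: "w j i \<in> coeff_set A1 UNIV" for j i
    using w[of j] affine_gens_dgens by (auto intro: coeff_set_mono)
  have "wcomb Qs r \<doteq> ucomb (\<lambda>i. Poly_Mapping.single l 1 * r i + (\<Sum>j<k. w j i * r j))" for r
  proof -
    let ?L = "\<lambda>j. laurent k (r j)"
    have "wcomb Qs r = (\<Sum>j<k. Tword j * (cyclotomic Qs (gX 1) * Sw 1) * ?L j)"
      by (simp add: wcomb_def mult.assoc)
    also have "\<dots> \<doteq> (\<Sum>j<k. (Sw (Suc j) * Xpow k l + ucomb (w j)) * ?L j)"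
      using w by (intro cong_ideal_sum rewrite_left) auto
    also have "\<dots> = (\<Sum>j<k. Sw (Suc j) * (laurent k (Poly_Mapping.single l 1) * ?L j) + ucomb (w j) * ?L j)"
      by (simp add: algebra_simps laurent_single)
    also have "\<dots> \<doteq> (\<Sum>j<k. Sw (Suc j) * laurent k (Poly_Mapping.single l 1 * r j) + ucomb (\<lambda>i. w j i * r j))"
      by (intro cong_ideal_sum cong_ideal_add rewrite_right laurent_mult ucomb_laurent w1)
        (simp add: lookup_single when_def)
    also have "\<dots> = ucomb (\<lambda>i. Poly_Mapping.single l 1 * r i + (\<Sum>j<k. w j i * r j))"
      by (simp add: ucomb_add ucomb_sum sum.distrib) (simp add: ucomb_def)
    finally show ?thesis .
  qed
  then show ?thesis using w by (intro exI[of _ w]) (auto simp: l_def)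
qed

lemma choose_coefficients:
  assumes "\<And>j m. j < k \<Longrightarrow>
    \<exists>g\<in>free_span A1. theta_free g = 0 \<and> Poly_Mapping.lookup (p j) m - diff_free Qs g \<in> J'"
  shows "\<exists>s. (\<forall>j. s j \<in> coeff_set A1 UNIV) \<and> (\<forall>j m. theta_free (Poly_Mapping.lookup (s j) m) = 0) \<and>
    (\<forall>j<k. \<forall>m. Poly_Mapping.lookup (p j) m - diff_free Qs (Poly_Mapping.lookup (s j) m) \<in> J')"
proof -
  have "\<exists>g. g \<in> free_span A1 \<and> theta_free g = 0 \<and>
      (j < k \<longrightarrow> Poly_Mapping.lookup (p j) m - diff_free Qs g \<in> J')" for j m
    using assms[of j m] by (cases "j < k") (auto intro: exI[of _ 0])
  then obtain g where g: "\<And>j m. g j m \<in> free_span A1" "\<And>j m. theta_free (g j m) = 0"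
    "\<And>j m. j < k \<Longrightarrow> Poly_Mapping.lookup (p j) m - diff_free Qs (g j m) \<in> J'"
    by metis
  define s where "s = (\<lambda>j. \<Sum>m\<in>Poly_Mapping.keys (p j). Poly_Mapping.single m (g j m))"
  have s: "Poly_Mapping.lookup (s j) m = (if m \<in> Poly_Mapping.keys (p j) then g j m else 0)" for j m
    by (simp add: s_def lookup_sum lookup_single when_def)
  show ?thesis
  proof (intro exI[of _ s] conjI allI impI)
    show "s j \<in> coeff_set A1 UNIV" for j using g(1) s by (auto simp: coeff_set_def)
    show "theta_free (Poly_Mapping.lookup (s j) m) = 0" for j m using g(2) s by auto
    show "Poly_Mapping.lookup (p j) m - diff_free Qs (Poly_Mapping.lookup (s j) m) \<in> J'"
      if "j < k" for j m
      using g(3)[OF that] s ideal_hull.zero by (auto simp: in_keys_iff)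
  qed
qed

text \<open>
  A cycle is written as \<open>\<Sum> S\<^sub>j c(p\<^sub>j) + \<Sum> T\<^sub>j \<theta> S c(r\<^sub>j)\<close>. Independence makes the coefficients of
  the \<open>r\<^sub>j\<close> cycles of the smaller algebra. Their components of positive degree are boundaries by
  induction, those of degree zero by the triangularity of the leading coefficients.
\<close>

lemma coefficients_boundary:
  assumes inf: "infinite (UNIV :: 'k set)"
    and IH: "\<And>f. f \<in> free_span A1 \<Longrightarrow> theta_free f = 0 \<Longrightarrow> diff_free Qs f \<in> J' \<Longrightarrow>
      \<exists>g\<in>free_span A1. f - diff_free Qs g \<in> J'"
    and coeffs: "\<And>j. p j \<in> coeff_set A1 UNIV" "\<And>j. r j \<in> coeff_set A1 UNIV"
    and cycle: "diff_free Qs (ucomb p + vcomb r) \<in> J"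
    and j: "j < k"
  shows "\<exists>g\<in>free_span A1. Poly_Mapping.lookup (r j) m - diff_free Qs g \<in> J'"
proof -
  define l where "l = int (length Qs)"
  let ?D = "diff_free Qs"
  obtain w where w: "\<And>j i. w j i \<in> coeff_set A0 {..<l}"
    "\<And>r. wcomb Qs r \<doteq> ucomb (\<lambda>i. Poly_Mapping.single l 1 * r i + (\<Sum>j<k. w j i * r j))"
    using wcomb_ucomb[of Qs] by (auto simp: l_def)
  define W where "W = (\<lambda>r i. Poly_Mapping.single l 1 * r i + (\<Sum>j<k. w j i * r j))"
  have lookup_W: "Poly_Mapping.lookup (W r i) m = Poly_Mapping.lookup (r i) (m - l) +
      (\<Sum>j<k. \<Sum>a\<in>Poly_Mapping.keys (w j i).
        Poly_Mapping.lookup (w j i) a * Poly_Mapping.lookup (r j) (m - a))" for r i m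
    by (simp add: W_def lookup_add lookup_sum lookup_mult_int)
  have DA: "?D x \<in> free_span A1" if "x \<in> free_span A1" for x
    using that by (rule diff_free_free_span)
  have w1: "w j i \<in> coeff_set A1 UNIV" for j i
    using w(1)[of j i] affine_gens_dgens by (auto intro: coeff_set_mono)
  have W1: "W r i \<in> coeff_set A1 UNIV" for i
    unfolding W_def using w1 coeffs
    by (intro coeff_set_add coeff_set_sum coeff_set_mult[of _ _ UNIV _ UNIV] coeff_set_single) auto
  have "?D (ucomb p + vcomb r)
      = ucomb (\<lambda>j. coeff_map ?D (p j)) + wcomb Qs r + - vcomb (\<lambda>j. coeff_map ?D (r j))"
    by (simp add: diff_free_add diff_free_ucomb diff_free_vcomb)
  also have "\<dots> \<doteq> ucomb (\<lambda>j. coeff_map ?D (p j)) + ucomb (W r) + - vcomb (\<lambda>j. coeff_map ?D (r j))"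
    using w(2)[of r] by (intro cong_ideal_add cong_ideal_refl) (simp add: W_def)
  also have "\<dots> = ucomb (\<lambda>j. coeff_map ?D (p j) + W r j) + vcomb (\<lambda>j. - coeff_map ?D (r j))"
    by (simp add: ucomb_add vcomb_uminus)
  finally have J: "ucomb (\<lambda>j. coeff_map ?D (p j) + W r j) + vcomb (\<lambda>j. - coeff_map ?D (r j)) \<in> J"
    using cycle cong_ideal_mem_iff by blast
  have D_coeffs: "coeff_map ?D s \<in> coeff_set A1 UNIV" if "s \<in> coeff_set A1 UNIV" for s
    by (rule coeff_set_coeff_map[OF that]) (simp_all add: DA)
  have c: "coeff_map ?D (p j) + W r j \<in> coeff_set A1 UNIV" "- coeff_map ?D (r j) \<in> coeff_set A1 UNIV" for j
    by (auto intro: coeff_set_add coeff_set_uminus W1 D_coeffs coeffs)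
  \<comment> \<open>The components with \<theta> show that the coefficients of \<open>r\<close> are
    cycles; those without \<theta> give the linear system used below.\<close>
  note indep = independence[OF inf c J]
  have Dr: "?D (Poly_Mapping.lookup (r j) m) \<in> J'" if "j < k" for j m
    using ideal_hull_uminus[OF indep(2)[OF that]] by (simp add: lookup_coeff_map)
  \<comment> \<open>Elements of the smaller algebra that are boundaries modulo its ideal.
    \<open>B\<close> is additive and stable under left multiplication by elements without \<theta>,
    enough to solve the triangular system.\<close>
  define B where "B = {x. \<exists>g\<in>free_span A1. x - ?D g \<in> J'}"
  have B_J': "x \<in> B" if "x \<in> J'" for x
    unfolding B_def using that by (intro CollectI bexI[of _ 0]) auto
  have B_D: "?D g \<in> B" if "g \<in> free_span A1" for g
    unfolding B_def using that ideal_hull.zero by (intro CollectI bexI[of _ g]) auto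
  have B_add: "x + y \<in> B" if "x \<in> B" "y \<in> B" for x y
  proof -
    from that obtain g h where gh: "g \<in> free_span A1" "h \<in> free_span A1" "x - ?D g \<in> J'" "y - ?D h \<in> J'"
      unfolding B_def by blast
    have "x + y - ?D (g + h) = (x - ?D g) + (y - ?D h)" by (simp add: diff_free_add)
    also have "\<dots> \<in> J'" by (rule ideal_hull_add[OF gh(3,4)])
    finally show ?thesis using gh unfolding B_def
      by (intro CollectI bexI[of _ "g + h"]) (auto simp: free_span_add)
  qed
  have B_mult: "h * x \<in> B" if "x \<in> B" "h \<in> free_span A0" for x h
  proof -
    from that obtain g where g: "g \<in> free_span A1" "x - ?D g \<in> J'" unfolding B_def by blast
    have h: "h \<in> free_span A1" using that(2) free_span_mono[OF affine_gens_dgens] by blast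
    have "h * x - ?D (h * g) = h * (x - ?D g)"
      by (simp add: diff_free_mult_0[OF homogeneous_affine[OF that(2)]] algebra_simps)
    also have "\<dots> \<in> J'" by (rule ideal_hull_mult_left[OF g(2)])
    finally show ?thesis using g h unfolding B_def
      by (intro CollectI bexI[of _ "h * g"]) (auto simp: free_span_mult)
  qed
  have B_sum: "(\<And>i. i \<in> I \<Longrightarrow> h i \<in> B) \<Longrightarrow> sum h I \<in> B" for I :: "'i set" and h
    by (induction I rule: infinite_finite_induct) (auto intro: B_add B_J' ideal_hull.zero)
  have B_uminus: "- x \<in> B" if "x \<in> B" for x
    using B_mult[OF that free_span_const, of "- 1"] by (simp add: free_const_uminus)
  have B_cong: "x \<in> B" if "x + y \<in> J'" "y \<in> B" for x y
    using B_add[OF B_J'[OF that(1)] B_uminus[OF that(2)]] by simp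
  define \<rho> where "\<rho> = (\<lambda>j m. theta_free (Poly_Mapping.lookup (r j) m))"
  have rA: "Poly_Mapping.lookup (r j) m \<in> free_span A1" for j m
    using coeffs(2)[of j] by (simp add: coeff_set_def)
  \<comment> \<open>Degree-zero part of the components without \<theta>. The entries of
    \<open>w\<close> are unaffected, and the contribution of \<open>p\<close> becomes a
    boundary.\<close>
  have W0: "\<rho> i (m - l) + (\<Sum>j<k. \<Sum>a\<in>Poly_Mapping.keys (w j i). Poly_Mapping.lookup (w j i) a * \<rho> j (m - a)) \<in> B"
    if "i < k" for i m
  proof -
    have wi: "theta_free (Poly_Mapping.lookup (w j i) a) = Poly_Mapping.lookup (w j i) a" for j a
      using w(1)[of j i] by (intro theta_free_ident homogeneous_affine) (auto simp: coeff_set_def)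
    have e1: "theta_free (Poly_Mapping.lookup (coeff_map ?D (p i) + W r i) m) \<in> J'"
      by (rule theta_free_ideal[OF indep(1)[OF that]])
    have e2: "theta_free (Poly_Mapping.lookup (coeff_map ?D (p i) + W r i) m)
      = (\<rho> i (m - l) + (\<Sum>j<k. \<Sum>a\<in>Poly_Mapping.keys (w j i). Poly_Mapping.lookup (w j i) a * \<rho> j (m - a)))
        + theta_free (?D (Poly_Mapping.lookup (p i) m))"
      by (simp add: lookup_add lookup_coeff_map theta_free_add lookup_W theta_free_sum theta_free_mult
          wi \<rho>_def)
    have e3: "theta_free (?D (Poly_Mapping.lookup (p i) m)) \<in> B"
      using theta_free_diff_free[of "Poly_Mapping.lookup (p i) m" A1 Qs] coeffs(1)[of i] B_D
      by (auto simp: coeff_set_def)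
    show ?thesis by (rule B_cong[OF e1[unfolded e2] e3])
  qed
  \<comment> \<open>Descending induction on the exponent, starting above all exponents of
    \<open>r\<close>. At exponent a + l the system isolates \<open>\<rho> i a\<close>, since b < l
    makes every other exponent a + l - b exceed a.\<close>
  have \<rho>_B: "\<rho> i a \<in> B" if "i < k" for i a
  proof -
    define K where "K = (\<Union>j<k. Poly_Mapping.keys (r j))"
    have K: "finite K" by (simp add: K_def)
    obtain N where N: "\<And>a. a \<in> K \<Longrightarrow> a \<le> N"
      using Max_ge[OF K] by blast
    show ?thesis using that
    proof (induction "nat (N + 1 - a)" arbitrary: a i rule: less_induct)
      case less
      show ?case
      proof (cases "a > N")
        case True
        then have "a \<notin> Poly_Mapping.keys (r i)" using N less.prems by (force simp: K_def)
        then show ?thesis by (simp add: \<rho>_def in_keys_iff B_J' ideal_hull.zero)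
      next
        case False
        have "(\<Sum>j<k. \<Sum>b\<in>Poly_Mapping.keys (w j i). Poly_Mapping.lookup (w j i) b * \<rho> j (a + l - b)) \<in> B"
        proof (intro B_sum B_mult)
          fix j b assume j: "j \<in> {..<k}" and b: "b \<in> Poly_Mapping.keys (w j i)"
          then have "b < l" using w(1)[of j i] by (auto simp: coeff_set_def)
          then show "\<rho> j (a + l - b) \<in> B" using j False by (intro less.hyps) auto
          show "Poly_Mapping.lookup (w j i) b \<in> free_span A0" using w(1)[of j i] by (simp add: coeff_set_def)
        qed
        from B_uminus[OF this] B_add[OF W0[OF less.prems, of "a + l"]] show ?thesis by fastforce
      qed
    qed
  qed
  let ?x = "Poly_Mapping.lookup (r j) m"
  \<comment> \<open>The remainder has no degree-zero part and is still a cycle, because the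
    differential kills degree zero; so the induction hypothesis applies.\<close>
  have "?x - \<rho> j m \<in> B"
    unfolding B_def
  proof (intro CollectI IH)
    show "?x - \<rho> j m \<in> free_span A1" using rA by (simp add: \<rho>_def free_span_diff theta_free_free_span)
    show "theta_free (?x - \<rho> j m) = 0" by (simp add: \<rho>_def theta_free_diff theta_free_idem)
    show "?D (?x - \<rho> j m) \<in> J'"
      using Dr[OF j] by (simp add: diff_free_diff \<rho>_def diff_free_homogeneous_0[OF theta_free_homogeneous])
  qed
  from B_add[OF this \<rho>_B[OF j, of m]] have "?x \<in> B" by simp
  then show ?thesis by (simp add: B_def)
qed

lemma ucomb_free_span:
  assumes "\<And>j. p j \<in> coeff_set A1 UNIV"
  shows "ucomb p \<in> free_span (dgens k)" "vcomb p \<in> free_span (dgens k)"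
proof -
  have G: "insert (GenX k) (insert (GenXinv k) A1) \<subseteq> dgens k"
    using k_pos by (auto simp: dgens_def dg_gens_def affine_gens_def split: if_splits)
  then have L: "laurent k (p j) \<in> free_span (dgens k)" for j
    using laurent_free_span[OF assms[of j]] free_span_mono by blast
  have T: "GenT i \<in> dgens k" if "1 \<le> i" "i < k" for i
    using that affine_gens_dgens[of k] by (auto simp: GenT_in)
  have S: "Sw m \<in> free_span (dgens k)" if "1 \<le> m" for m
    using that
  proof (induction "k - m" arbitrary: m)
    case (Suc n)
    then have "m < k" "S m \<in> free_span (dgens k)" using T by (auto intro: gS_free_span)
    moreover have "Sw (Suc m) \<in> free_span (dgens k)" using Suc by auto
    ultimately show ?case by (simp add: Sword_rec free_span_mult)
  qed simp
  have Tw: "(Tword j :: (hecke_gen, 'k) free_alg) \<in> free_span (dgens k)" if "j < k" for j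
    using that by (induction j) (auto intro!: free_span_mult T)
  have "GenTheta \<in> dgens k" using k_pos by (rule GenTheta_in)
  then show "ucomb p \<in> free_span (dgens k)" "vcomb p \<in> free_span (dgens k)"
    unfolding ucomb_def vcomb_def by (auto intro!: free_span_sum free_span_mult L S Tw)
qed

text \<open>The coefficients with \<theta> are boundaries of some \<open>\<rho>\<close>, so adding
  the differential of \<open>vcomb \<rho>\<close> removes them. The coefficients then left are
  cycles without degree-zero part, hence boundaries of some \<open>\<sigma>\<close>.\<close>

lemma acyclic_step:
  assumes inf: "infinite (UNIV :: 'k set)"
    and IH: "\<And>f. f \<in> free_span A1 \<Longrightarrow> theta_free f = 0 \<Longrightarrow> diff_free Qs f \<in> J' \<Longrightarrow>
      \<exists>g\<in>free_span A1. f - diff_free Qs g \<in> J'"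
    and f: "f \<in> free_span (dgens k)" "theta_free f = 0" "diff_free Qs f \<in> J"
  shows "\<exists>g\<in>free_span (dgens k). f - diff_free Qs g \<in> J"
proof -
  let ?D = "diff_free Qs"
  have D_J: "?D x \<in> J" if "x \<in> J" for x
    using that by (rule diff_free_ideal[OF inf q_nz k_pos])
  have D_cong: "?D x \<doteq> ?D y" if "x \<doteq> y" for x y
    using D_J that by (simp add: cong_ideal_def flip: diff_free_diff)
  \<comment> \<open>A preimage may be stripped of its degree-zero part, which the differential
    kills. This keeps the later coefficients \<open>p'\<close> free of degree zero.\<close>
  have IH0: "\<exists>g\<in>free_span A1. theta_free g = 0 \<and> x - ?D g \<in> J'"
    if "\<exists>g\<in>free_span A1. x - ?D g \<in> J'" for x
  proof -
    from that obtain g where "g \<in> free_span A1" "x - ?D g \<in> J'" by blast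
    then show ?thesis
      by (intro bexI[of _ "g - theta_free g"])
        (auto simp: theta_free_diff theta_free_idem diff_free_diff free_span_diff theta_free_free_span
          diff_free_homogeneous_0[OF theta_free_homogeneous])
  qed
  obtain p0 r where pr: "\<And>j. p0 j \<in> coeff_set A1 UNIV" "\<And>j. r j \<in> coeff_set A1 UNIV"
    "f \<doteq> ucomb p0 + vcomb r"
    using spanning[OF f(1)] by blast
  \<comment> \<open>As \<open>f\<close> has no degree-zero part, the degree-zero part of the normal
    form lies in the ideal and can be discarded.\<close>
  define p where "p = (\<lambda>j. p0 j + - coeff_map theta_free (p0 j))"
  have p: "p j \<in> coeff_set A1 UNIV" for j
    unfolding p_def by (intro coeff_set_add coeff_set_uminus coeff_set_coeff_map pr(1)) (auto intro: theta_free_free_span pr(1))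
  have p0: "theta_free (Poly_Mapping.lookup (p j) m) = 0" for j m
    by (simp add: p_def lookup_minus lookup_coeff_map theta_free_diff theta_free_idem)
  have f_eq: "f \<doteq> ucomb p + vcomb r"
  proof -
    have "theta_free (f - (ucomb p0 + vcomb r)) \<in> J"
      using pr(3) unfolding cong_ideal_def by (rule theta_free_ideal)
    then have "ucomb (\<lambda>j. coeff_map theta_free (p0 j)) \<in> J"
      using f(2) ideal_hull_uminus[of "- ucomb (\<lambda>j. coeff_map theta_free (p0 j))"]
      by (simp add: theta_free_diff theta_free_add theta_free_ucomb theta_free_vcomb)
    with pr(3) have "f - (ucomb p0 + vcomb r) + ucomb (\<lambda>j. coeff_map theta_free (p0 j)) \<in> J"
      unfolding cong_ideal_def by (intro ideal_hull_add)
    moreover have up: "ucomb p = ucomb p0 - ucomb (\<lambda>j. coeff_map theta_free (p0 j))"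
      using ucomb_add[of p0 "\<lambda>j. - coeff_map theta_free (p0 j)"]
        ucomb_uminus[of "\<lambda>j. coeff_map theta_free (p0 j)"]
      by (simp add: p_def)
    ultimately show ?thesis unfolding cong_ideal_def up by (simp add: algebra_simps)
  qed
  have cycle: "?D (ucomb p + vcomb r) \<in> J"
    using cong_ideal_mem_iff[OF D_cong[OF f_eq]] f(3) by simp
  have bd: "\<exists>g\<in>free_span A1. Poly_Mapping.lookup (r j) m - ?D g \<in> J'" if "j < k" for j m
    by (rule coefficients_boundary[OF inf IH p pr(2) cycle that])
  obtain \<rho> where \<rho>: "\<And>j. \<rho> j \<in> coeff_set A1 UNIV"
    "\<And>j m. theta_free (Poly_Mapping.lookup (\<rho> j) m) = 0"
    "\<And>j m. j < k \<Longrightarrow> Poly_Mapping.lookup (r j) m - ?D (Poly_Mapping.lookup (\<rho> j) m) \<in> J'"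
    using choose_coefficients[of r Qs, OF IH0[OF bd]] by metis
  obtain w where w: "\<And>j i. w j i \<in> coeff_set A0 {..<int (length Qs)}"
    "\<And>r. wcomb Qs r \<doteq> ucomb (\<lambda>i. Poly_Mapping.single (int (length Qs)) 1 * r i + (\<Sum>j<k. w j i * r j))"
    using wcomb_ucomb[of Qs] by auto
  define p' where "p' = (\<lambda>i. p i + (Poly_Mapping.single (int (length Qs)) 1 * \<rho> i + (\<Sum>j<k. w j i * \<rho> j)))"
  have w1: "w j i \<in> coeff_set A1 UNIV" for j i
    using w(1)[of j i] affine_gens_dgens by (auto intro: coeff_set_mono)
  have p': "p' i \<in> coeff_set A1 UNIV" for i
    unfolding p'_def using w1 p \<rho>(1)
    by (intro coeff_set_add coeff_set_sum coeff_set_mult[of _ _ UNIV _ UNIV] coeff_set_single) auto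
  have p'0: "theta_free (Poly_Mapping.lookup (p' i) m) = 0" for i m
    by (simp add: p'_def lookup_add lookup_sum lookup_mult_int theta_free_add theta_free_sum
        theta_free_mult p0 \<rho>(2))
  \<comment> \<open>The sign from passing \<theta> makes the differential contribute minus the
    differentiated coefficients, which cancels \<open>vcomb r\<close>.\<close>
  have f'_eq: "f + ?D (vcomb \<rho>) \<doteq> ucomb p'"
  proof -
    have "f + ?D (vcomb \<rho>) \<doteq> (ucomb p + vcomb r) + (wcomb Qs \<rho> - vcomb (\<lambda>j. coeff_map ?D (\<rho> j)))"
      unfolding diff_free_vcomb by (intro cong_ideal_add f_eq cong_ideal_refl)
    also have "\<dots> \<doteq> (ucomb p + vcomb r)
        + (ucomb (\<lambda>i. Poly_Mapping.single (int (length Qs)) 1 * \<rho> i + (\<Sum>j<k. w j i * \<rho> j)) - vcomb r)"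
      by (intro cong_ideal_add cong_ideal_diff w(2) cong_ideal_refl cong_ideal_sym[OF ucomb_cong(2)])
        (simp add: lookup_coeff_map \<rho>(3))
    also have "\<dots> = ucomb p'" by (simp add: p'_def ucomb_add)
    finally show ?thesis .
  qed
  have "?D (ucomb p') \<in> J"
    using cong_ideal_mem_iff[OF D_cong[OF f'_eq]] f(3) by (simp add: diff_free_add diff_free_diff_free)
  then have J: "ucomb (\<lambda>j. coeff_map ?D (p' j)) + vcomb (\<lambda>j. 0) \<in> J"
    by (simp add: diff_free_ucomb)
  have Dp': "?D (Poly_Mapping.lookup (p' j) m) \<in> J'" if "j < k" for j m
  proof -
    have "coeff_map ?D (p' j) \<in> coeff_set A1 UNIV" for j
      by (rule coeff_set_coeff_map[OF p']) (simp_all add: diff_free_free_span)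
    from independence(1)[OF inf this _ J that, of m] show ?thesis by (simp add: lookup_coeff_map)
  qed
  have p'A: "Poly_Mapping.lookup (p' j) m \<in> free_span A1" for j m
    using p'[of j] by (simp add: coeff_set_def)
  obtain \<sigma> where \<sigma>: "\<And>j. \<sigma> j \<in> coeff_set A1 UNIV"
    "\<And>j m. j < k \<Longrightarrow> Poly_Mapping.lookup (p' j) m - ?D (Poly_Mapping.lookup (\<sigma> j) m) \<in> J'"
    using choose_coefficients[of p' Qs, OF IH0[OF IH[OF p'A p'0 Dp']]] by metis
  have "ucomb p' \<doteq> ?D (ucomb \<sigma>)"
    unfolding diff_free_ucomb by (rule ucomb_cong) (simp add: lookup_coeff_map \<sigma>(2))
  with f'_eq have "f + ?D (vcomb \<rho>) \<doteq> ?D (ucomb \<sigma>)" by (rule cong_ideal_trans)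
  then have "f - ?D (ucomb \<sigma> - vcomb \<rho>) \<in> J"
    by (simp add: cong_ideal_def diff_free_diff algebra_simps)
  then show ?thesis
    by (intro bexI[of _ "ucomb \<sigma> - vcomb \<rho>"]) (auto intro!: free_span_diff ucomb_free_span \<sigma> \<rho>)
qed

end

theorem acyclic:
  fixes q :: "'k::field"
  assumes inf: "infinite (UNIV :: 'k set)" and q: "q \<noteq> 0"
    and "f \<in> free_span (dgens k)" "theta_free f = 0" "diff_free Qs f \<in> ideal_hull (dg_relators k q)"
  shows "\<exists>g\<in>free_span (dgens k). f - diff_free Qs g \<in> ideal_hull (dg_relators k q)"
  using assms(3-)
proof (induction k arbitrary: f)
  case 0
  then have "f \<in> free_span (affine_gens 0)" by (simp add: dgens_def affine_gens_def)
  then have "theta_free f = f" by (intro theta_free_ident homogeneous_affine)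
  then show ?case using 0 by (intro bexI[of _ 0]) (auto intro: ideal_hull.zero)
next
  case (Suc k)
  interpret hecke_pos q "Suc k" by unfold_locales (use q in auto)
  show ?case by (rule acyclic_step[OF inf _ Suc.prems]) (use Suc.IH in simp)
qed


section \<open>Quotients of algebras\<close>

lemma scalar_ring_simps [simp]:
  "carrier (ring_of_type_algebra :: 'k::field ring) = UNIV"
  "x \<otimes>\<^bsub>ring_of_type_algebra\<^esub> y = x * (y :: 'k)" "\<one>\<^bsub>ring_of_type_algebra\<^esub> = (1 :: 'k)"
  "x \<oplus>\<^bsub>ring_of_type_algebra\<^esub> y = x + (y :: 'k)" "\<zero>\<^bsub>ring_of_type_algebra\<^esub> = (0 :: 'k)"
  by (simp_all add: ring_of_type_algebra_def)

lemma assoc_algebraI: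
  fixes A :: "('k::field, 'a) module" (structure)
  assumes "ring A"
    and "\<And>c x. x \<in> carrier A \<Longrightarrow> c \<odot> x \<in> carrier A"
    and "\<And>c e x. x \<in> carrier A \<Longrightarrow> (c + e) \<odot> x = c \<odot> x \<oplus> e \<odot> x"
    and "\<And>c x y. x \<in> carrier A \<Longrightarrow> y \<in> carrier A \<Longrightarrow> c \<odot> (x \<oplus> y) = c \<odot> x \<oplus> c \<odot> y"
    and "\<And>c e x. x \<in> carrier A \<Longrightarrow> (c * e) \<odot> x = c \<odot> (e \<odot> x)"
    and "\<And>x. x \<in> carrier A \<Longrightarrow> 1 \<odot> x = x"
    and "\<And>c x y. x \<in> carrier A \<Longrightarrow> y \<in> carrier A \<Longrightarrow> c \<odot> (x \<otimes> y) = (c \<odot> x) \<otimes> y"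
    and "\<And>c x y. x \<in> carrier A \<Longrightarrow> y \<in> carrier A \<Longrightarrow> c \<odot> (x \<otimes> y) = x \<otimes> (c \<odot> y)"
  shows "assoc_algebra A"
proof (intro assoc_algebra.intro module.intro module_axioms.intro assoc_algebra_axioms.intro)
  show "cring (ring_of_type_algebra :: 'k ring)" by (rule cring_from_type_algebra)
  show "ring A" "abelian_group A" using assms(1) by (auto simp: ring_def)
qed (use assms in auto)

context assoc_algebra
begin

lemma scale_closed [simp]: "x \<in> carrier A \<Longrightarrow> c \<odot> x \<in> carrier A"
  and scale_l_distr: "x \<in> carrier A \<Longrightarrow> (c + e) \<odot> x = c \<odot> x \<oplus> e \<odot> x"
  and scale_r_distr: "x \<in> carrier A \<Longrightarrow> y \<in> carrier A \<Longrightarrow> c \<odot> (x \<oplus> y) = c \<odot> x \<oplus> c \<odot> y"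
  and scale_assoc: "x \<in> carrier A \<Longrightarrow> (c * e) \<odot> x = c \<odot> (e \<odot> x)"
  and scale_one: "x \<in> carrier A \<Longrightarrow> 1 \<odot> x = x"
  using scalars.smult_closed[of c x] scalars.smult_l_distr[of c e x] scalars.smult_r_distr[of c x y]
    scalars.smult_assoc1[of c e x] scalars.smult_one[of x] by simp_all

text \<open>Scaling is multiplication by the scalar multiple of the unit.\<close>

lemma scale_ideal:
  assumes "ideal I A" "i \<in> I" shows "c \<odot> i \<in> I"
proof -
  interpret I: ideal I A by fact
  have "c \<odot> i = (c \<odot> \<one>) \<otimes> i"
    using smult_mult_left[of \<one> i c] assms(2) by simp
  then show ?thesis using I.I_l_closed[OF assms(2), of "c \<odot> \<one>"] by simp
qed

lemma quotient_algebra_simps: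
  "carrier (quotient_algebra A I) = (+>) I ` carrier A"
  "\<one>\<^bsub>quotient_algebra A I\<^esub> = I +> \<one>"
  "\<zero>\<^bsub>quotient_algebra A I\<^esub> = I"
  by (auto simp: quotient_algebra_def ring.defs module.defs FactRing_def A_RCOSETS_def')

lemma quotient_algebra_mult:
  "ideal I A \<Longrightarrow> x \<in> carrier A \<Longrightarrow> y \<in> carrier A \<Longrightarrow>
    (I +> x) \<otimes>\<^bsub>quotient_algebra A I\<^esub> (I +> y) = I +> (x \<otimes> y)"
  by (simp add: quotient_algebra_def ring.defs module.defs FactRing_def ideal.rcoset_mult_add)

lemma quotient_algebra_add:
  assumes "ideal I A" "x \<in> carrier A" "y \<in> carrier A"
  shows "(I +> x) \<oplus>\<^bsub>quotient_algebra A I\<^esub> (I +> y) = I +> (x \<oplus> y)"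
proof -
  interpret I: ideal I A by fact
  show ?thesis using assms
    by (simp add: quotient_algebra_def ring.defs module.defs FactRing_def I.a_rcos_sum)
qed

lemma coset_eq_iff:
  "ideal I A \<Longrightarrow> x \<in> carrier A \<Longrightarrow> y \<in> carrier A \<Longrightarrow> I +> x = I +> y \<longleftrightarrow> x \<ominus> y \<in> I"
  using quotient_eq_iff_same_a_r_cos by blast

lemma quotient_algebra_scale:
  assumes I: "ideal I A" and x: "x \<in> carrier A"
  shows "c \<odot>\<^bsub>quotient_algebra A I\<^esub> (I +> x) = I +> (c \<odot> x)"
proof -
  interpret I: ideal I A by fact
  have "I +> (c \<odot> y) = I +> (c \<odot> x)" if y: "y \<in> I +> x" for y
  proof -
    obtain i where i: "i \<in> I" "y = i \<oplus> x" using y by (auto simp: a_r_coset_def')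
    then have "i \<in> carrier A" by simp
    then have "c \<odot> y \<ominus> c \<odot> x = c \<odot> i"
      using x i by (simp add: scale_r_distr minus_eq a_assoc r_neg)
    then show ?thesis using scale_ideal[OF I i(1), of c] coset_eq_iff[OF I, of "c \<odot> y" "c \<odot> x"] x i
      by simp
  qed
  moreover have "x \<in> I +> x" using I.a_rcos_self[OF x] .
  ultimately have "(\<Union>y\<in>I +> x. I +> (c \<odot> y)) = I +> (c \<odot> x)" by blast
  then show ?thesis by (simp add: quotient_algebra_def ring.defs module.defs)
qed

lemma ring_quotient_algebra:
  assumes "ideal I A" shows "ring (quotient_algebra A I)"
proof -
  interpret Q: ring "A Quot I" using assms by (rule ideal.quotient_is_ring)
  show ?thesis
  proof (rule ringI)
    show "abelian_group (quotient_algebra A I)"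
      by (rule abelian_groupI)
        (use Q.a_assoc Q.a_comm Q.l_zero Q.a_closed Q.add.l_inv_ex
          in \<open>simp_all add: quotient_algebra_def ring.defs module.defs\<close>)
    show "Group.monoid (quotient_algebra A I)"
      by (rule monoidI)
        (use Q.m_assoc Q.l_one Q.r_one Q.m_closed in \<open>simp_all add: quotient_algebra_def ring.defs module.defs\<close>)
  qed (use Q.l_distr Q.r_distr in \<open>simp_all add: quotient_algebra_def ring.defs module.defs\<close>)
qed

lemma assoc_algebra_quotient:
  assumes I: "ideal I A"
  shows "assoc_algebra (quotient_algebra A I)"
proof -
  note simps = quotient_algebra_simps quotient_algebra_mult[OF I] quotient_algebra_add[OF I]
    quotient_algebra_scale[OF I]
  show ?thesis
  proof (rule assoc_algebraI[OF ring_quotient_algebra[OF I]]; unfold quotient_algebra_simps(1))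
    fix x y c e
    { assume x: "x \<in> (+>) I ` carrier A"
      then show "c \<odot>\<^bsub>quotient_algebra A I\<^esub> x \<in> (+>) I ` carrier A" by (auto simp: simps)
      show "1 \<odot>\<^bsub>quotient_algebra A I\<^esub> x = x" using x by (auto simp: simps scale_one)
      show "(c + e) \<odot>\<^bsub>quotient_algebra A I\<^esub> x
        = c \<odot>\<^bsub>quotient_algebra A I\<^esub> x \<oplus>\<^bsub>quotient_algebra A I\<^esub> e \<odot>\<^bsub>quotient_algebra A I\<^esub> x"
        using x by (auto simp: simps scale_l_distr)
      show "(c * e) \<odot>\<^bsub>quotient_algebra A I\<^esub> x = c \<odot>\<^bsub>quotient_algebra A I\<^esub> (e \<odot>\<^bsub>quotient_algebra A I\<^esub> x)"
        using x by (auto simp: simps scale_assoc) }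
    { assume xy: "x \<in> (+>) I ` carrier A" "y \<in> (+>) I ` carrier A"
      then show "c \<odot>\<^bsub>quotient_algebra A I\<^esub> (x \<oplus>\<^bsub>quotient_algebra A I\<^esub> y)
        = c \<odot>\<^bsub>quotient_algebra A I\<^esub> x \<oplus>\<^bsub>quotient_algebra A I\<^esub> c \<odot>\<^bsub>quotient_algebra A I\<^esub> y"
        by (auto simp: simps scale_r_distr)
      show "c \<odot>\<^bsub>quotient_algebra A I\<^esub> (x \<otimes>\<^bsub>quotient_algebra A I\<^esub> y)
        = c \<odot>\<^bsub>quotient_algebra A I\<^esub> x \<otimes>\<^bsub>quotient_algebra A I\<^esub> y"
        using xy by (auto simp: simps smult_mult_left)
      show "c \<odot>\<^bsub>quotient_algebra A I\<^esub> (x \<otimes>\<^bsub>quotient_algebra A I\<^esub> y)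
        = x \<otimes>\<^bsub>quotient_algebra A I\<^esub> (c \<odot>\<^bsub>quotient_algebra A I\<^esub> y)"
        using xy by (auto simp: simps smult_mult_right) }
  qed
qed

text \<open>The isomorphism theorem for the underlying rings; compatibility with scalars is checked
  on cosets.\<close>

lemma alg_iso_quotient_kernel:
  assumes B: "ring B" and h: "h \<in> ring_hom A B" and surj: "h ` carrier A = carrier B"
    and lin: "\<And>c x. x \<in> carrier A \<Longrightarrow> h (c \<odot> x) = c \<odot>\<^bsub>B\<^esub> h x"
  shows "\<exists>g. g \<in> alg_iso (quotient_algebra A (a_kernel A B h)) B"
proof -
  interpret h: ring_hom_ring A B h
    using ring_axioms B h by (rule ring_hom_ringI2)
  let ?K = "a_kernel A B h"
  let ?g = "\<lambda>C. the_elem (h ` C)"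
  have K: "ideal ?K A" by (rule h.kernel_is_ideal)
  have "?g \<in> ring_iso (A Quot ?K) B" by (rule h.FactRing_iso_set[OF surj])
  then have "?g \<in> ring_iso (quotient_algebra A ?K) B"
    by (simp add: ring_iso_def ring_hom_def quotient_algebra_def ring.defs module.defs)
  moreover have "?g (c \<odot>\<^bsub>quotient_algebra A ?K\<^esub> C) = c \<odot>\<^bsub>B\<^esub> ?g C"
    if C: "C \<in> carrier (quotient_algebra A ?K)" for c C
  proof -
    obtain x where x: "x \<in> carrier A" "C = ?K +> x" using C by (auto simp: quotient_algebra_simps)
    then show ?thesis by (simp add: quotient_algebra_scale[OF K] h.the_elem_simp lin)
  qed
  ultimately show ?thesis by (auto simp: alg_iso_def)
qed

end

section \<open>Presented algebras\<close>

lemma assoc_algebra_free_algebra: "assoc_algebra (free_algebra S)"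
proof (rule assoc_algebraI[OF ring_free_algebra])
  show "c \<odot>\<^bsub>free_algebra S\<^esub> (x \<otimes>\<^bsub>free_algebra S\<^esub> y)
    = x \<otimes>\<^bsub>free_algebra S\<^esub> (c \<odot>\<^bsub>free_algebra S\<^esub> y)" for c x y
    using const_mid[of x c y] by simp
qed (auto simp: carrier_free_algebra free_span_mult free_const_add free_const_mult algebra_simps)

locale presentation =
  fixes S :: "'g set" and R :: "('g, 'k::field) free_alg set"
  assumes relators: "R \<subseteq> free_span S"
begin

abbreviation P where "P \<equiv> presented_algebra S R"
abbreviation cl where "cl \<equiv> presented_class S R"

sublocale F: assoc_algebra "free_algebra S" by (rule assoc_algebra_free_algebra)

lemma ideal_relation_ideal: "ideal (relation_ideal S R) (free_algebra S)"
  unfolding relation_ideal_def by (rule F.genideal_ideal) (use relators in \<open>simp add: carrier_free_algebra\<close>)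

sublocale P: assoc_algebra P
  unfolding presented_algebra_def by (rule F.assoc_algebra_quotient[OF ideal_relation_ideal])

lemma free_uminus: "x \<in> free_span S \<Longrightarrow> \<ominus>\<^bsub>free_algebra S\<^esub> x = - x"
  by (intro F.minus_equality) (auto simp: carrier_free_algebra free_span_uminus)

lemma free_minus: "x \<in> free_span S \<Longrightarrow> y \<in> free_span S \<Longrightarrow> x \<ominus>\<^bsub>free_algebra S\<^esub> y = x - y"
  by (simp add: a_minus_def free_uminus)

lemma carrier_P: "carrier P = cl ` free_span S"
  by (simp add: presented_algebra_def F.quotient_algebra_simps presented_class_def carrier_free_algebra)

lemma cl_closed [simp]: "f \<in> free_span S \<Longrightarrow> cl f \<in> carrier P"
  by (simp add: carrier_P)

lemma cl_eq_iff:
  assumes "f \<in> free_span S" "g \<in> free_span S"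
  shows "cl f = cl g \<longleftrightarrow> f - g \<in> ideal_hull R"
  using F.coset_eq_iff[OF ideal_relation_ideal, of f g] assms
  by (simp add: presented_class_def carrier_free_algebra free_minus relation_ideal_eq[OF relators]
      free_span_diff)

lemma cl_one: "\<one>\<^bsub>P\<^esub> = cl 1"
  by (simp add: presented_algebra_def F.quotient_algebra_simps presented_class_def)

lemma cl_zero: "\<zero>\<^bsub>P\<^esub> = cl 0"
proof -
  have "cl 0 = relation_ideal S R"
    using F.a_coset_join2[of 0 "relation_ideal S R"] ideal_relation_ideal
    by (simp add: presented_class_def carrier_free_algebra ideal_def additive_subgroup_def
        subgroup.one_closed additive_subgroup.zero_closed)
      (metis F.a_coset_add_zero free_algebra_simps(3) additive_subgroup.a_subset ideal.axioms(1) ideal_relation_ideal)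
  then show ?thesis by (simp add: presented_algebra_def F.quotient_algebra_simps)
qed

lemma cl_eq_zero_iff: "f \<in> free_span S \<Longrightarrow> cl f = \<zero>\<^bsub>P\<^esub> \<longleftrightarrow> f \<in> ideal_hull R"
  by (simp add: cl_zero cl_eq_iff)

lemma cl_add: "f \<in> free_span S \<Longrightarrow> g \<in> free_span S \<Longrightarrow> cl f \<oplus>\<^bsub>P\<^esub> cl g = cl (f + g)"
  using F.quotient_algebra_add[OF ideal_relation_ideal, of f g]
  by (simp add: presented_algebra_def presented_class_def carrier_free_algebra)

lemma cl_mult: "f \<in> free_span S \<Longrightarrow> g \<in> free_span S \<Longrightarrow> cl f \<otimes>\<^bsub>P\<^esub> cl g = cl (f * g)"
  using F.quotient_algebra_mult[OF ideal_relation_ideal, of f g]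
  by (simp add: presented_algebra_def presented_class_def carrier_free_algebra)

lemma cl_scale: "f \<in> free_span S \<Longrightarrow> c \<odot>\<^bsub>P\<^esub> cl f = cl (free_const c * f)"
  using F.quotient_algebra_scale[OF ideal_relation_ideal, of f c]
  by (simp add: presented_algebra_def presented_class_def carrier_free_algebra)

lemma cl_uminus: "f \<in> free_span S \<Longrightarrow> \<ominus>\<^bsub>P\<^esub> cl f = cl (- f)"
  by (rule P.minus_equality) (simp_all add: cl_add free_span_uminus cl_zero)

lemma cl_minus: "f \<in> free_span S \<Longrightarrow> g \<in> free_span S \<Longrightarrow> cl f \<ominus>\<^bsub>P\<^esub> cl g = cl (f - g)"
  by (simp add: a_minus_def cl_uminus cl_add free_span_uminus)

lemma cl_sign: "(\<ominus>\<^bsub>P\<^esub> \<one>\<^bsub>P\<^esub>) [^]\<^bsub>P\<^esub> (n::nat) = cl (free_const ((- 1) ^ n))"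
proof (induction n)
  case (Suc n)
  then show ?case
    by (simp add: cl_one cl_uminus cl_mult free_span_uminus free_const_uminus)
qed (simp add: cl_one)

lemma cl_finsum:
  "finite I \<Longrightarrow> (\<And>i. i \<in> I \<Longrightarrow> f i \<in> free_span S) \<Longrightarrow> (\<Oplus>\<^bsub>P\<^esub>i\<in>I. cl (f i)) = cl (sum f I)"
proof (induction I rule: finite_induct)
  case (insert i I)
  then show ?case by (subst P.finsum_insert) (auto simp: cl_add free_span_sum)
qed (simp add: cl_zero)

lemma cl_cyclotomic:
  "x \<in> free_span S \<Longrightarrow> cyclotomic_element P (cl x) Qs = cl (cyclotomic Qs x)"
proof (induction Qs)
  case (Cons c Qs)
  have "cl x \<ominus>\<^bsub>P\<^esub> c \<odot>\<^bsub>P\<^esub> \<one>\<^bsub>P\<^esub> = cl (x - free_const c)"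
    using Cons by (simp add: cl_one cl_scale cl_minus)
  then show ?case using Cons
    by (simp add: cyclotomic_element_def cl_mult free_span_diff cyclotomic_free_span)
qed (simp add: cyclotomic_element_def cl_one)

end


section \<open>The differential graded algebra\<close>

text \<open>Over a finite field, one plus the product of all X - a has positive degree and no
  root.\<close>

lemma infinite_alg_closed_field: "infinite (UNIV :: 'k::alg_closed_field set)"
proof
  assume fin: "finite (UNIV :: 'k set)"
  define p :: "'k poly" where "p = (\<Prod>a\<in>UNIV. [:- a, 1:])"
  have "Polynomial.degree p = (\<Sum>a\<in>(UNIV :: 'k set). Polynomial.degree [:- a, 1:])"
    unfolding p_def by (rule degree_prod_eq_sum_degree) auto
  then have deg: "Polynomial.degree p > 0" using fin by (simp add: card_gt_0_iff)
  then have "Polynomial.degree (p + 1) > 0" by (subst degree_add_eq_left) auto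
  then obtain x where "poly (p + 1) x = 0" using alg_closed_imp_poly_has_root by blast
  moreover have "poly p x = 0" using fin by (simp add: p_def poly_prod)
  ultimately show False by simp
qed

definition theta_part :: "nat \<Rightarrow> (hecke_gen, 'k::field) free_alg \<Rightarrow> (hecke_gen, 'k) free_alg" where
  "theta_part n = restrict_words (\<lambda>u. theta_count u = n)"

lemma theta_part_add: "theta_part n (f + g) = theta_part n f + theta_part n g"
  and theta_part_diff: "theta_part n (f - g) = theta_part n f - theta_part n g"
  and theta_part_sum: "theta_part n (sum h I) = (\<Sum>i\<in>I. theta_part n (h i))"
  and theta_part_free_span: "f \<in> free_span S \<Longrightarrow> theta_part n f \<in> free_span S"
  by (simp_all add: theta_part_def restrict_words_add restrict_words_diff restrict_words_sum
      restrict_words_free_span)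

lemma theta_part_homogeneous: "theta_part n f \<in> homogeneous n"
  by (auto simp: theta_part_def homogeneous_def in_keys_iff lookup_restrict_words when_def split: if_splits)

lemma theta_part_of_homogeneous:
  assumes "f \<in> homogeneous m"
  shows "theta_part n f = (if m = n then f else 0)"
  using assms by (intro poly_mapping_eqI)
    (auto simp: theta_part_def lookup_restrict_words homogeneous_def when_def in_keys_iff)

text \<open>The relators are homogeneous, so the ideal is graded; multipliers are first split into
  words.\<close>

lemma theta_part_ideal:
  "f \<in> ideal_hull (dg_relators k q) \<Longrightarrow> theta_part n f \<in> ideal_hull (dg_relators k q)"
proof (induction rule: ideal_hull.induct)
  case (add r f u v)
  obtain m where m: "r \<in> homogeneous m" using dg_relators_homogeneous[OF add(1)] by blast
  have "theta_part n (u * r * v) \<in> ideal_hull (dg_relators k q)"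
  proof (induction u rule: free_alg_induct)
    case (word c u)
    show ?case
    proof (induction v rule: free_alg_induct)
      case (word e v)
      have "word_term u c * r * word_term v e \<in> homogeneous (theta_count u + m + theta_count v)"
        by (intro homogeneous_mult m homogeneous_word_term refl)
      then show ?case
        using ideal_hull_mult_left[OF ideal_hull_mult_right[OF ideal_hull_incl[OF add(1)]]]
        by (simp add: theta_part_of_homogeneous ideal_hull.zero mult.assoc)
    qed (simp add: distrib_left theta_part_add ideal_hull_add)
  qed (simp add: distrib_right theta_part_add ideal_hull_add)
  then show ?case using add by (simp add: theta_part_add ideal_hull_add)
qed (simp add: theta_part_def ideal_hull.zero)

lemma sum_theta_part:
  "(\<Sum>n\<in>(\<lambda>w. theta_count (letters w)) ` Poly_Mapping.keys f. theta_part n f) = f"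
  by (rule poly_mapping_eqI)
    (auto simp: lookup_sum theta_part_def lookup_restrict_words when_def in_keys_iff)

lemma diff_free_homogeneous:
  assumes "f \<in> homogeneous (Suc n)"
  shows "diff_free Qs f \<in> homogeneous n"
proof -
  have *: "diff_word Qs u \<in> homogeneous n" if "theta_count u = Suc n" for u n
    using that
  proof (induction u arbitrary: n)
    case (Cons g u)
    show ?case
    proof (cases "g = GenTheta")
      case True
      then have u: "theta_count u = n" using Cons by simp
      have "cyclotomic Qs (gX 1) * word_term u 1 \<in> homogeneous n"
        using homogeneous_mult[OF cyclotomic_homogeneous homogeneous_word_term[OF u]] by simp
      moreover have "gTheta * diff_word Qs u \<in> homogeneous n"
      proof (cases n)
        case 0
        then have "diff_word Qs u = 0"
          using diff_free_homogeneous_0[OF homogeneous_word_term[of u 0 1], of Qs] u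
          by (simp add: diff_free_word_term)
        then show ?thesis by simp
      next
        case (Suc m)
        then show ?thesis
          using homogeneous_mult[OF homogeneous_theta Cons.IH[of m]] u by simp
      qed
      ultimately show ?thesis using True by (simp add: homogeneous_diff)
    next
      case False
      then show ?thesis
        using homogeneous_mult[OF homogeneous_gen[of g] Cons.IH[of n]] Cons.prems by simp
    qed
  qed simp
  show ?thesis
    unfolding diff_free_def
  proof (intro homogeneous_sum)
    fix w assume "w \<in> Poly_Mapping.keys f"
    then have "theta_count (letters w) = Suc n" using assms by (simp add: homogeneous_def)
    from homogeneous_mult[OF homogeneous_const *[OF this]]
    show "free_const (Poly_Mapping.lookup f w) * diff_word Qs (letters w) \<in> homogeneous n" by simp
  qed
qed

lemma diff_free_mult_right_0:
  assumes "g \<in> homogeneous 0"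
  shows "diff_free Qs (f * g) = diff_free Qs f * g"
proof (induction f rule: free_alg_induct)
  case (word c u)
  show ?case by (simp add: diff_free_word_mult diff_free_homogeneous_0[OF assms])
qed (simp add: algebra_simps diff_free_add)

text \<open>Setting \<theta> to 0 in the differential of a word leaves at most a term in which the
  removed \<theta> has been replaced by the cyclotomic polynomial.\<close>

lemma theta_free_diff_free_ideal:
  "theta_free (diff_free Qs f) \<in> ideal_hull {cyclotomic Qs (gX 1)}"
proof (induction f rule: free_alg_induct)
  case (word c u)
  have "theta_free (diff_word Qs u) \<in> ideal_hull {cyclotomic Qs (gX 1)}"
  proof (induction u)
    case (Cons g u)
    have "theta_free (cyclotomic Qs (gX 1)) = cyclotomic Qs (gX 1)"
      by (rule theta_free_ident[OF cyclotomic_homogeneous])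
    note Pol = this
    show ?case
    proof (cases "g = GenTheta")
      case True
      have "cyclotomic Qs (gX 1) * theta_free (word_term u 1) \<in> ideal_hull {cyclotomic Qs (gX 1)}"
        by (intro ideal_hull_mult_right ideal_hull_incl) simp
      then show ?thesis using True by (simp add: theta_free_diff theta_free_mult Pol)
    next
      case False
      then show ?thesis using ideal_hull_mult_left[OF Cons.IH, of "theta_free (free_gen g)"]
        by (simp add: theta_free_mult)
    qed
  qed (simp add: ideal_hull.zero)
  then show ?case by (simp add: diff_free_word_term theta_free_mult ideal_hull_mult_left)
qed (simp add: diff_free_add theta_free_add ideal_hull_add)

lemma dgens_eq: "d \<ge> 1 \<Longrightarrow> dgens d = dg_gens d"
  by (simp add: dgens_def)

locale dg_hecke_algebra =
  fixes q :: "'k::alg_closed_field" and d :: nat and Qs :: "'k list"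
  assumes q: "q \<noteq> 0" and d: "d \<ge> 1"
begin

sublocale dg: presentation "dg_gens d" "dg_relators d q"
  by unfold_locales (use dg_relators_free_span[OF d, of q] dgens_eq[OF d] in simp)

sublocale aff: presentation "affine_gens d" "affine_relators d q"
  by unfold_locales (rule affine_relators_free_span)

abbreviation FS :: "(hecke_gen, 'k) free_alg set" where "FS \<equiv> free_span (dg_gens d)"
abbreviation AS :: "(hecke_gen, 'k) free_alg set" where "AS \<equiv> free_span (affine_gens d)"
abbreviation J where "J \<equiv> ideal_hull (dg_relators d q)"
abbreviation G where "G \<equiv> dg_degree d q"
abbreviation Pol :: "(hecke_gen, 'k) free_alg" where "Pol \<equiv> cyclotomic Qs (gX 1)"

lemma AS_FS: "f \<in> AS \<Longrightarrow> f \<in> FS"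
  using free_span_mono[of "affine_gens d" "dg_gens d"] by (auto simp: dg_gens_def)

lemma Pol_AS: "Pol \<in> AS"
  using d by (intro cyclotomic_free_span) (simp add: GenX_in)

lemma theta_in [simp]: "GenTheta \<in> dg_gens d"
  by (simp add: dg_gens_def)

lemma diff_FS: "f \<in> FS \<Longrightarrow> diff_free Qs f \<in> FS"
  using diff_free_free_span[of f d Qs] by (simp add: dgens_eq[OF d])

lemma diff_J: "f \<in> J \<Longrightarrow> diff_free Qs f \<in> J"
  by (rule diff_free_ideal[OF infinite_alg_closed_field q d])

lemma theta_free_AS: "f \<in> FS \<Longrightarrow> theta_free f \<in> AS"
  using theta_free_affine_span[of f d] by (simp add: dgens_eq[OF d])

lemma G_eq: "G n = dg.cl ` (FS \<inter> homogeneous n)"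
  by (auto simp: dg_degree_def dg_class_def carrier_free_algebra homogeneous_def)

text \<open>The choice of representative is immaterial because the differential preserves the
  ideal.\<close>

definition diff :: "(hecke_gen, 'k) free_alg set \<Rightarrow> (hecke_gen, 'k) free_alg set" where
  "diff = (\<lambda>x\<in>carrier dg.P. dg.cl (diff_free Qs (SOME f. f \<in> FS \<and> dg.cl f = x)))"

lemma diff_cl:
  assumes f: "f \<in> FS" shows "diff (dg.cl f) = dg.cl (diff_free Qs f)"
proof -
  define g where "g = (SOME g. g \<in> FS \<and> dg.cl g = dg.cl f)"
  have g: "g \<in> FS \<and> dg.cl g = dg.cl f"
    unfolding g_def by (rule someI[of _ f]) (simp add: f)
  then have "diff_free Qs (g - f) \<in> J" using f by (intro diff_J) (simp flip: dg.cl_eq_iff)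
  then have "dg.cl (diff_free Qs g) = dg.cl (diff_free Qs f)"
    using f g by (simp add: dg.cl_eq_iff diff_FS diff_free_diff)
  then show ?thesis using f by (simp add: diff_def flip: g_def)
qed

lemma cases_P:
  assumes "x \<in> carrier dg.P" obtains f where "f \<in> FS" "x = dg.cl f"
  using assms by (auto simp: dg.carrier_P)

lemma graded_derivation_diff: "graded_derivation dg.P G diff"
  unfolding graded_derivation_def
proof (intro conjI ballI allI)
  show "diff \<in> carrier dg.P \<rightarrow> carrier dg.P"
    by (auto simp: dg.carrier_P diff_cl diff_FS)
next
  fix x y assume "x \<in> carrier dg.P" "y \<in> carrier dg.P"
  then show "diff (x \<oplus>\<^bsub>dg.P\<^esub> y) = diff x \<oplus>\<^bsub>dg.P\<^esub> diff y"
    by (elim cases_P) (simp add: dg.cl_add diff_cl diff_FS free_span_add diff_free_add)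
next
  fix c x assume "x \<in> carrier dg.P"
  then show "diff (c \<odot>\<^bsub>dg.P\<^esub> x) = c \<odot>\<^bsub>dg.P\<^esub> diff x"
    by (elim cases_P) (simp add: dg.cl_scale diff_cl diff_FS free_span_mult
        diff_free_mult_0[OF homogeneous_const])
next
  fix n x y assume "x \<in> G n" and y: "y \<in> carrier dg.P"
  then obtain f where f: "f \<in> FS" "f \<in> homogeneous n" "x = dg.cl f" by (auto simp: G_eq)
  from y obtain g where g: "g \<in> FS" "y = dg.cl g" by (elim cases_P)
  show "diff (x \<otimes>\<^bsub>dg.P\<^esub> y) = diff x \<otimes>\<^bsub>dg.P\<^esub> y
      \<oplus>\<^bsub>dg.P\<^esub> ((\<ominus>\<^bsub>dg.P\<^esub> \<one>\<^bsub>dg.P\<^esub>) [^]\<^bsub>dg.P\<^esub> n) \<otimes>\<^bsub>dg.P\<^esub> (x \<otimes>\<^bsub>dg.P\<^esub> diff y)"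
    using f g by (simp add: dg.cl_mult dg.cl_add dg.cl_sign diff_cl diff_FS free_span_mult
        diff_free_mult[OF f(2)])
qed

lemma subalgebra_homogeneous:
  assumes "x \<in> subalgebra_generated dg.P ((\<lambda>g. dg.cl (free_gen g)) ` affine_gens d)"
  shows "x \<in> dg.cl ` AS"
  using assms unfolding subalgebra_generated_def
proof (induction rule: generate_ring.induct)
  case one
  then show ?case by (simp add: dg.cl_one)
next
  case (incl h)
  then show ?case by (auto simp: dg.cl_one dg.cl_scale)
next
  case (a_inv h)
  then show ?case by (auto simp: dg.cl_uminus AS_FS free_span_uminus)
next
  case (eng_add h1 h2)
  then show ?case by (auto simp: dg.cl_add AS_FS free_span_add)
next
  case (eng_mult h1 h2)
  then show ?case by (auto simp: dg.cl_mult AS_FS free_span_mult)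
qed

lemma is_dg_differential_diff: "is_dg_differential d q Qs diff"
  unfolding is_dg_differential_def dg_hecke_def dg_class_def
proof (intro conjI ballI)
  show "graded_derivation dg.P G diff" by (rule graded_derivation_diff)
next
  fix x assume "x \<in> subalgebra_generated dg.P ((\<lambda>g. dg.cl (free_gen g)) ` affine_gens d)"
  then obtain f where "f \<in> AS" "x = dg.cl f" using subalgebra_homogeneous by blast
  then show "diff x = \<zero>\<^bsub>dg.P\<^esub>"
    by (simp add: diff_cl AS_FS diff_free_homogeneous_0[OF homogeneous_affine] dg.cl_zero)
next
  show "diff (dg.cl gTheta) = cyclotomic_element dg.P (dg.cl (gX 1)) Qs"
    using AS_FS[of "gX 1"] d
    by (simp add: dg.cl_cyclotomic diff_cl diff_free_theta GenX_in)
qed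

text \<open>Words are peeled from the left: their first letter is homogeneous of degree zero, with
  value 0, or equal to \<theta>, so the Leibniz rule determines the rest.\<close>

lemma is_dg_differential_unique:
  assumes E: "is_dg_differential d q Qs E" and f: "f \<in> FS"
  shows "E (dg.cl f) = dg.cl (diff_free Qs f)"
proof -
  have der: "graded_derivation dg.P G E"
    and zero: "\<And>x. x \<in> subalgebra_generated dg.P ((\<lambda>g. dg.cl (free_gen g)) ` affine_gens d) \<Longrightarrow>
        E x = \<zero>\<^bsub>dg.P\<^esub>"
    and theta: "E (dg.cl gTheta) = cyclotomic_element dg.P (dg.cl (gX 1)) Qs"
    using E unfolding is_dg_differential_def dg_hecke_def dg_class_def by blast+
  have E_add: "E (x \<oplus>\<^bsub>dg.P\<^esub> y) = E x \<oplus>\<^bsub>dg.P\<^esub> E y"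
    if "x \<in> carrier dg.P" "y \<in> carrier dg.P" for x y
    using der that unfolding graded_derivation_def by blast
  have E_mult: "E (x \<otimes>\<^bsub>dg.P\<^esub> y) = E x \<otimes>\<^bsub>dg.P\<^esub> y
      \<oplus>\<^bsub>dg.P\<^esub> ((\<ominus>\<^bsub>dg.P\<^esub> \<one>\<^bsub>dg.P\<^esub>) [^]\<^bsub>dg.P\<^esub> n) \<otimes>\<^bsub>dg.P\<^esub> (x \<otimes>\<^bsub>dg.P\<^esub> E y)"
    if "x \<in> G n" "y \<in> carrier dg.P" for x y n
    using der that unfolding graded_derivation_def by blast
  have E_theta: "E (dg.cl gTheta) = dg.cl Pol"
    using AS_FS[of "gX 1"] d by (simp add: theta dg.cl_cyclotomic GenX_in)
  have E_const: "E (dg.cl (free_const c)) = \<zero>\<^bsub>dg.P\<^esub>" for c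
  proof (rule zero)
    have "c \<odot>\<^bsub>dg.P\<^esub> \<one>\<^bsub>dg.P\<^esub> = dg.cl (free_const c)" by (simp add: dg.cl_one dg.cl_scale)
    then show "dg.cl (free_const c) \<in> subalgebra_generated dg.P ((\<lambda>g. dg.cl (free_gen g)) ` affine_gens d)"
      unfolding subalgebra_generated_def by (intro generate_ring.incl) (metis (mono_tags, lifting) UnI2 mem_Collect_eq)
  qed
  have E_gen: "E (dg.cl (free_gen g)) = \<zero>\<^bsub>dg.P\<^esub>" if "g \<in> affine_gens d" for g
    by (rule zero) (use that in \<open>auto simp: subalgebra_generated_def intro!: generate_ring.incl\<close>)
  show ?thesis using f
  proof (induction f rule: free_span_induct)
    case (word c u)
    then show ?case
    proof (induction u)
      case Nil
      then show ?case
        using E_const[of c] diff_free_homogeneous_0[OF homogeneous_const[of c], of Qs]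
        by (simp add: dg.cl_zero flip: free_const_eq)
    next
      case (Cons g u)
      then have g: "g \<in> dg_gens d" and u: "word_term u c \<in> FS"
        and IH: "E (dg.cl (word_term u c)) = dg.cl (diff_free Qs (word_term u c))"
        by (auto intro: free_span_word_term)
      have mult: "dg.cl (word_term (g # u) c) = dg.cl (free_gen g) \<otimes>\<^bsub>dg.P\<^esub> dg.cl (word_term u c)"
        using g u by (simp add: word_term_Cons dg.cl_mult)
      show ?case
      proof (cases "g = GenTheta")
        case True
        have "dg.cl gTheta \<in> G (Suc 0)" by (auto simp: G_eq homogeneous_theta)
        from E_mult[OF this, of "dg.cl (word_term u c)"] show ?thesis
          unfolding mult using True u IH Pol_AS
          by (simp add: word_term_Cons E_theta diff_free_theta_mult dg.cl_mult dg.cl_add dg.cl_uminus dg.cl_one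
              diff_FS AS_FS free_span_mult free_span_uminus)
      next
        case False
        then have g': "g \<in> affine_gens d" using g by (simp add: dg_gens_def)
        have "dg.cl (free_gen g) \<in> G 0" using False g by (auto simp: G_eq homogeneous_gen)
        from E_mult[OF this, of "dg.cl (word_term u c)"] show ?thesis
          unfolding mult using False u IH g
          by (simp add: word_term_Cons E_gen[OF g'] diff_free_mult_0[OF homogeneous_gen] dg.cl_mult dg.cl_add
              dg.cl_zero dg.cl_one diff_FS free_span_mult)
      qed
    qed
  next
    case (add f g)
    then show ?case
      using E_add[of "dg.cl f" "dg.cl g"] by (simp add: dg.cl_add diff_FS diff_free_add)
  qed
qed

lemma dg_differential_eq: "dg_differential d q Qs = diff"
  unfolding dg_differential_def
proof (rule the_equality)
  show "diff \<in> extensional (carrier (dg_hecke d q)) \<and> is_dg_differential d q Qs diff"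
    using is_dg_differential_diff by (simp add: diff_def dg_hecke_def)
next
  fix E assume E: "E \<in> extensional (carrier (dg_hecke d q)) \<and> is_dg_differential d q Qs E"
  show "E = diff"
  proof (rule extensionalityI[of _ "carrier dg.P"])
    show "E \<in> extensional (carrier dg.P)" using E by (simp add: dg_hecke_def)
    show "diff \<in> extensional (carrier dg.P)" by (simp add: diff_def)
    show "E x = diff x" if "x \<in> carrier dg.P" for x
      using that E by (elim cases_P) (simp add: diff_cl is_dg_differential_unique)
  qed
qed

text \<open>The components are the classes of the \<open>theta_part n h\<close>. For uniqueness,
  \<open>theta_part n\<close> is applied to the difference of two representatives, which stays in
  the graded ideal.\<close>

lemma direct_sum:
  assumes x: "x \<in> carrier dg.P"
  shows "\<exists>!f. (\<forall>n. f n \<in> G n) \<and> finite {n. f n \<noteq> \<zero>\<^bsub>dg.P\<^esub>} \<and>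
    x = (\<Oplus>\<^bsub>dg.P\<^esub>n\<in>{n. f n \<noteq> \<zero>\<^bsub>dg.P\<^esub>}. f n)"
proof -
  obtain h where h: "h \<in> FS" "x = dg.cl h" using x by (elim cases_P)
  show ?thesis
  proof (rule ex1I[of _ "\<lambda>n. dg.cl (theta_part n h)"], intro conjI allI)
    let ?N = "(\<lambda>w. theta_count (letters w)) ` Poly_Mapping.keys h"
    let ?M = "{n. dg.cl (theta_part n h) \<noteq> \<zero>\<^bsub>dg.P\<^esub>}"
    show "dg.cl (theta_part n h) \<in> G n" for n
      unfolding G_eq by (intro imageI IntI theta_part_free_span theta_part_homogeneous h(1))
    have M: "?M \<subseteq> ?N"
    proof
      fix n assume n: "n \<in> ?M"
      have "theta_part n h \<noteq> 0" using n by (auto simp: dg.cl_zero)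
      then obtain w where "Poly_Mapping.lookup (theta_part n h) w \<noteq> 0"
        by (metis lookup_zero poly_mapping_eqI)
      then show "n \<in> ?N"
        by (auto simp: theta_part_def lookup_restrict_words when_def in_keys_iff split: if_splits)
    qed
    then show fin: "finite ?M" using finite_subset by fastforce
    \<comment> \<open>The decomposition sums over nonzero classes only, so components that vanish
      merely modulo the ideal have to be dropped.\<close>
    have "theta_part n h \<in> J" if "n \<in> ?N - ?M" for n
      using that h by (simp add: dg.cl_eq_zero_iff theta_part_free_span)
    then have "sum (\<lambda>n. theta_part n h) (?N - ?M) \<in> J" by (intro ideal_hull_sum)
    moreover have "h = sum (\<lambda>n. theta_part n h) (?N - ?M) + sum (\<lambda>n. theta_part n h) ?M"
      using sum_theta_part[of h] sum.subset_diff[OF M, of "\<lambda>n. theta_part n h"] by simp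
    ultimately have "h - sum (\<lambda>n. theta_part n h) ?M \<in> J" by (metis add_diff_cancel_right')
    then have "x = dg.cl (sum (\<lambda>n. theta_part n h) ?M)"
      using h by (simp add: dg.cl_eq_iff free_span_sum theta_part_free_span)
    also have "\<dots> = (\<Oplus>\<^bsub>dg.P\<^esub>n\<in>?M. dg.cl (theta_part n h))"
      using fin h by (intro dg.cl_finsum[symmetric]) (auto simp: theta_part_free_span)
    finally show "x = (\<Oplus>\<^bsub>dg.P\<^esub>n\<in>?M. dg.cl (theta_part n h))" .
  next
    fix f assume f: "(\<forall>n. f n \<in> G n) \<and> finite {n. f n \<noteq> \<zero>\<^bsub>dg.P\<^esub>} \<and>
      x = (\<Oplus>\<^bsub>dg.P\<^esub>n\<in>{n. f n \<noteq> \<zero>\<^bsub>dg.P\<^esub>}. f n)"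
    let ?M = "{n. f n \<noteq> \<zero>\<^bsub>dg.P\<^esub>}"
    have "\<exists>g. g \<in> FS \<and> g \<in> homogeneous n \<and> f n = dg.cl g" for n
      using f by (auto simp: G_eq)
    then obtain g where g: "\<And>n. g n \<in> FS" "\<And>n. g n \<in> homogeneous n" "\<And>n. f n = dg.cl (g n)"
      by metis
    have "x = dg.cl (sum g ?M)"
      using f g by (simp add: dg.cl_finsum)
    then have hJ: "h - sum g ?M \<in> J"
      using h g by (simp add: dg.cl_eq_iff free_span_sum)
    show "f = (\<lambda>n. dg.cl (theta_part n h))"
    proof
      fix n
      have "theta_part n (sum g ?M) = (\<Sum>m\<in>?M. if m = n then g m else 0)"
        unfolding theta_part_sum using g(2) by (intro sum.cong) (auto simp: theta_part_of_homogeneous)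
      also have "\<dots> = (if n \<in> ?M then g n else 0)" using f by simp
      finally have "theta_part n h - (if n \<in> ?M then g n else 0) \<in> J"
        using theta_part_ideal[OF hJ, of n] by (simp add: theta_part_diff)
      then have "dg.cl (theta_part n h) = dg.cl (if n \<in> ?M then g n else 0)"
        using g(1) h by (simp add: dg.cl_eq_iff theta_part_free_span)
      then show "f n = dg.cl (theta_part n h)" using g(3) by (auto simp: dg.cl_zero)
    qed
  qed
qed

lemma dg_algebra_diff: "dg_algebra dg.P G diff"
proof (intro dg_algebra.intro dg_algebra_axioms.intro)
  show "assoc_algebra dg.P" by (rule dg.P.assoc_algebra_axioms)
  show "submodule (G n) ring_of_type_algebra dg.P" for n
  proof (rule dg.P.scalars.submoduleI)
    show "\<zero>\<^bsub>dg.P\<^esub> \<in> G n" by (auto simp: G_eq dg.cl_zero)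
  qed (auto simp: G_eq dg.cl_uminus dg.cl_add dg.cl_scale intro!: imageI free_span_intros
      homogeneous_add homogeneous_uminus homogeneous_mult[OF homogeneous_const, simplified])
  show "\<one>\<^bsub>dg.P\<^esub> \<in> G 0"
    using homogeneous_const[of 1] by (auto simp: G_eq dg.cl_one)
  show "x \<otimes>\<^bsub>dg.P\<^esub> y \<in> G (m + n)" if "x \<in> G m" "y \<in> G n" for x y m n
    using that by (auto simp: G_eq dg.cl_mult intro!: imageI free_span_mult homogeneous_mult)
  show "diff x \<in> G n" if "x \<in> G (Suc n)" for x n
    using that by (auto simp: G_eq diff_cl diff_FS intro!: imageI diff_free_homogeneous)
  show "diff x = \<zero>\<^bsub>dg.P\<^esub>" if "x \<in> G 0" for x
    using that by (auto simp: G_eq diff_cl diff_free_homogeneous_0 dg.cl_zero)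
  show "diff (diff x) = \<zero>\<^bsub>dg.P\<^esub>" if "x \<in> carrier dg.P" for x
    using that by (elim cases_P) (simp add: diff_cl diff_FS diff_free_diff_free dg.cl_zero)
qed (use direct_sum graded_derivation_diff in auto)

section \<open>The homology\<close>

abbreviation Cyc where "Cyc \<equiv> cycles dg.P diff"
abbreviation Bd where "Bd \<equiv> boundaries dg.P diff"
abbreviation Zalg where "Zalg \<equiv> dg.P\<lparr>carrier := Cyc\<rparr>"
abbreviation Icyc where "Icyc \<equiv> genideal aff.P {aff.cl Pol}"
abbreviation Q where "Q \<equiv> quotient_algebra aff.P Icyc"

lemma cycles_eq: "Cyc = dg.cl ` {f \<in> FS. diff_free Qs f \<in> J}"
proof -
  have "diff (dg.cl f) = \<zero>\<^bsub>dg.P\<^esub> \<longleftrightarrow> diff_free Qs f \<in> J" if "f \<in> FS" for f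
    using that by (simp add: diff_cl dg.cl_eq_zero_iff diff_FS)
  then show ?thesis unfolding cycles_def dg.carrier_P by blast
qed

lemma boundaries_eq: "Bd = dg.cl ` diff_free Qs ` FS"
  by (auto simp: boundaries_def dg.carrier_P diff_cl image_image)

text \<open>The Leibniz rule needs a homogeneous left factor. Since the ideal is graded and the
  differential lowers degree by one, each component of \<open>f\<close> is itself a cycle modulo the
  ideal.\<close>

lemma diff_mult_J:
  assumes "diff_free Qs f \<in> J" "diff_free Qs g \<in> J" "f \<in> FS" "g \<in> FS"
  shows "diff_free Qs (f * g) \<in> J"
proof -
  have "diff_free Qs (theta_part n f) \<in> J" for n
  proof (cases n)
    case 0
    then show ?thesis using theta_part_homogeneous[of 0 f] by (simp add: diff_free_homogeneous_0 ideal_hull.zero)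
  next
    case (Suc m)
    have "theta_part m (diff_free Qs (theta_part i f))
        = (if i = Suc m then diff_free Qs (theta_part i f) else 0)" for i
    proof (cases i)
      case 0
      then show ?thesis using theta_part_homogeneous[of 0 f]
        by (simp add: diff_free_homogeneous_0 theta_part_def)
    next
      case (Suc j)
      then show ?thesis
        using theta_part_of_homogeneous[OF diff_free_homogeneous[OF theta_part_homogeneous[of "Suc j" f]], of m Qs]
        by simp
    qed
    \<comment> \<open>Inserting n guarantees that the n-th summand is present even if
      \<open>f\<close> has no word of that degree.\<close>
    moreover define N where "N = insert n ((\<lambda>w. theta_count (letters w)) ` Poly_Mapping.keys f)"
    have N: "(\<Sum>i\<in>N. theta_part i f) = f"
    proof -
      have "(\<Sum>i\<in>N. theta_part i f) = (\<Sum>i\<in>(\<lambda>w. theta_count (letters w)) ` Poly_Mapping.keys f. theta_part i f)"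
        unfolding N_def
      proof (rule sum.mono_neutral_right)
        show "\<forall>i \<in> insert n ((\<lambda>w. theta_count (letters w)) ` Poly_Mapping.keys f)
            - (\<lambda>w. theta_count (letters w)) ` Poly_Mapping.keys f. theta_part i f = 0"
        proof (intro ballI poly_mapping_eqI)
          fix i w
          assume "i \<in> insert n ((\<lambda>w. theta_count (letters w)) ` Poly_Mapping.keys f)
            - (\<lambda>w. theta_count (letters w)) ` Poly_Mapping.keys f"
          then have "w \<notin> Poly_Mapping.keys f" if "theta_count (letters w) = i" using that by blast
          then show "Poly_Mapping.lookup (theta_part i f) w = Poly_Mapping.lookup 0 w"
            by (simp add: theta_part_def lookup_restrict_words when_def in_keys_iff)
        qed
      qed auto
      then show ?thesis by (simp add: sum_theta_part)
    qed
    have "theta_part m (diff_free Qs (\<Sum>i\<in>N. theta_part i f))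
        = (\<Sum>i\<in>N. theta_part m (diff_free Qs (theta_part i f)))"
      by (simp add: diff_free_sum theta_part_sum)
    then have "theta_part m (diff_free Qs f) = (\<Sum>i\<in>N. theta_part m (diff_free Qs (theta_part i f)))"
      unfolding N .
    ultimately have "theta_part m (diff_free Qs f) = diff_free Qs (theta_part n f)"
      using Suc by (simp add: N_def)
    then show ?thesis using theta_part_ideal[OF assms(1), of m] by simp
  qed
  then have *: "diff_free Qs (theta_part n f * g) \<in> J" for n
    using assms(2) unfolding diff_free_mult[OF theta_part_homogeneous]
    by (intro ideal_hull_add ideal_hull_mult_left ideal_hull_mult_right) auto
  have "diff_free Qs ((\<Sum>n\<in>(\<lambda>w. theta_count (letters w)) ` Poly_Mapping.keys f. theta_part n f) * g) \<in> J"
    unfolding sum_distrib_right diff_free_sum by (intro ideal_hull_sum *)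
  then show ?thesis by (simp add: sum_theta_part)
qed

lemma assoc_algebra_cycles: "assoc_algebra Zalg"
proof (rule assoc_algebraI)
  have "subring Cyc dg.P"
  proof (rule dg.P.subringI)
    show "Cyc \<subseteq> carrier dg.P" by (auto simp: cycles_def)
    show "\<one>\<^bsub>dg.P\<^esub> \<in> Cyc"
      using diff_free_homogeneous_0[OF homogeneous_const[of 1], of Qs]
      by (auto simp: cycles_eq dg.cl_one ideal_hull.zero)
    show "\<ominus>\<^bsub>dg.P\<^esub> x \<in> Cyc" if "x \<in> Cyc" for x
      using that by (auto simp: cycles_eq dg.cl_uminus free_span_uminus diff_free_uminus ideal_hull_uminus)
    show "x \<otimes>\<^bsub>dg.P\<^esub> y \<in> Cyc" if "x \<in> Cyc" "y \<in> Cyc" for x y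
      using that by (auto simp: cycles_eq dg.cl_mult free_span_mult diff_mult_J)
    show "x \<oplus>\<^bsub>dg.P\<^esub> y \<in> Cyc" if "x \<in> Cyc" "y \<in> Cyc" for x y
      using that by (auto simp: cycles_eq dg.cl_add free_span_add diff_free_add ideal_hull_add)
  qed
  then show "ring Zalg" by (rule dg.P.subring_is_ring)
  have sub: "x \<in> carrier dg.P" if "x \<in> carrier Zalg" for x using that by (simp add: cycles_def)
  show "c \<odot>\<^bsub>Zalg\<^esub> x \<in> carrier Zalg" if "x \<in> carrier Zalg" for c x
    using that by (auto simp: cycles_eq dg.cl_scale free_span_mult diff_free_mult_0[OF homogeneous_const]
        ideal_hull_mult_left)
  show "c \<odot>\<^bsub>Zalg\<^esub> (x \<otimes>\<^bsub>Zalg\<^esub> y) = (c \<odot>\<^bsub>Zalg\<^esub> x) \<otimes>\<^bsub>Zalg\<^esub> y"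
    if "x \<in> carrier Zalg" "y \<in> carrier Zalg" for c x y
    using dg.P.smult_mult_left[of x y c] sub that by simp
  show "c \<odot>\<^bsub>Zalg\<^esub> (x \<otimes>\<^bsub>Zalg\<^esub> y) = x \<otimes>\<^bsub>Zalg\<^esub> (c \<odot>\<^bsub>Zalg\<^esub> y)"
    if "x \<in> carrier Zalg" "y \<in> carrier Zalg" for c x y
    using dg.P.smult_mult_right[of x y c] sub that by simp
qed (simp_all add: cycles_def dg.P.scale_l_distr dg.P.scale_r_distr dg.P.scale_assoc dg.P.scale_one)

section \<open>The cyclotomic ideal and the boundaries in degree zero\<close>

lemma Icyc_ideal: "ideal Icyc aff.P"
  by (rule aff.P.genideal_ideal) (simp add: Pol_AS)

text \<open>Imposing the relations in two stages or at once gives the same ideal; both inclusions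
  follow from minimality of generated ideals, through the preimage and the image under the class
  map.\<close>

lemma Icyc_iff:
  assumes g: "g \<in> AS"
  shows "aff.cl g \<in> Icyc \<longleftrightarrow> g \<in> ideal_hull (insert Pol (affine_relators d q))"
proof -
  let ?R = "insert Pol (affine_relators d q)"
  have R: "?R \<subseteq> free_span (affine_gens d)" using aff.relators Pol_AS by simp
  interpret I: ideal Icyc aff.P by (rule Icyc_ideal)
  have aff_sub: "ideal_hull (affine_relators d q) \<subseteq> ideal_hull ?R"
    by (intro ideal_hull_subset) (auto intro: ideal_hull_incl)
  have 1: "ideal {f \<in> AS. aff.cl f \<in> Icyc} (free_algebra (affine_gens d))"
  proof (rule idealI[OF ring_free_algebra])
    show "subgroup {f \<in> AS. aff.cl f \<in> Icyc} (add_monoid (free_algebra (affine_gens d)))"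
    proof (rule group.subgroupI[OF aff.F.add.is_group])
      show "inv\<^bsub>add_monoid (free_algebra (affine_gens d))\<^esub> a \<in> {f \<in> AS. aff.cl f \<in> Icyc}"
        if "a \<in> {f \<in> AS. aff.cl f \<in> Icyc}" for a
        using that aff.free_uminus[of a] I.a_inv_closed[of "aff.cl a"] unfolding a_inv_def[of "free_algebra (affine_gens d)"]
        by (auto simp del: free_algebra_simps simp: free_span_uminus aff.cl_uminus)
      have "0 \<in> {f \<in> AS. aff.cl f \<in> Icyc}" using I.zero_closed by (simp add: aff.cl_zero)
      then show "{f \<in> AS. aff.cl f \<in> Icyc} \<noteq> {}" by blast
    qed (use I.a_closed in \<open>auto simp: carrier_free_algebra free_span_add simp flip: aff.cl_add\<close>)
  qed (use I.I_l_closed I.I_r_closed in \<open>auto simp: carrier_free_algebra free_span_mult simp flip: aff.cl_mult\<close>)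
  have "?R \<subseteq> {f \<in> AS. aff.cl f \<in> Icyc}"
  proof (intro subsetI CollectI conjI)
    fix r assume r: "r \<in> ?R"
    then show "r \<in> AS" using R by blast
    show "aff.cl r \<in> Icyc"
    proof (cases "r = Pol")
      case True
      then show ?thesis using aff.P.genideal_self'[of "aff.cl Pol"] Pol_AS by simp
    next
      case False
      then have "aff.cl r = \<zero>\<^bsub>aff.P\<^esub>"
        using r \<open>r \<in> AS\<close> by (auto simp: aff.cl_eq_zero_iff ideal_hull_incl)
      then show ?thesis using I.zero_closed by simp
    qed
  qed
  then have sub1: "relation_ideal (affine_gens d) ?R \<subseteq> {f \<in> AS. aff.cl f \<in> Icyc}"
    unfolding relation_ideal_def by (rule aff.F.genideal_minimal[OF 1])
  have 2: "ideal (aff.cl ` (ideal_hull ?R \<inter> AS)) aff.P"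
  proof (rule idealI)
    show "ring aff.P" by (rule aff.P.ring_axioms)
    show "subgroup (aff.cl ` (ideal_hull ?R \<inter> AS)) (add_monoid aff.P)"
    proof (rule group.subgroupI[OF aff.P.add.is_group])
      fix a assume "a \<in> aff.cl ` (ideal_hull ?R \<inter> AS)"
      then have "\<ominus>\<^bsub>aff.P\<^esub> a \<in> aff.cl ` (ideal_hull ?R \<inter> AS)"
        by (auto simp: aff.cl_uminus intro!: imageI free_span_uminus ideal_hull_uminus)
      then show "inv\<^bsub>add_monoid aff.P\<^esub> a \<in> aff.cl ` (ideal_hull ?R \<inter> AS)"
        by (simp add: a_inv_def)
    next
      have "aff.cl 0 \<in> aff.cl ` (ideal_hull ?R \<inter> AS)" by (simp add: ideal_hull.zero)
      then show "aff.cl ` (ideal_hull ?R \<inter> AS) \<noteq> {}" by blast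
    qed (auto simp: aff.cl_add intro!: imageI ideal_hull_add free_span_add)
  next
    fix a x assume "a \<in> aff.cl ` (ideal_hull ?R \<inter> AS)" "x \<in> carrier aff.P"
    then obtain f h where f: "f \<in> ideal_hull ?R" "f \<in> AS" "a = aff.cl f" and h: "h \<in> AS" "x = aff.cl h"
      by (auto simp: aff.carrier_P)
    show "x \<otimes>\<^bsub>aff.P\<^esub> a \<in> aff.cl ` (ideal_hull ?R \<inter> AS)" "a \<otimes>\<^bsub>aff.P\<^esub> x \<in> aff.cl ` (ideal_hull ?R \<inter> AS)"
      using f h by (auto simp: aff.cl_mult intro!: imageI free_span_mult
          intro: ideal_hull_mult_left ideal_hull_mult_right)
  qed
  have sub2: "Icyc \<subseteq> aff.cl ` (ideal_hull ?R \<inter> AS)"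
    by (rule aff.P.genideal_minimal[OF 2]) (auto intro: ideal_hull_incl Pol_AS)
  have lift: "g \<in> ideal_hull ?R" if "aff.cl g = aff.cl h" "h \<in> ideal_hull ?R" "h \<in> AS" for h
  proof -
    have "g - h \<in> ideal_hull ?R" using that g aff_sub by (auto simp: aff.cl_eq_iff)
    from ideal_hull_add[OF this that(2)] show ?thesis by simp
  qed
  show ?thesis
  proof
    assume "aff.cl g \<in> Icyc"
    then have "aff.cl g \<in> aff.cl ` (ideal_hull ?R \<inter> AS)" using sub2 by blast
    then show "g \<in> ideal_hull ?R" using lift by blast
  next
    assume "g \<in> ideal_hull ?R"
    then have "g \<in> relation_ideal (affine_gens d) ?R" using g by (simp add: relation_ideal_eq[OF R])
    then show "aff.cl g \<in> Icyc" using sub1 by blast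
  qed
qed

text \<open>The differential is linear over degree zero from both sides, so affine elements that are
  boundaries form a two-sided ideal; it contains the cyclotomic polynomial as the differential of
  \<theta>.\<close>

lemma cyclotomic_ideal_boundary:
  assumes "g \<in> ideal_hull (insert Pol (affine_relators d q))" "g \<in> AS"
  shows "\<exists>h\<in>FS. g - diff_free Qs h \<in> J"
proof -
  let ?R = "insert Pol (affine_relators d q)"
  let ?B = "{g \<in> AS. \<exists>h\<in>FS. g - diff_free Qs h \<in> J}"
  have R: "?R \<subseteq> free_span (affine_gens d)" using aff.relators Pol_AS by simp
  have "ideal ?B (free_algebra (affine_gens d))"
  proof (rule idealI[OF ring_free_algebra])
    show "subgroup ?B (add_monoid (free_algebra (affine_gens d)))"
    proof (rule group.subgroupI[OF aff.F.add.is_group])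
      fix a :: "(hecke_gen, 'k) free_alg" assume a: "a \<in> ?B"
      then obtain h where h: "h \<in> FS" "a - diff_free Qs h \<in> J" by blast
      have "- a - diff_free Qs (- h) \<in> J"
        using ideal_hull_uminus[OF h(2)] by (simp add: diff_free_uminus)
      moreover have "inv\<^bsub>add_monoid (free_algebra (affine_gens d))\<^esub> a = - a"
        using aff.free_uminus[of a] a unfolding a_inv_def by simp
      ultimately show "inv\<^bsub>add_monoid (free_algebra (affine_gens d))\<^esub> a \<in> ?B"
        using a h(1) by (auto simp: free_span_uminus simp del: diff_minus_eq_add intro!: bexI[of _ "- h"])
    next
      fix a b :: "(hecke_gen, 'k) free_alg" assume ab: "a \<in> ?B" "b \<in> ?B"
      then obtain h h' where h: "h \<in> FS" "a - diff_free Qs h \<in> J" "h' \<in> FS" "b - diff_free Qs h' \<in> J"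
        by blast
      have "(a + b) - diff_free Qs (h + h') \<in> J"
        using ideal_hull_add[OF h(2,4)] by (simp add: diff_free_add algebra_simps)
      then show "a \<otimes>\<^bsub>add_monoid (free_algebra (affine_gens d))\<^esub> b \<in> ?B"
        using ab h by (auto simp: free_span_add intro!: bexI[of _ "h + h'"])
    next
      have "0 \<in> ?B" using ideal_hull.zero by (auto intro!: bexI[of _ 0])
      then show "?B \<noteq> {}" by blast
    qed (auto simp: carrier_free_algebra)
  next
    fix a x :: "(hecke_gen, 'k) free_alg" assume a: "a \<in> ?B" and "x \<in> carrier (free_algebra (affine_gens d))"
    then have x: "x \<in> AS" by (simp add: carrier_free_algebra)
    from a obtain h where h: "h \<in> FS" "a - diff_free Qs h \<in> J" by blast
    have "x * a - diff_free Qs (x * h) \<in> J"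
      using ideal_hull_mult_left[OF h(2), of x]
      by (simp add: diff_free_mult_0[OF homogeneous_affine[OF x]] right_diff_distrib)
    then show "x \<otimes>\<^bsub>free_algebra (affine_gens d)\<^esub> a \<in> ?B"
      using a h x by (auto simp: free_span_mult AS_FS intro!: bexI[of _ "x * h"])
    have "a * x - diff_free Qs (h * x) \<in> J"
      using ideal_hull_mult_right[OF h(2), of x]
      by (simp add: diff_free_mult_right_0[OF homogeneous_affine[OF x]] left_diff_distrib)
    then show "a \<otimes>\<^bsub>free_algebra (affine_gens d)\<^esub> x \<in> ?B"
      using a h x by (auto simp: free_span_mult AS_FS intro!: bexI[of _ "h * x"])
  qed
  moreover have "?R \<subseteq> ?B"
  proof (intro subsetI CollectI conjI)
    fix r assume r: "r \<in> ?R"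
    then show "r \<in> AS" using R by blast
    show "\<exists>h\<in>FS. r - diff_free Qs h \<in> J"
    proof (cases "r = Pol")
      case True
      then show ?thesis by (intro bexI[of _ gTheta]) (auto simp: diff_free_theta ideal_hull.zero)
    next
      case False
      then have "r \<in> J" using r by (auto simp: dg_relators_def intro: ideal_hull_incl)
      then show ?thesis by (intro bexI[of _ 0]) auto
    qed
  qed
  ultimately have "relation_ideal (affine_gens d) ?R \<subseteq> ?B"
    unfolding relation_ideal_def by (rule aff.F.genideal_minimal)
  then show ?thesis using assms by (auto simp: relation_ideal_eq[OF R])
qed

lemma acyclic_FS:
  "f \<in> FS \<Longrightarrow> theta_free f = 0 \<Longrightarrow> diff_free Qs f \<in> J \<Longrightarrow> \<exists>g\<in>FS. f - diff_free Qs g \<in> J"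
  using acyclic[OF infinite_alg_closed_field q, of f d Qs] by (simp add: dgens_eq[OF d])

text \<open>The augmentation sending \<theta> to 0, followed by the quotient map to the cyclotomic
  algebra. It does not depend on the representative, by
  \<open>theta_free_ideal_affine\<close>.\<close>

definition proj :: "(hecke_gen, 'k) free_alg set \<Rightarrow> (hecke_gen, 'k) free_alg set set" where
  "proj x = Icyc +>\<^bsub>aff.P\<^esub> aff.cl (theta_free (SOME f. f \<in> FS \<and> dg.cl f = x))"

lemma proj_cl:
  assumes f: "f \<in> FS" shows "proj (dg.cl f) = Icyc +>\<^bsub>aff.P\<^esub> aff.cl (theta_free f)"
proof -
  define g where "g = (SOME g. g \<in> FS \<and> dg.cl g = dg.cl f)"
  have g: "g \<in> FS \<and> dg.cl g = dg.cl f"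
    unfolding g_def by (rule someI[of _ f]) (simp add: f)
  then have "theta_free (g - f) \<in> ideal_hull (affine_relators d q)"
    using f by (intro theta_free_ideal_affine) (simp flip: dg.cl_eq_iff)
  then have "aff.cl (theta_free g) = aff.cl (theta_free f)"
    using f g by (simp add: aff.cl_eq_iff theta_free_AS theta_free_diff)
  then show ?thesis by (simp add: proj_def flip: g_def)
qed

lemma proj_ring_hom: "proj \<in> ring_hom Zalg Q"
proof (rule ring_hom_memI)
  note simps = aff.P.quotient_algebra_simps aff.P.quotient_algebra_mult[OF Icyc_ideal]
    aff.P.quotient_algebra_add[OF Icyc_ideal] proj_cl theta_free_AS
  show "proj x \<in> carrier Q" if "x \<in> carrier Zalg" for x
    using that by (auto simp: cycles_eq simps)
  show "proj (x \<otimes>\<^bsub>Zalg\<^esub> y) = proj x \<otimes>\<^bsub>Q\<^esub> proj y" if "x \<in> carrier Zalg" "y \<in> carrier Zalg" for x y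
    using that by (auto simp: cycles_eq simps dg.cl_mult aff.cl_mult theta_free_mult free_span_mult)
  show "proj (x \<oplus>\<^bsub>Zalg\<^esub> y) = proj x \<oplus>\<^bsub>Q\<^esub> proj y" if "x \<in> carrier Zalg" "y \<in> carrier Zalg" for x y
    using that by (auto simp: cycles_eq simps dg.cl_add aff.cl_add theta_free_add free_span_add)
  have "theta_free 1 = (1 :: (hecke_gen, 'k) free_alg)"
    using theta_free_ident[OF homogeneous_const[of 1]] by simp
  then show "proj \<one>\<^bsub>Zalg\<^esub> = \<one>\<^bsub>Q\<^esub>"
    by (simp add: simps dg.cl_one aff.cl_one)
qed

text \<open>A cycle is a boundary exactly when its degree-zero part lies in the cyclotomic ideal:
  that part is handled by \<open>cyclotomic_ideal_boundary\<close>, the rest by acyclicity.\<close>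

lemma proj_kernel: "a_kernel Zalg Q proj = Bd"
proof -
  have "dg.cl f \<in> Bd \<longleftrightarrow> proj (dg.cl f) = \<zero>\<^bsub>Q\<^esub>" if f: "f \<in> FS" "diff_free Qs f \<in> J" for f
  proof -
    interpret I: ideal Icyc aff.P by (rule Icyc_ideal)
    have "proj (dg.cl f) = \<zero>\<^bsub>Q\<^esub> \<longleftrightarrow> aff.cl (theta_free f) \<in> Icyc"
      using f I.a_rcos_const I.a_rcos_self[of "aff.cl (theta_free f)"]
      by (auto simp: proj_cl aff.P.quotient_algebra_simps theta_free_AS)
    also have "\<dots> \<longleftrightarrow> theta_free f \<in> ideal_hull (insert Pol (affine_relators d q))"
      using f by (simp add: Icyc_iff theta_free_AS)
    also have "\<dots> \<longleftrightarrow> (\<exists>g\<in>FS. f - diff_free Qs g \<in> J)"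
    proof
      assume "theta_free f \<in> ideal_hull (insert Pol (affine_relators d q))"
      then obtain h where h: "h \<in> FS" "theta_free f - diff_free Qs h \<in> J"
        using cyclotomic_ideal_boundary f theta_free_AS by blast
      \<comment> \<open>Removing the degree-zero part keeps the cycle condition, which makes
        acyclicity applicable.\<close>
      have "diff_free Qs (f - theta_free f) = diff_free Qs f"
        by (simp add: diff_free_diff diff_free_homogeneous_0[OF theta_free_homogeneous])
      then obtain g where g: "g \<in> FS" "f - theta_free f - diff_free Qs g \<in> J"
        using acyclic_FS[of "f - theta_free f"] f
        by (auto simp: theta_free_diff theta_free_idem free_span_diff theta_free_free_span)
      have "f - diff_free Qs (g + h) \<in> J"
        using ideal_hull_add[OF g(2) h(2)] by (simp add: diff_free_add algebra_simps)
      then show "\<exists>g\<in>FS. f - diff_free Qs g \<in> J" using g h free_span_add by blast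
    next
      assume "\<exists>g\<in>FS. f - diff_free Qs g \<in> J"
      then obtain g where g: "g \<in> FS" "f - diff_free Qs g \<in> J" by blast
      have sub: "ideal_hull S \<subseteq> ideal_hull (insert Pol (affine_relators d q))"
        if "S \<subseteq> insert Pol (affine_relators d q)" for S
        using that by (intro ideal_hull_subset) (auto intro: ideal_hull_incl)
      have "theta_free f - theta_free (diff_free Qs g) \<in> ideal_hull (insert Pol (affine_relators d q))"
        using theta_free_ideal_affine[OF g(2)] sub[of "affine_relators d q"] by (auto simp: theta_free_diff)
      moreover have "theta_free (diff_free Qs g) \<in> ideal_hull (insert Pol (affine_relators d q))"
        using theta_free_diff_free_ideal[of Qs g] sub[of "{Pol}"] by auto
      ultimately have "theta_free f - theta_free (diff_free Qs g) + theta_free (diff_free Qs g)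
          \<in> ideal_hull (insert Pol (affine_relators d q))"
        by (rule ideal_hull_add)
      then show "theta_free f \<in> ideal_hull (insert Pol (affine_relators d q))" by simp
    qed
    also have "\<dots> \<longleftrightarrow> (\<exists>g\<in>FS. dg.cl f = dg.cl (diff_free Qs g))"
      using f by (simp add: dg.cl_eq_iff diff_FS)
    also have "\<dots> \<longleftrightarrow> dg.cl f \<in> Bd" unfolding boundaries_eq by blast
    finally show ?thesis by blast
  qed
  moreover have "Bd \<subseteq> Cyc"
    by (auto simp: boundaries_eq cycles_eq diff_FS diff_free_diff_free ideal_hull.zero intro!: imageI)
  ultimately show ?thesis
    unfolding a_kernel_def' by (auto simp: cycles_eq)
qed

lemma homology_iso: "\<exists>h. h \<in> alg_iso (homology dg.P diff) Q"
proof -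
  interpret Z: assoc_algebra Zalg by (rule assoc_algebra_cycles)
  have "proj ` carrier Zalg = carrier Q"
  proof
    show "proj ` carrier Zalg \<subseteq> carrier Q" using proj_ring_hom by (auto simp: ring_hom_def)
    show "carrier Q \<subseteq> proj ` carrier Zalg"
    proof
      fix y assume "y \<in> carrier Q"
      then obtain g where g: "g \<in> AS" "y = Icyc +>\<^bsub>aff.P\<^esub> aff.cl g"
        by (auto simp: aff.P.quotient_algebra_simps aff.carrier_P)
      have "dg.cl g \<in> Cyc" using g AS_FS
        by (auto simp: cycles_eq diff_free_homogeneous_0[OF homogeneous_affine] ideal_hull.zero)
      moreover have "proj (dg.cl g) = y"
        using g by (simp add: proj_cl AS_FS theta_free_ident[OF homogeneous_affine])
      ultimately show "y \<in> proj ` carrier Zalg" by force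
    qed
  qed
  moreover have "proj (c \<odot>\<^bsub>Zalg\<^esub> x) = c \<odot>\<^bsub>Q\<^esub> proj x" if "x \<in> carrier Zalg" for c x
    using that by (auto simp: cycles_eq proj_cl dg.cl_scale aff.cl_scale free_span_mult theta_free_mult
        theta_free_ident[OF homogeneous_const] theta_free_AS aff.P.quotient_algebra_scale[OF Icyc_ideal])
  ultimately have "\<exists>g. g \<in> alg_iso (quotient_algebra Zalg (a_kernel Zalg Q proj)) Q"
    using aff.P.ring_quotient_algebra[OF Icyc_ideal] proj_ring_hom
    by (intro Z.alg_iso_quotient_kernel)
  then show ?thesis by (simp add: proj_kernel homology_def)
qed

text \<open>A homogeneous cycle of positive degree has no degree-zero part, so acyclicity makes it a
  boundary.\<close>

lemma homology_component_zero:
  assumes "n \<noteq> 0"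
  shows "homology_component dg.P G diff n = {\<zero>\<^bsub>homology dg.P diff\<^esub>}"
proof -
  interpret Z: assoc_algebra Zalg by (rule assoc_algebra_cycles)
  interpret h: ring_hom_ring Zalg Q proj
    using Z.ring_axioms aff.P.ring_quotient_algebra[OF Icyc_ideal] proj_ring_hom by (rule ring_hom_ringI2)
  interpret Bd: ideal Bd Zalg using h.kernel_is_ideal by (simp add: proj_kernel)
  have "Bd +>\<^bsub>dg.P\<^esub> z = Bd" if "z \<in> G n \<inter> Cyc" for z
  proof -
    from that obtain f where f: "f \<in> FS" "f \<in> homogeneous n" "z = dg.cl f" by (auto simp: G_eq)
    have "diff_free Qs f \<in> J"
      using that f by (simp add: cycles_def diff_cl dg.cl_eq_zero_iff diff_FS)
    moreover have "theta_free f = 0"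
      using theta_part_of_homogeneous[OF f(2), of 0] assms
      by (simp add: theta_part_def theta_free_def count_list_0_iff)
    ultimately obtain g where g: "g \<in> FS" "f - diff_free Qs g \<in> J"
      using acyclic_FS[OF f(1)] by blast
    then have "z = dg.cl (diff_free Qs g)" using f by (simp add: dg.cl_eq_iff diff_FS)
    then have "z \<in> Bd" using g(1) unfolding boundaries_eq by blast
    then have "Bd +>\<^bsub>Zalg\<^esub> z = Bd" by (rule Bd.a_rcos_const)
    then show ?thesis by (simp add: a_r_coset_def')
  qed
  moreover have "\<zero>\<^bsub>dg.P\<^esub> \<in> G n \<inter> Cyc"
    by (auto simp: G_eq cycles_eq dg.cl_zero ideal_hull.zero intro!: imageI)
  ultimately have "homology_component dg.P G diff n = {Bd}"
    unfolding homology_component_def by blast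
  then show ?thesis by (simp add: homology_def Z.quotient_algebra_simps)
qed

lemma cyclotomic_hecke_eq: "cyclotomic_hecke d q Qs = Q"
proof -
  have "gX 1 \<in> AS" using d by (simp add: GenX_in)
  then show ?thesis
    by (simp add: cyclotomic_hecke_def affine_hecke_def affine_hecke_X1_def aff.cl_cyclotomic)
qed

end

theorem proposition4p18:
  fixes q :: "'k::alg_closed_field" and d l :: nat and Qs :: "'k list"
  assumes "q \<noteq> 0" and "q \<noteq> 1" and "d \<ge> 1" and "l \<ge> 1"
    and "length Qs = l" and "0 \<notin> set Qs"
  shows "is_dg_differential d q Qs (dg_differential d q Qs) \<and>
    dg_algebra (dg_hecke d q) (dg_degree d q) (dg_differential d q Qs) \<and>
    (\<forall>n. n \<noteq> 0 \<longrightarrow>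
       homology_component (dg_hecke d q) (dg_degree d q) (dg_differential d q Qs) n =
         {\<zero>\<^bsub>homology (dg_hecke d q) (dg_differential d q Qs)\<^esub>}) \<and>
    (\<exists>h. h \<in> alg_iso (homology (dg_hecke d q) (dg_differential d q Qs)) (cyclotomic_hecke d q Qs))"
proof -
  interpret dg_hecke_algebra q d Qs by unfold_locales (use assms in auto)
  show ?thesis
    unfolding dg_differential_eq cyclotomic_hecke_eq dg_hecke_def
    using is_dg_differential_diff dg_algebra_diff homology_component_zero homology_iso by blast
qed

end
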